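(* Let $\Omega\subset\mathbb{R}^n$ be a bounded domain with smooth boundary, let $\rho,a,b,d>0$, $\eta\in\mathbb{R}\setminus\{0\}$ and $c<0$. Consider the system $$\rho u_{tt}=-c\Delta^2u+\eta\Delta\theta,\qquad a\theta_t=b\Delta\theta-d\Delta^2\theta-\eta\Delta u_t\quad\text{in }\Omega,\ t>0,$$ with boundary conditions $u=\Delta u=\theta=\Delta\theta=0$ on $\partial\Omega$ and initial conditions $u(\cdot,0)=u^0$, $u_t(\cdot,0)=v^0$, $\theta(\cdot,0)=\theta^0$. Then: 1. There exists at most one solution. 2. If $(u,\theta)$ is a solution on $[0,\infty)$ such that $E(0)<0$, or such that $E(0)=0$ and $\dot{\mathscr F}(0)>0$, then it is exponentially unstable. Here $E$, $\mathscr F$ and "exponentially unstable" are as defined in the context.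
   Context: Functions are real-valued. $H_*^4(\Omega)=\{w\in H^4(\Omega): w=\Delta w=0\text{ on }\partial\Omega\}$. A solution on a time interval $I=[0,t_1]$ or $I=[0,\infty)$ is a strong solution: $u\in C^2(I;L^2(\Omega))\cap C^1(I;H^2(\Omega)\cap H_0^1(\Omega))\cap C(I;H_*^4(\Omega))$, $\theta\in C^1(I;L^2(\Omega))\cap C(I;H_*^4(\Omega))$, with the equations holding in $L^2(\Omega)$. Energy: $E(t)=\frac12\int_\Omega(\rho|u_t|^2+c|\Delta u|^2+a|\theta|^2)\,d\Omega$. Let $\alpha(x,t)=\int_0^t\theta(x,s)\,ds$, let $\Phi$ be the solution of $b\Delta\Phi-d\Delta^2\Phi=a\theta^0+\eta\Delta u^0$ in $\Omega$ with $\Phi=\Delta\Phi=0$ on $\partial\Omega$, and let $\Psi=\alpha+\Phi$. For constants $\omega,t_0\ge0$ put $$\mathscr F(t)=\int_\Omega\rho u^2\,d\Omega+\int_0^t\int_\Omega\big(b|\nabla\Psi|^2+d|\Delta\Psi|^2\big)\,d\Omega\,ds+\omega(t+t_0)^2.$$ In part 2, $\omega=-E(0)$ is used; in particular $\omega=0$ when $E(0)=0$, so that then $\dot{\mathscr F}(0)=2\int_\Omega\rho u^0v^0\,d\Omega+\int_\Omega(b|\nabla\Phi|^2+d|\Delta\Phi|^2)\,d\Omega$. The solution is called exponentially unstable if, for this $\omega$ and some $t_0\ge0$, there are constants $C_1>0$, $\kappa>0$, $C_2\ge0$ such that $\mathscr F(t)\ge C_1e^{\kappa t}-C_2$ for all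 $t\ge0$. *)

theory Defs
  imports "HOL-Analysis.Analysis"
begin

text \<open>A multi-index is a list of basis vectors, to be differentiated along one after the other.
  Different orderings of one multi-index are therefore listed separately; for Sobolev spaces this
  only replaces the norm by an equivalent one.\<close>

primrec partials :: "'a::euclidean_space list \<Rightarrow> ('a \<Rightarrow> real) \<Rightarrow> 'a \<Rightarrow> real" where
  "partials [] f = f"
| "partials (i # \<beta>) f = (\<lambda>x. frechet_derivative (partials \<beta> f) (at x) i)"

definition multi_indices :: "nat \<Rightarrow> 'a::euclidean_space list set" where
  "multi_indices k = {\<beta>. set \<beta> \<subseteq> Basis \<and> length \<beta> \<le> k}"

text \<open>For open \<open>S\<close> this is \<open>C\<^sup>\<infinity>(S)\<close>: differentiability of all iterated partial derivatives makes
  them all continuous.\<close>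

definition smooth_on :: "'a::euclidean_space set \<Rightarrow> ('a \<Rightarrow> real) \<Rightarrow> bool" where
  "smooth_on S f \<longleftrightarrow> (\<forall>\<beta>. set \<beta> \<subseteq> Basis \<longrightarrow> (\<forall>x\<in>S. partials \<beta> f differentiable (at x)))"

definition test_function :: "'a::euclidean_space set \<Rightarrow> ('a \<Rightarrow> real) \<Rightarrow> bool" where
  "test_function \<Omega> \<phi> \<longleftrightarrow> smooth_on UNIV \<phi> \<and> compact (closure {x. \<phi> x \<noteq> 0}) \<and> closure {x. \<phi> x \<noteq> 0} \<subseteq> \<Omega>"

text \<open>Smoothness of the boundary is expressed by local defining functions; since the gradient of
  \<open>g\<close> does not vanish, the frontier of \<open>\<Omega>\<close> inside \<open>U\<close> is the hypersurface \<open>g = 0\<close>, with \<open>\<Omega>\<close> on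
  one side of it.\<close>

definition bounded_smooth_domain :: "'a::euclidean_space set \<Rightarrow> bool" where
  "bounded_smooth_domain \<Omega> \<longleftrightarrow>
     open \<Omega> \<and> connected \<Omega> \<and> \<Omega> \<noteq> {} \<and> bounded \<Omega> \<and>
     (\<forall>p\<in>frontier \<Omega>. \<exists>U g. open U \<and> p \<in> U \<and> smooth_on U g \<and>
        (\<forall>x\<in>U. \<exists>i\<in>Basis. partials [i] g x \<noteq> 0) \<and> \<Omega> \<inter> U = {x\<in>U. g x < 0})"

text \<open>Elements of \<open>L\<^sup>2(\<Omega>)\<close> are represented by functions on the whole space; values outside \<open>\<Omega>\<close> and
  on null sets are irrelevant, and equality in \<open>L\<^sup>2(\<Omega>)\<close> is equality almost everywhere on \<open>\<Omega>\<close>.\<close>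

definition L2 :: "'a::euclidean_space set \<Rightarrow> ('a \<Rightarrow> real) set" where
  "L2 \<Omega> = {f. f \<in> borel_measurable (lebesgue_on \<Omega>) \<and> integrable (lebesgue_on \<Omega>) (\<lambda>x. (f x)\<^sup>2)}"

definition L2_norm :: "'a::euclidean_space set \<Rightarrow> ('a \<Rightarrow> real) \<Rightarrow> real" where
  "L2_norm \<Omega> f = sqrt (\<integral>x. (f x)\<^sup>2 \<partial>lebesgue_on \<Omega>)"

definition is_weak_deriv ::
  "'a::euclidean_space set \<Rightarrow> 'a list \<Rightarrow> ('a \<Rightarrow> real) \<Rightarrow> ('a \<Rightarrow> real) \<Rightarrow> bool" where
  "is_weak_deriv \<Omega> \<beta> f g \<longleftrightarrow>
     (\<forall>\<phi>. test_function \<Omega> \<phi> \<longrightarrow>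
        (\<integral>x. f x * partials \<beta> \<phi> x \<partial>lebesgue_on \<Omega>)
          = (- 1) ^ length \<beta> * (\<integral>x. g x * \<phi> x \<partial>lebesgue_on \<Omega>))"

text \<open>A representative of the weak derivative, which is unique up to null sets; arbitrary if there
  is no weak derivative in \<open>L\<^sup>2(\<Omega>)\<close>.\<close>

definition wderiv :: "'a::euclidean_space set \<Rightarrow> 'a list \<Rightarrow> ('a \<Rightarrow> real) \<Rightarrow> 'a \<Rightarrow> real" where
  "wderiv \<Omega> \<beta> f = (SOME g. g \<in> L2 \<Omega> \<and> is_weak_deriv \<Omega> \<beta> f g)"

definition sobolev :: "'a::euclidean_space set \<Rightarrow> nat \<Rightarrow> ('a \<Rightarrow> real) set" where
  "sobolev \<Omega> k = {f \<in> L2 \<Omega>. \<forall>\<beta>\<in>multi_indices k. \<exists>g\<in>L2 \<Omega>. is_weak_deriv \<Omega> \<beta> f g}"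

definition sobolev_norm :: "'a::euclidean_space set \<Rightarrow> nat \<Rightarrow> ('a \<Rightarrow> real) \<Rightarrow> real" where
  "sobolev_norm \<Omega> k f = sqrt (\<Sum>\<beta>\<in>multi_indices k. (L2_norm \<Omega> (wderiv \<Omega> \<beta> f))\<^sup>2)"

definition H10 :: "'a::euclidean_space set \<Rightarrow> ('a \<Rightarrow> real) set" where
  "H10 \<Omega> = {f \<in> sobolev \<Omega> 1. \<exists>\<phi>. (\<forall>k::nat. test_function \<Omega> (\<phi> k)) \<and>
      (\<lambda>k. sobolev_norm \<Omega> 1 (\<lambda>x. f x - \<phi> k x)) \<longlonglongrightarrow> 0}"

definition laplacian :: "'a::euclidean_space set \<Rightarrow> ('a \<Rightarrow> real) \<Rightarrow> 'a \<Rightarrow> real" where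
  "laplacian \<Omega> f x = (\<Sum>i\<in>Basis. wderiv \<Omega> [i, i] f x)"

definition grad_sq :: "'a::euclidean_space set \<Rightarrow> ('a \<Rightarrow> real) \<Rightarrow> 'a \<Rightarrow> real" where
  "grad_sq \<Omega> f x = (\<Sum>i\<in>Basis. (wderiv \<Omega> [i] f x)\<^sup>2)"

text \<open>The boundary conditions \<open>w = \<Delta>w = 0\<close> hold in the trace sense, that is, in \<open>H\<^sup>1\<^sub>0(\<Omega>)\<close>.\<close>

definition H4_star :: "'a::euclidean_space set \<Rightarrow> ('a \<Rightarrow> real) set" where
  "H4_star \<Omega> = {w \<in> sobolev \<Omega> 4. w \<in> H10 \<Omega> \<and> laplacian \<Omega> w \<in> H10 \<Omega>}"

text \<open>\<open>C_time k I X N u\<close> means \<open>u \<in> C\<^sup>k(I; X)\<close>, where the function space \<open>X\<close> carries the norm \<open>N\<close>;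
  derivatives at endpoints of \<open>I\<close> are one-sided.\<close>

primrec C_time :: "nat \<Rightarrow> real set \<Rightarrow> ('a \<Rightarrow> real) set \<Rightarrow> (('a \<Rightarrow> real) \<Rightarrow> real) \<Rightarrow>
    (real \<Rightarrow> 'a \<Rightarrow> real) \<Rightarrow> bool" where
  "C_time 0 I X N u \<longleftrightarrow>
     (\<forall>t\<in>I. u t \<in> X \<and> ((\<lambda>s. N (\<lambda>x. u s x - u t x)) \<longlongrightarrow> 0) (at t within I))"
| "C_time (Suc k) I X N u \<longleftrightarrow>
     (\<forall>t\<in>I. u t \<in> X) \<and>
     (\<exists>u'. C_time k I X N u' \<and>
        (\<forall>t\<in>I. ((\<lambda>s. N (\<lambda>x. (u s x - u t x) / (s - t) - u' t x)) \<longlongrightarrow> 0) (at t within I)))"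

text \<open>The time derivative in \<open>L\<^sup>2(\<Omega>)\<close>, unique up to null sets at each time.\<close>

definition tderiv :: "'a::euclidean_space set \<Rightarrow> real set \<Rightarrow> (real \<Rightarrow> 'a \<Rightarrow> real) \<Rightarrow> real \<Rightarrow> 'a \<Rightarrow> real" where
  "tderiv \<Omega> I u t = (SOME v. v \<in> L2 \<Omega> \<and>
     ((\<lambda>s. L2_norm \<Omega> (\<lambda>x. (u s x - u t x) / (s - t) - v x)) \<longlongrightarrow> 0) (at t within I))"

text \<open>The integral of an \<open>L\<^sup>2(\<Omega>)\<close>-valued curve over \<open>[0,t]\<close>: the definition of \<^const>\<open>has_integral\<close> with
  the norm of \<open>L\<^sup>2(\<Omega>)\<close>. Integrating the representatives pointwise in \<open>x\<close> would not be meaningful,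
  as they may be chosen independently for each time.\<close>

definition is_time_integral ::
  "'a::euclidean_space set \<Rightarrow> (real \<Rightarrow> 'a \<Rightarrow> real) \<Rightarrow> real \<Rightarrow> ('a \<Rightarrow> real) \<Rightarrow> bool" where
  "is_time_integral \<Omega> f t A \<longleftrightarrow>
     (\<forall>\<epsilon>>0. \<exists>\<gamma>. gauge \<gamma> \<and> (\<forall>\<D>. \<D> tagged_division_of {0..t} \<and> \<gamma> fine \<D> \<longrightarrow>
        L2_norm \<Omega> (\<lambda>x. (\<Sum>(s, K)\<in>\<D>. measure lborel K * f s x) - A x) < \<epsilon>))"

definition time_integral ::
  "'a::euclidean_space set \<Rightarrow> (real \<Rightarrow> 'a \<Rightarrow> real) \<Rightarrow> real \<Rightarrow> 'a \<Rightarrow> real" where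
  "time_integral \<Omega> f t = (SOME A. A \<in> L2 \<Omega> \<and> is_time_integral \<Omega> f t A)"

definition solution_interval :: "real set \<Rightarrow> bool" where
  "solution_interval I \<longleftrightarrow> (\<exists>t1>0. I = {0..t1}) \<or> I = {0..}"

definition strong_solution ::
  "'a::euclidean_space set \<Rightarrow> real \<Rightarrow> real \<Rightarrow> real \<Rightarrow> real \<Rightarrow> real \<Rightarrow> real \<Rightarrow>
   ('a \<Rightarrow> real) \<Rightarrow> ('a \<Rightarrow> real) \<Rightarrow> ('a \<Rightarrow> real) \<Rightarrow> real set \<Rightarrow>
   (real \<Rightarrow> 'a \<Rightarrow> real) \<Rightarrow> (real \<Rightarrow> 'a \<Rightarrow> real) \<Rightarrow> bool" where
  "strong_solution \<Omega> \<rho> a b c d \<eta> u0 v0 \<theta>0 I u \<theta> \<longleftrightarrow>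
     C_time 2 I (L2 \<Omega>) (L2_norm \<Omega>) u \<and>
     C_time 1 I (sobolev \<Omega> 2 \<inter> H10 \<Omega>) (sobolev_norm \<Omega> 2) u \<and>
     C_time 0 I (H4_star \<Omega>) (sobolev_norm \<Omega> 4) u \<and>
     C_time 1 I (L2 \<Omega>) (L2_norm \<Omega>) \<theta> \<and>
     C_time 0 I (H4_star \<Omega>) (sobolev_norm \<Omega> 4) \<theta> \<and>
     (\<forall>t\<in>I. t > 0 \<longrightarrow>
        (AE x in lebesgue_on \<Omega>. \<rho> * tderiv \<Omega> I (tderiv \<Omega> I u) t x
            = - c * laplacian \<Omega> (laplacian \<Omega> (u t)) x + \<eta> * laplacian \<Omega> (\<theta> t) x) \<and>
        (AE x in lebesgue_on \<Omega>. a * tderiv \<Omega> I \<theta> t x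
            = b * laplacian \<Omega> (\<theta> t) x - d * laplacian \<Omega> (laplacian \<Omega> (\<theta> t)) x
              - \<eta> * laplacian \<Omega> (tderiv \<Omega> I u t) x)) \<and>
     (AE x in lebesgue_on \<Omega>. u 0 x = u0 x) \<and>
     (AE x in lebesgue_on \<Omega>. tderiv \<Omega> I u 0 x = v0 x) \<and>
     (AE x in lebesgue_on \<Omega>. \<theta> 0 x = \<theta>0 x)"

definition energy ::
  "'a::euclidean_space set \<Rightarrow> real \<Rightarrow> real \<Rightarrow> real \<Rightarrow> real set \<Rightarrow>
   (real \<Rightarrow> 'a \<Rightarrow> real) \<Rightarrow> (real \<Rightarrow> 'a \<Rightarrow> real) \<Rightarrow> real \<Rightarrow> real" where
  "energy \<Omega> \<rho> a c I u \<theta> t = 1 / 2 *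
     (\<integral>x. \<rho> * (tderiv \<Omega> I u t x)\<^sup>2 + c * (laplacian \<Omega> (u t) x)\<^sup>2 + a * (\<theta> t x)\<^sup>2 \<partial>lebesgue_on \<Omega>)"

definition solves_Phi ::
  "'a::euclidean_space set \<Rightarrow> real \<Rightarrow> real \<Rightarrow> real \<Rightarrow> real \<Rightarrow> ('a \<Rightarrow> real) \<Rightarrow> ('a \<Rightarrow> real) \<Rightarrow>
   ('a \<Rightarrow> real) \<Rightarrow> bool" where
  "solves_Phi \<Omega> a b d \<eta> u0 \<theta>0 \<Phi> \<longleftrightarrow> \<Phi> \<in> H4_star \<Omega> \<and>
     (AE x in lebesgue_on \<Omega>. b * laplacian \<Omega> \<Phi> x - d * laplacian \<Omega> (laplacian \<Omega> \<Phi>) x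
        = a * \<theta>0 x + \<eta> * laplacian \<Omega> u0 x)"

definition Psi ::
  "'a::euclidean_space set \<Rightarrow> ('a \<Rightarrow> real) \<Rightarrow> (real \<Rightarrow> 'a \<Rightarrow> real) \<Rightarrow> real \<Rightarrow> 'a \<Rightarrow> real" where
  "Psi \<Omega> \<Phi> \<theta> t = (\<lambda>x. time_integral \<Omega> \<theta> t x + \<Phi> x)"

definition F_fun ::
  "'a::euclidean_space set \<Rightarrow> real \<Rightarrow> real \<Rightarrow> real \<Rightarrow> ('a \<Rightarrow> real) \<Rightarrow> real \<Rightarrow> real \<Rightarrow>
   (real \<Rightarrow> 'a \<Rightarrow> real) \<Rightarrow> (real \<Rightarrow> 'a \<Rightarrow> real) \<Rightarrow> real \<Rightarrow> real" where
  "F_fun \<Omega> \<rho> b d \<Phi> \<omega> t0 u \<theta> t =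
     (\<integral>x. \<rho> * (u t x)\<^sup>2 \<partial>lebesgue_on \<Omega>) +
     integral {0..t} (\<lambda>s. \<integral>x. b * grad_sq \<Omega> (Psi \<Omega> \<Phi> \<theta> s) x
                              + d * (laplacian \<Omega> (Psi \<Omega> \<Phi> \<theta> s) x)\<^sup>2 \<partial>lebesgue_on \<Omega>) +
     \<omega> * (t + t0)\<^sup>2"

definition exponentially_unstable ::
  "'a::euclidean_space set \<Rightarrow> real \<Rightarrow> real \<Rightarrow> real \<Rightarrow> ('a \<Rightarrow> real) \<Rightarrow> real \<Rightarrow>
   (real \<Rightarrow> 'a \<Rightarrow> real) \<Rightarrow> (real \<Rightarrow> 'a \<Rightarrow> real) \<Rightarrow> bool" where
  "exponentially_unstable \<Omega> \<rho> b d \<Phi> \<omega> u \<theta> \<longleftrightarrow>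
     (\<exists>t0\<ge>0. \<exists>C1>0. \<exists>\<kappa>>0. \<exists>C2\<ge>0. \<forall>t\<ge>0. F_fun \<Omega> \<rho> b d \<Phi> \<omega> t0 u \<theta> t \<ge> C1 * exp (\<kappa> * t) - C2)"

end

theory Submission
  imports Defs
begin

text \<open>Everything is transported to the Hilbert space \<open>L\<^sup>2\<close> of the whole space, extending functions by zero, where
  strong solutions become differentiable curves. Testing the equations gives
  \<open>E(t) = E(0) - \<integral>\<^sub>0\<^sup>t B(\<theta>)\<close> with \<open>B(w) = \<integral>(b |\<nabla>w|\<^sup>2 + d |\<Delta>w|\<^sup>2)\<close>. For \<open>\<omega> = - E(0) \<ge> 0\<close> and \<open>t\<^sub>0 = 0\<close>
  put \<open>Q = \<integral>\<rho> u\<^sub>t\<^sup>2 + \<integral>\<^sub>0\<^sup>t B(\<theta>) + \<omega>\<close>; then \<open>F'' = 4 Q + 2 \<omega>\<close>, and the Cauchy-Schwarz inequality gives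
  \<open>(F' - B(\<Phi>))\<^sup>2 \<le> 4 F Q \<le> F F''\<close>.

  For the difference of two solutions \<open>F(0) = 0\<close> and \<open>\<Phi> = 0\<close>, so that \<open>F\<close> is logarithmically convex and
  vanishes. For the instability, \<open>F''\<close> is bounded below by a positive constant from some time on: otherwise
  \<open>E(0) = 0\<close> and \<open>B(\<theta>)\<close> vanishes identically, which forces \<open>\<theta> = 0\<close>, \<open>u\<^sub>t = 0\<close>, \<open>\<Delta>u = 0\<close>, hence
  \<open>B(\<Phi>) = 0\<close> and \<open>F'(0) = 0\<close>. Quadratic growth of \<open>F\<close> then makes the term \<open>B(\<Phi>)\<close> in the differential inequality
  harmless, and \<open>F' \<ge> \<kappa> F\<close> follows.\<close>

section \<open>The Hilbert space of square-integrable functions\<close>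

text \<open>As c < 0, the energy is indefinite and its decay bounds nothing; logarithmic convexity
  takes the place of a priori estimates. The coupling \<eta> has no sign and must cancel. This is
  the purpose of \<Phi>: it is the constant of integration that turns the time-integrated heat
  equation into b \<Delta>\<Psi> - d \<Delta>^2 \<Psi> = a \<theta> + \<eta> \<Delta>u. Tested with
  \<theta>, this gives the polar form of B at \<theta> and \<Psi>, and its coupling term is opposite
  to that of the wave equation tested with u. There remains -2 (c |\<Delta>u|^2 + a |\<theta>|^2),
  which the energy expresses by u_t; hence the factor 4 in F''. The price is the term B(\<Psi>) in
  F': only its increment from B(\<Phi>) is controlled by F and Q, so B(\<Phi>) disturbs the
  inequality. The Hilbert space is forced by the representatives: those at different times are
  unrelated, so nothing can be differentiated or integrated in t at fixed x, and derivatives picked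
  by \<open>SOME\<close> are determined only as classes.\<close>

definition square_integrable :: "('a::euclidean_space \<Rightarrow> real) \<Rightarrow> bool" where
  "square_integrable f \<longleftrightarrow> f \<in> borel_measurable lebesgue \<and> integrable lebesgue (\<lambda>x. (f x)\<^sup>2)"

lemma square_integrable_mult:
  assumes "square_integrable f" "square_integrable g"
  shows "integrable lebesgue (\<lambda>x. f x * g x)"
proof (rule Bochner_Integration.integrable_bound)
  show "integrable lebesgue (\<lambda>x. (f x)\<^sup>2 + (g x)\<^sup>2)"
    using assms by (auto simp: square_integrable_def)
  show "(\<lambda>x. f x * g x) \<in> borel_measurable lebesgue"
    using assms unfolding square_integrable_def by (intro borel_measurable_times) simp_all
  have "\<bar>s * t\<bar> \<le> s\<^sup>2 + t\<^sup>2" for s t :: real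
  proof -
    have "2 * \<bar>s * t\<bar> \<le> s\<^sup>2 + t\<^sup>2"
      using zero_le_power2[of "\<bar>s\<bar> - \<bar>t\<bar>"] by (simp add: power2_diff abs_mult)
    then show ?thesis
      by linarith
  qed
  then show "AE x in lebesgue. norm (f x * g x) \<le> norm ((f x)\<^sup>2 + (g x)\<^sup>2)"
    by (auto intro!: AE_I2 order_trans[OF _ abs_ge_self])
qed

lemma square_integrable_add:
  assumes "square_integrable f" "square_integrable g"
  shows "square_integrable (\<lambda>x. f x + g x)"
  unfolding square_integrable_def
proof
  show "(\<lambda>x. f x + g x) \<in> borel_measurable lebesgue"
    using assms unfolding square_integrable_def by (intro borel_measurable_add) simp_all
  have "integrable lebesgue (\<lambda>x. (f x)\<^sup>2 + (g x)\<^sup>2 + 2 * (f x * g x))"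
    using assms square_integrable_mult[OF assms]
    unfolding square_integrable_def by (intro Bochner_Integration.integrable_add integrable_mult_right) simp_all
  then show "integrable lebesgue (\<lambda>x. (f x + g x)\<^sup>2)"
    by (simp add: power2_sum mult.assoc)
qed

lemma square_integrable_cmult:
  assumes "square_integrable f"
  shows "square_integrable (\<lambda>x. c * f x)"
  using assms unfolding square_integrable_def power_mult_distrib
  by (intro conjI borel_measurable_times integrable_mult_right) simp_all

lemma square_integrable_diff:
  assumes "square_integrable f" "square_integrable g"
  shows "square_integrable (\<lambda>x. f x - g x)"
  using square_integrable_add[OF assms(1) square_integrable_cmult[OF assms(2), of "-1"]] by simp

lemma square_integrable_zero: "square_integrable (\<lambda>x. 0)"
  by (simp add: square_integrable_def)

lemma square_integrable_restrict:
  assumes "square_integrable f" "S \<in> sets lebesgue"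
  shows "square_integrable (\<lambda>x. indicator S x * f x)"
  unfolding square_integrable_def
proof
  show "(\<lambda>x. indicator S x * f x) \<in> borel_measurable lebesgue"
    using assms unfolding square_integrable_def by (intro borel_measurable_times borel_measurable_indicator) simp_all
  have "integrable lebesgue (\<lambda>x. indicator S x *\<^sub>R (f x)\<^sup>2)"
    using assms unfolding square_integrable_def by (intro integrable_mult_indicator) simp_all
  then show "integrable lebesgue (\<lambda>x. (indicator S x * f x)\<^sup>2)"
    by (rule back_subst[of "integrable lebesgue"]) (auto simp: indicator_def)
qed

text \<open>A partial equivalence: functions that are not square-integrable are related to nothing,
  so every class of the quotient is a genuine element of L2.\<close>

definition l2_rel :: "('a::euclidean_space \<Rightarrow> real) \<Rightarrow> ('a \<Rightarrow> real) \<Rightarrow> bool" where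
  "l2_rel f g \<longleftrightarrow> square_integrable f \<and> square_integrable g \<and> (AE x in lebesgue. f x = g x)"

lemma part_equivp_l2_rel: "part_equivp (l2_rel :: ('a::euclidean_space \<Rightarrow> real) \<Rightarrow> _)"
proof (rule part_equivpI)
  show "\<exists>x. l2_rel x x"
    using square_integrable_zero unfolding l2_rel_def by (intro exI[of _ "\<lambda>x. 0"]) simp
  show "symp l2_rel"
    unfolding symp_def l2_rel_def by (simp add: eq_commute)
  show "transp (l2_rel :: ('a \<Rightarrow> real) \<Rightarrow> _)"
  proof (rule transpI)
    fix f g h :: "'a \<Rightarrow> real"
    assume *: "l2_rel f g" "l2_rel g h"
    then have "AE x in lebesgue. f x = g x" "AE x in lebesgue. g x = h x"
      by (simp_all add: l2_rel_def)
    then have "AE x in lebesgue. f x = h x"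
      by eventually_elim simp
    with * show "l2_rel f h"
      by (simp add: l2_rel_def)
  qed
qed

quotient_type (overloaded) 'a l2 = "'a::euclidean_space \<Rightarrow> real" / partial: l2_rel
  by (rule part_equivp_l2_rel)

instantiation l2 :: (euclidean_space) real_vector
begin

lift_definition zero_l2 :: "'a l2" is "\<lambda>x. 0"
  by (simp add: l2_rel_def square_integrable_zero)

lift_definition plus_l2 :: "'a l2 \<Rightarrow> 'a l2 \<Rightarrow> 'a l2" is "\<lambda>f g x. f x + g x"
proof -
  fix f f' g g' :: "'a \<Rightarrow> real"
  assume *: "l2_rel f f'" "l2_rel g g'"
  then have "AE x in lebesgue. f x = f' x" "AE x in lebesgue. g x = g' x"
    by (auto simp: l2_rel_def)
  then have "AE x in lebesgue. f x + g x = f' x + g' x"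
    by eventually_elim simp
  with * show "l2_rel (\<lambda>x. f x + g x) (\<lambda>x. f' x + g' x)"
    by (simp add: l2_rel_def square_integrable_add)
qed

lift_definition uminus_l2 :: "'a l2 \<Rightarrow> 'a l2" is "\<lambda>f x. - f x"
proof -
  fix f f' :: "'a \<Rightarrow> real"
  assume "l2_rel f f'"
  then show "l2_rel (\<lambda>x. - f x) (\<lambda>x. - f' x)"
    using square_integrable_cmult[of f "-1"] square_integrable_cmult[of f' "-1"]
    by (simp add: l2_rel_def)
qed

lift_definition minus_l2 :: "'a l2 \<Rightarrow> 'a l2 \<Rightarrow> 'a l2" is "\<lambda>f g x. f x - g x"
proof -
  fix f f' g g' :: "'a \<Rightarrow> real"
  assume *: "l2_rel f f'" "l2_rel g g'"
  then have "AE x in lebesgue. f x = f' x" "AE x in lebesgue. g x = g' x"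
    by (auto simp: l2_rel_def)
  then have "AE x in lebesgue. f x - g x = f' x - g' x"
    by eventually_elim simp
  with * show "l2_rel (\<lambda>x. f x - g x) (\<lambda>x. f' x - g' x)"
    by (simp add: l2_rel_def square_integrable_diff)
qed

lift_definition scaleR_l2 :: "real \<Rightarrow> 'a l2 \<Rightarrow> 'a l2" is "\<lambda>c f x. c * f x"
proof -
  fix c :: real and f f' :: "'a \<Rightarrow> real"
  assume *: "l2_rel f f'"
  then have "AE x in lebesgue. f x = f' x"
    by (simp add: l2_rel_def)
  then have "AE x in lebesgue. c * f x = c * f' x"
    by eventually_elim simp
  with * show "l2_rel (\<lambda>x. c * f x) (\<lambda>x. c * f' x)"
    by (simp add: l2_rel_def square_integrable_cmult)
qed

instance
proof
  fix x y z :: "'a l2" and r s :: real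
  show "x + y + z = x + (y + z)" by transfer (simp add: l2_rel_def add.assoc square_integrable_add)
  show "x + y = y + x" by transfer (simp add: l2_rel_def add.commute square_integrable_add)
  show "0 + x = x" by transfer (simp add: l2_rel_def)
  show "- x + x = 0" by transfer (simp add: l2_rel_def square_integrable_zero)
  show "x - y = x + - y"
    by transfer (simp add: l2_rel_def square_integrable_diff)
  show "r *\<^sub>R (x + y) = r *\<^sub>R x + r *\<^sub>R y"
    by transfer (simp add: l2_rel_def algebra_simps square_integrable_add square_integrable_cmult)
  show "(r + s) *\<^sub>R x = r *\<^sub>R x + s *\<^sub>R x"
    by transfer (simp add: l2_rel_def algebra_simps square_integrable_add square_integrable_cmult)
  show "r *\<^sub>R s *\<^sub>R x = (r * s) *\<^sub>R x"
    by transfer (simp add: l2_rel_def mult.assoc square_integrable_cmult)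
  show "1 *\<^sub>R x = x" by transfer (simp add: l2_rel_def)
qed

end

instantiation l2 :: (euclidean_space) real_inner
begin

lift_definition inner_l2 :: "'a l2 \<Rightarrow> 'a l2 \<Rightarrow> real" is "\<lambda>f g. \<integral>x. f x * g x \<partial>lebesgue"
  unfolding l2_rel_def
proof safe
  fix f f' g g' :: "'a \<Rightarrow> real"
  assume *: "square_integrable f" "square_integrable f'" "square_integrable g" "square_integrable g'"
    and ae: "AE x in lebesgue. f x = f' x" "AE x in lebesgue. g x = g' x"
  from ae have "AE x in lebesgue. f x * g x = f' x * g' x"
    by eventually_elim simp
  then show "(\<integral>x. f x * g x \<partial>lebesgue) = (\<integral>x. f' x * g' x \<partial>lebesgue)"
    using * by (intro integral_cong_AE) (auto simp: square_integrable_def)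
qed

definition norm_l2 :: "'a l2 \<Rightarrow> real" where "norm_l2 f = sqrt (inner f f)"
definition dist_l2 :: "'a l2 \<Rightarrow> 'a l2 \<Rightarrow> real" where "dist_l2 f g = norm (f - g)"
definition sgn_l2 :: "'a l2 \<Rightarrow> 'a l2" where "sgn_l2 f = f /\<^sub>R norm f"
definition uniformity_l2 :: "('a l2 \<times> 'a l2) filter" where
  "uniformity_l2 = (INF e\<in>{0 <..}. principal {(x, y). dist x y < e})"
definition open_l2 :: "'a l2 set \<Rightarrow> bool" where
  "open_l2 U \<longleftrightarrow> (\<forall>x\<in>U. \<forall>\<^sub>F (x', y) in uniformity. x' = x \<longrightarrow> y \<in> U)"

instance
proof
  fix x y z :: "'a l2" and r s :: real
  show "sgn x = x /\<^sub>R norm x" by (rule sgn_l2_def)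
  show "dist x y = norm (x - y)" by (rule dist_l2_def)
  show "uniformity = (INF e\<in>{0 <..}. principal {(x, y :: 'a l2). dist x y < e})" by (rule uniformity_l2_def)
  show "inner x y = inner y x" by transfer (simp add: mult.commute)
  show "inner (x + y) z = inner x z + inner y z"
  proof transfer
    fix f g h :: "'a \<Rightarrow> real"
    assume "l2_rel f f" "l2_rel g g" "l2_rel h h"
    then have "integrable lebesgue (\<lambda>x. f x * h x)" "integrable lebesgue (\<lambda>x. g x * h x)"
      unfolding l2_rel_def by (blast intro: square_integrable_mult)+
    then show "(\<integral>x. (f x + g x) * h x \<partial>lebesgue) = (\<integral>x. f x * h x \<partial>lebesgue) + (\<integral>x. g x * h x \<partial>lebesgue)"
      by (simp add: distrib_right)
  qed
  show "inner (r *\<^sub>R x) y = r * inner x y"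
    by transfer (simp add: mult.assoc)
  show "0 \<le> inner x x" by transfer simp
  show "inner x x = 0 \<longleftrightarrow> x = 0"
  proof transfer
    fix f :: "'a \<Rightarrow> real"
    assume "l2_rel f f"
    then have f: "square_integrable f" unfolding l2_rel_def by blast
    have "integrable lebesgue (\<lambda>x. f x * f x)" using square_integrable_mult[OF f f] .
    then have "(\<integral>x. f x * f x \<partial>lebesgue) = 0 \<longleftrightarrow> (AE x in lebesgue. f x * f x = 0)"
      by (intro integral_nonneg_eq_0_iff_AE) auto
    then show "(\<integral>x. f x * f x \<partial>lebesgue) = 0 \<longleftrightarrow> l2_rel f (\<lambda>x. 0)"
      using f by (simp add: l2_rel_def square_integrable_zero)
  qed
  show "norm x = sqrt (inner x x)" by (rule norm_l2_def)
  fix U :: "'a l2 set"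
  show "open U = (\<forall>x\<in>U. \<forall>\<^sub>F (x', y) in uniformity. x' = x \<longrightarrow> y \<in> U)" by (rule open_l2_def)
qed

end

lemma abs_l2_eq_iff:
  assumes "square_integrable f" "square_integrable g"
  shows "abs_l2 f = abs_l2 g \<longleftrightarrow> (AE x in lebesgue. f x = g x)"
proof -
  have "abs_l2 f = abs_l2 g \<longleftrightarrow> l2_rel f g"
    using Quotient_rel[OF Quotient_l2, of f g] assms by (auto simp: l2_rel_def)
  then show ?thesis using assms by (simp add: l2_rel_def)
qed

lemma rep_l2: "square_integrable (rep_l2 h)" "abs_l2 (rep_l2 h) = h"
  using Quotient_rep_reflp[OF Quotient_l2, of h] Quotient_abs_rep[OF Quotient_l2, of h]
  by (simp_all add: l2_rel_def)

lemma
  assumes "square_integrable f" "square_integrable g"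
  shows abs_l2_add: "abs_l2 (\<lambda>x. f x + g x) = abs_l2 f + abs_l2 g"
    and abs_l2_diff: "abs_l2 (\<lambda>x. f x - g x) = abs_l2 f - abs_l2 g"
    and inner_abs_l2: "abs_l2 f \<bullet> abs_l2 g = (\<integral>x. f x * g x \<partial>lebesgue)"
proof -
  have "l2_rel f f" "l2_rel g g"
    using assms by (simp_all add: l2_rel_def)
  note * = plus_l2.abs_eq[OF this] minus_l2.abs_eq[OF this] inner_l2.abs_eq[OF this]
  show "abs_l2 (\<lambda>x. f x + g x) = abs_l2 f + abs_l2 g"
    by (rule *(1)[symmetric])
  show "abs_l2 (\<lambda>x. f x - g x) = abs_l2 f - abs_l2 g"
    by (rule *(2)[symmetric])
  show "abs_l2 f \<bullet> abs_l2 g = (\<integral>x. f x * g x \<partial>lebesgue)"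
    by (rule *(3))
qed

lemma abs_l2_scaleR: "square_integrable f \<Longrightarrow> abs_l2 (\<lambda>x. c * f x) = c *\<^sub>R abs_l2 f"
  using scaleR_l2.abs_eq[of f c] by (simp add: l2_rel_def)

lemma norm_abs_l2:
  assumes "square_integrable f"
  shows "(norm (abs_l2 f))\<^sup>2 = (\<integral>x. (f x)\<^sup>2 \<partial>lebesgue)"
  unfolding power2_norm_eq_inner inner_abs_l2[OF assms assms] by (simp add: power2_eq_square)

lemma nn_integral_abs_l2:
  assumes "square_integrable f"
  shows "(\<integral>\<^sup>+x. ennreal ((f x)\<^sup>2) \<partial>lebesgue) = ennreal ((norm (abs_l2 f))\<^sup>2)"
  using assms unfolding norm_abs_l2[OF assms]
  by (intro nn_integral_eq_integral) (simp_all add: square_integrable_def)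

text \<open>Along a subsequence the increments satisfy \<open>\<Sum>n. 2^n |f(n+1) - f(n)|^2 < \<infinity>\<close> almost everywhere, and
  \<open>g \<le> 2^(-n) + 2^n g^2\<close> turns this into pointwise convergence. Fatou's lemma identifies the limit.\<close>

lemma l2_rapidly_Cauchy_convergent:
  fixes X :: "nat \<Rightarrow> 'a::euclidean_space l2"
  assumes C: "Cauchy X" and rapid: "\<And>n. (norm (X (Suc n) - X n))\<^sup>2 \<le> (1/4) ^ n"
  shows "convergent X"
proof -
  define f where "f = (\<lambda>n. rep_l2 (X n))"
  have sf: "square_integrable (f n)" and Xf: "X n = abs_l2 (f n)" for n
    by (simp_all add: f_def rep_l2)
  have meas[measurable]: "f n \<in> borel_measurable lebesgue" for n
    using sf by (simp add: square_integrable_def)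
  have dist_f: "(\<integral>\<^sup>+x. ennreal ((f m x - f n x)\<^sup>2) \<partial>lebesgue) = ennreal ((norm (X m - X n))\<^sup>2)" for m n
    using nn_integral_abs_l2[OF square_integrable_diff[OF sf sf], of m n]
    by (simp add: Xf abs_l2_diff[OF sf sf])
  have "(\<integral>\<^sup>+x. (\<Sum>n. ennreal (2^n * (f (Suc n) x - f n x)\<^sup>2)) \<partial>lebesgue)
      = (\<Sum>n. (\<integral>\<^sup>+x. ennreal (2^n * (f (Suc n) x - f n x)\<^sup>2) \<partial>lebesgue))"
    by (intro nn_integral_suminf) measurable
  also have "\<dots> = (\<Sum>n. ennreal (2^n * (norm (X (Suc n) - X n))\<^sup>2))"
    by (intro suminf_cong) (simp add: ennreal_mult nn_integral_cmult dist_f)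
  also have "\<dots> \<le> (\<Sum>n. ennreal ((1/2) ^ n))"
  proof (intro suminf_le ennreal_leI)
    show "2 ^ n * (norm (X (Suc n) - X n))\<^sup>2 \<le> (1/2) ^ n" for n
    proof -
      have "2 ^ n * (norm (X (Suc n) - X n))\<^sup>2 \<le> 2 ^ n * (1/4) ^ n"
        using rapid[of n] by (intro mult_left_mono) auto
      also have "\<dots> = (1/2) ^ n"
        by (simp flip: power_mult_distrib)
      finally show ?thesis .
    qed
  qed auto
  also have "\<dots> = ennreal (\<Sum>n. (1/2) ^ n)"
    by (intro suminf_ennreal2) (auto intro: summable_geometric)
  finally have "(\<integral>\<^sup>+x. (\<Sum>n. ennreal (2^n * (f (Suc n) x - f n x)\<^sup>2)) \<partial>lebesgue) \<noteq> \<infinity>"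
    by (auto simp: top_unique)
  then have "AE x in lebesgue. (\<Sum>n. ennreal (2^n * (f (Suc n) x - f n x)\<^sup>2)) \<noteq> \<infinity>"
    by (intro nn_integral_PInf_AE) measurable
  then have conv: "AE x in lebesgue. (\<lambda>n. f n x) \<longlonglongrightarrow> lim (\<lambda>n. f n x)"
  proof eventually_elim
    case (elim x)
    have s: "summable (\<lambda>n. 2^n * (f (Suc n) x - f n x)\<^sup>2)"
      by (rule summable_suminf_not_top) (use elim in auto)
    have "summable (\<lambda>n. f (Suc n) x - f n x)"
    proof (rule summable_comparison_test)
      show "summable (\<lambda>n. (1/2) ^ n + 2^n * (f (Suc n) x - f n x)\<^sup>2)"
        using s by (intro summable_add summable_geometric) auto
      show "\<exists>N. \<forall>n\<ge>N. norm (f (Suc n) x - f n x) \<le> (1/2) ^ n + 2^n * (f (Suc n) x - f n x)\<^sup>2"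
      proof (intro exI allI impI)
        fix n :: nat
        define g where "g = \<bar>f (Suc n) x - f n x\<bar>"
        define s where "s = (2::real) ^ n"
        have "s > 0" "g \<ge> 0" by (auto simp: s_def g_def)
        \<comment> \<open>Expanded and divided by \<open>s\<close>, this is
          \<open>g \<le> 1 / s + s * g\<^sup>2\<close>, whose two terms are summable over n for
          \<open>s = 2 ^ n\<close>.\<close>
        have "0 \<le> (s * g - 1)\<^sup>2 + s * g" using \<open>s > 0\<close> \<open>g \<ge> 0\<close> by simp
        then have "g * s \<le> (1 / s + s * g\<^sup>2) * s"
          using \<open>s > 0\<close> by (simp add: power2_eq_square distrib_right algebra_simps)
        then have "g \<le> 1 / s + s * g\<^sup>2"
          using \<open>s > 0\<close> by simp
        then show "norm (f (Suc n) x - f n x) \<le> (1/2) ^ n + 2^n * (f (Suc n) x - f n x)\<^sup>2"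
          by (simp add: g_def s_def power_divide)
      qed
    qed
    then have "convergent (\<lambda>n. \<Sum>k<n. f (Suc k) x - f k x)"
      by (simp add: summable_iff_convergent)
    then have "convergent (\<lambda>n. f n x - f 0 x)"
      by (simp add: sum_lessThan_telescope[of "\<lambda>n. f n x"])
    then have "convergent (\<lambda>n. f n x)"
      using convergent_add[OF _ convergent_const[of "f 0 x"]] by fastforce
    then show ?case by (simp add: convergent_LIMSEQ_iff)
  qed
  \<comment> \<open>On the null set where the values diverge, \<open>lim\<close> is a default value;
    measurability holds all the same, and only values almost everywhere enter below.\<close>
  define F where "F = (\<lambda>x. lim (\<lambda>n. f n x))"
  have F[measurable]: "F \<in> borel_measurable lebesgue"
    unfolding F_def by measurable
  have fatou: "(\<integral>\<^sup>+x. ennreal ((F x - f n x)\<^sup>2) \<partial>lebesgue) \<le> ennreal e"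
    if e: "\<forall>m\<ge>n. (norm (X m - X n))\<^sup>2 \<le> e" for n e
  proof -
    have "(\<integral>\<^sup>+x. ennreal ((F x - f n x)\<^sup>2) \<partial>lebesgue)
        = (\<integral>\<^sup>+x. liminf (\<lambda>m. ennreal ((f m x - f n x)\<^sup>2)) \<partial>lebesgue)"
    proof (rule nn_integral_cong_AE)
      show "AE x in lebesgue. ennreal ((F x - f n x)\<^sup>2) = liminf (\<lambda>m. ennreal ((f m x - f n x)\<^sup>2))"
        using conv
      proof eventually_elim
        case (elim x)
        then have "(\<lambda>m. ennreal ((f m x - f n x)\<^sup>2)) \<longlonglongrightarrow> ennreal ((F x - f n x)\<^sup>2)"
          unfolding F_def by (intro tendsto_ennrealI tendsto_intros)
        then show ?case
          by (rule lim_imp_Liminf[OF sequentially_bot, symmetric])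
      qed
    qed
    also have "\<dots> \<le> liminf (\<lambda>m. \<integral>\<^sup>+x. ennreal ((f m x - f n x)\<^sup>2) \<partial>lebesgue)"
      by (intro nn_integral_liminf) measurable
    also have "\<dots> = liminf (\<lambda>m. ennreal ((norm (X m - X n))\<^sup>2))"
      by (simp add: dist_f)
    also have "\<dots> \<le> ennreal e"
    proof -
      have "\<forall>\<^sub>F m in sequentially. ennreal ((norm (X m - X n))\<^sup>2) \<le> ennreal e"
        using e by (auto simp: eventually_sequentially intro!: exI[of _ n] ennreal_leI)
      then have "limsup (\<lambda>m. ennreal ((norm (X m - X n))\<^sup>2)) \<le> ennreal e"
        by (rule Limsup_bounded)
      then show ?thesis
        using Liminf_le_Limsup[OF sequentially_bot] order_trans by blast
    qed
    finally show ?thesis .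
  qed
  have Cauchy_sq: "\<exists>N. \<forall>m\<ge>N. \<forall>n\<ge>N. (norm (X m - X n))\<^sup>2 \<le> e\<^sup>2" if "e > 0" for e
  proof -
    obtain N where "\<forall>m\<ge>N. \<forall>n\<ge>N. norm (X m - X n) < e"
      using C \<open>e > 0\<close> unfolding Cauchy_iff by blast
    then show ?thesis
      by (intro exI[of _ N] allI impI power_mono) (auto intro: less_imp_le)
  qed
  have diff_int: "square_integrable (\<lambda>x. F x - f n x)" if "\<forall>m\<ge>n. (norm (X m - X n))\<^sup>2 \<le> e" for n e
    unfolding square_integrable_def
  proof
    show "(\<lambda>x. F x - f n x) \<in> borel_measurable lebesgue"
      by (intro borel_measurable_diff F meas)
    show "integrable lebesgue (\<lambda>x. (F x - f n x)\<^sup>2)"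
    proof (rule integrableI_bounded)
      show "(\<lambda>x. (F x - f n x)\<^sup>2) \<in> borel_measurable lebesgue"
        by (intro borel_measurable_power borel_measurable_diff F meas)
      have "(\<integral>\<^sup>+x. ennreal ((F x - f n x)\<^sup>2) \<partial>lebesgue) < \<infinity>"
        using le_less_trans[OF fatou[OF that] ennreal_less_top] by simp
      then show "(\<integral>\<^sup>+x. ennreal (norm ((F x - f n x)\<^sup>2)) \<partial>lebesgue) < \<infinity>"
        by simp
    qed
  qed
  obtain N where "\<forall>m\<ge>N. \<forall>n\<ge>N. (norm (X m - X n))\<^sup>2 \<le> 1\<^sup>2"
    using Cauchy_sq[of 1] by auto
  then have "square_integrable (\<lambda>x. (F x - f N x) + f N x)"
    by (intro square_integrable_add diff_int[of N 1] sf) auto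
  then have sF: "square_integrable F" by simp
  have "X \<longlonglongrightarrow> abs_l2 F"
  proof (rule LIMSEQ_I)
    fix e :: real
    assume "e > 0"
    then obtain N where N: "\<forall>m\<ge>N. \<forall>n\<ge>N. (norm (X m - X n))\<^sup>2 \<le> (e/2)\<^sup>2"
      using Cauchy_sq[of "e/2"] by auto
    have "norm (X n - abs_l2 F) < e" if "n \<ge> N" for n
    proof -
      have "ennreal ((norm (abs_l2 F - X n))\<^sup>2) \<le> ennreal ((e/2)\<^sup>2)"
        using fatou[of n "(e/2)\<^sup>2"] N that nn_integral_abs_l2[OF square_integrable_diff[OF sF sf[of n]]]
        by (simp add: Xf abs_l2_diff[OF sF sf])
      then have "(norm (abs_l2 F - X n))\<^sup>2 \<le> (e/2)\<^sup>2"
        by (subst (asm) ennreal_le_iff) auto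
      then have "norm (abs_l2 F - X n) \<le> e/2"
        using \<open>e > 0\<close> by (simp add: power2_le_iff_abs_le)
      then show ?thesis
        using \<open>e > 0\<close> by (simp add: norm_minus_commute)
    qed
    then show "\<exists>N. \<forall>n\<ge>N. norm (X n - abs_l2 F) < e" by blast
  qed
  then show ?thesis by (rule convergentI)
qed

text \<open>Passes to a subsequence with steps below (1/2)^n, since a Cauchy sequence converges as
  soon as one of its subsequences does. Completeness is what makes continuous curves in this space
  integrable.\<close>

instance l2 :: (euclidean_space) banach
proof
  fix X :: "nat \<Rightarrow> 'a l2"
  assume C: "Cauchy X"
  have "\<forall>k. \<exists>N. \<forall>m\<ge>N. \<forall>n\<ge>N. norm (X m - X n) < (1/2) ^ k"
    using C unfolding Cauchy_iff by (simp del: power_divide)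
  from choice[OF this] obtain N where "\<forall>k. \<forall>m\<ge>N k. \<forall>n\<ge>N k. norm (X m - X n) < (1/2) ^ k"
    by blast
  then have N: "norm (X m - X n) < (1/2) ^ k" if "m \<ge> N k" "n \<ge> N k" for m n k
    using that by blast
  \<comment> \<open>The \<open>Suc m\<close> under the maximum makes \<open>r\<close> strictly
    increasing, and \<open>N (Suc k)\<close> keeps \<open>r k\<close> behind the threshold for
    (1/2)^k.\<close>
  define r where "r = rec_nat (N 0) (\<lambda>k m. max (Suc m) (N (Suc k)))"
  have r0: "r 0 = N 0" and rS: "r (Suc k) = max (Suc (r k)) (N (Suc k))" for k
    by (simp_all add: r_def)
  have sm: "strict_mono r"
    by (auto simp: strict_mono_Suc_iff rS)
  have rN: "r k \<ge> N k" for k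
    by (cases k) (simp_all add: r0 rS)
  have "convergent (X \<circ> r)"
  proof (rule l2_rapidly_Cauchy_convergent)
    show "Cauchy (X \<circ> r)"
      using C sm by (rule Cauchy_subseq_Cauchy)
    show "(norm ((X \<circ> r) (Suc n) - (X \<circ> r) n))\<^sup>2 \<le> (1/4) ^ n" for n
    proof -
      have "r (Suc n) \<ge> N n"
        using rN[of n] by (simp add: rS)
      then have "norm ((X \<circ> r) (Suc n) - (X \<circ> r) n) \<le> (1/2) ^ n"
        using N[of n "r (Suc n)" "r n"] rN[of n] by simp
      then have "(norm ((X \<circ> r) (Suc n) - (X \<circ> r) n))\<^sup>2 \<le> ((1/2) ^ n)\<^sup>2"
        by (rule power_mono) simp
      also have "\<dots> = (1/4) ^ n"
        unfolding power_even_eq[symmetric] power_mult by (simp add: power2_eq_square)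
      finally show ?thesis .
    qed
  qed
  then obtain l where "(X \<circ> r) \<longlonglongrightarrow> l"
    by (auto simp: convergent_def)
  then have "X \<longlonglongrightarrow> l"
    by (rule Cauchy_converges_subseq[OF C sm])
  then show "convergent X"
    by (rule convergentI)
qed

section \<open>L2(\<Omega>) as a subspace of the Hilbert space, by extension by zero\<close>

definition emb :: "'a::euclidean_space set \<Rightarrow> ('a \<Rightarrow> real) \<Rightarrow> 'a l2" where
  "emb \<Omega> f = abs_l2 (\<lambda>x. indicator \<Omega> x * f x)"

lemma L2_iff_square_integrable:
  assumes "\<Omega> \<in> sets lebesgue"
  shows "f \<in> L2 \<Omega> \<longleftrightarrow> square_integrable (\<lambda>x. indicator \<Omega> x * f x)"
proof -
  have "f \<in> borel_measurable (lebesgue_on \<Omega>) \<longleftrightarrow> (\<lambda>x. indicator \<Omega> x * f x) \<in> borel_measurable lebesgue"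
    using assms borel_measurable_restrict_space_iff[of \<Omega> lebesgue f] by simp
  moreover have "integrable (lebesgue_on \<Omega>) (\<lambda>x. (f x)\<^sup>2) \<longleftrightarrow> integrable lebesgue (\<lambda>x. indicator \<Omega> x * (f x)\<^sup>2)"
    using assms integrable_restrict_space[of \<Omega> lebesgue "\<lambda>x. (f x)\<^sup>2"] by simp
  moreover have "indicator \<Omega> x * (f x)\<^sup>2 = (indicator \<Omega> x * f x)\<^sup>2" for x
    by (simp add: indicator_def)
  ultimately show ?thesis
    by (simp add: L2_def square_integrable_def)
qed

lemma L2_add: "\<Omega> \<in> sets lebesgue \<Longrightarrow> f \<in> L2 \<Omega> \<Longrightarrow> g \<in> L2 \<Omega> \<Longrightarrow> (\<lambda>x. f x + g x) \<in> L2 \<Omega>"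
  by (simp add: L2_iff_square_integrable square_integrable_add distrib_left)

lemma L2_diff: "\<Omega> \<in> sets lebesgue \<Longrightarrow> f \<in> L2 \<Omega> \<Longrightarrow> g \<in> L2 \<Omega> \<Longrightarrow> (\<lambda>x. f x - g x) \<in> L2 \<Omega>"
  by (simp add: L2_iff_square_integrable square_integrable_diff right_diff_distrib)

lemma L2_cmult: "\<Omega> \<in> sets lebesgue \<Longrightarrow> f \<in> L2 \<Omega> \<Longrightarrow> (\<lambda>x. c * f x) \<in> L2 \<Omega>"
  by (simp add: L2_iff_square_integrable square_integrable_cmult mult.left_commute[of _ c])

lemma L2_zero: "\<Omega> \<in> sets lebesgue \<Longrightarrow> (\<lambda>x. 0) \<in> L2 \<Omega>"
  by (simp add: L2_iff_square_integrable square_integrable_zero)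

lemma L2_sum:
  assumes "\<Omega> \<in> sets lebesgue" "\<And>i. i \<in> I \<Longrightarrow> f i \<in> L2 \<Omega>"
  shows "(\<lambda>x. \<Sum>i\<in>I. f i x) \<in> L2 \<Omega>"
  using assms(2) by (induction I rule: infinite_finite_induct) (simp_all add: L2_zero L2_add assms(1))

lemma emb_add: "\<Omega> \<in> sets lebesgue \<Longrightarrow> f \<in> L2 \<Omega> \<Longrightarrow> g \<in> L2 \<Omega> \<Longrightarrow> emb \<Omega> (\<lambda>x. f x + g x) = emb \<Omega> f + emb \<Omega> g"
  by (simp add: emb_def distrib_left abs_l2_add L2_iff_square_integrable)

lemma emb_diff: "\<Omega> \<in> sets lebesgue \<Longrightarrow> f \<in> L2 \<Omega> \<Longrightarrow> g \<in> L2 \<Omega> \<Longrightarrow> emb \<Omega> (\<lambda>x. f x - g x) = emb \<Omega> f - emb \<Omega> g"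
  by (simp add: emb_def right_diff_distrib abs_l2_diff L2_iff_square_integrable)

lemma emb_cmult: "\<Omega> \<in> sets lebesgue \<Longrightarrow> f \<in> L2 \<Omega> \<Longrightarrow> emb \<Omega> (\<lambda>x. c * f x) = c *\<^sub>R emb \<Omega> f"
  by (simp add: emb_def mult.left_commute[of _ c] abs_l2_scaleR L2_iff_square_integrable)

lemma emb_zero: "emb \<Omega> (\<lambda>x. 0) = 0"
  by (simp add: emb_def zero_l2_def)

lemma emb_sum:
  assumes "\<Omega> \<in> sets lebesgue" "\<And>i. i \<in> I \<Longrightarrow> f i \<in> L2 \<Omega>"
  shows "emb \<Omega> (\<lambda>x. \<Sum>i\<in>I. f i x) = (\<Sum>i\<in>I. emb \<Omega> (f i))"
  using assms(2) by (induction I rule: infinite_finite_induct) (simp_all add: emb_zero emb_add L2_sum assms(1))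

lemma inner_emb:
  assumes "\<Omega> \<in> sets lebesgue" "f \<in> L2 \<Omega>" "g \<in> L2 \<Omega>"
  shows "emb \<Omega> f \<bullet> emb \<Omega> g = (\<integral>x. f x * g x \<partial>lebesgue_on \<Omega>)"
proof -
  have "emb \<Omega> f \<bullet> emb \<Omega> g = (\<integral>x. (indicator \<Omega> x * f x) * (indicator \<Omega> x * g x) \<partial>lebesgue)"
    using assms unfolding emb_def by (intro inner_abs_l2) (simp_all add: L2_iff_square_integrable)
  also have "\<dots> = (\<integral>x. indicator \<Omega> x *\<^sub>R (f x * g x) \<partial>lebesgue)"
    by (intro Bochner_Integration.integral_cong) (simp_all add: indicator_def)
  finally show ?thesis
    using assms by (simp add: integral_restrict_space)
qed

lemma norm_emb: "\<Omega> \<in> sets lebesgue \<Longrightarrow> f \<in> L2 \<Omega> \<Longrightarrow> norm (emb \<Omega> f) = L2_norm \<Omega> f"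
  by (simp add: norm_eq_sqrt_inner inner_emb L2_norm_def power2_eq_square)

lemma emb_eq_iff:
  assumes "\<Omega> \<in> sets lebesgue" "f \<in> L2 \<Omega>" "g \<in> L2 \<Omega>"
  shows "emb \<Omega> f = emb \<Omega> g \<longleftrightarrow> (AE x in lebesgue_on \<Omega>. f x = g x)"
proof -
  have "emb \<Omega> f = emb \<Omega> g \<longleftrightarrow> (AE x in lebesgue. indicator \<Omega> x * f x = indicator \<Omega> x * g x)"
    using assms by (simp add: emb_def abs_l2_eq_iff L2_iff_square_integrable)
  also have "\<dots> \<longleftrightarrow> (AE x in lebesgue. x \<in> \<Omega> \<longrightarrow> f x = g x)"
    by (intro eventually_cong) (auto simp: indicator_def)
  finally show ?thesis
    using assms by (simp add: AE_restrict_space_iff)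
qed

text \<open>A type cannot depend on \<Omega>; L2(\<Omega>) is therefore a subspace of the one type
  \<open>l2\<close>.\<close>

definition l2_on :: "'a::euclidean_space set \<Rightarrow> 'a l2 set" where
  "l2_on \<Omega> = emb \<Omega> ` L2 \<Omega>"

text \<open>The orthogonal projection onto \<open>l2_on \<Omega>\<close>, that is, multiplication by
  the indicator function. It turns membership in \<open>l2_on \<Omega>\<close> into a fixed point
  equation, which linear operations and integrals preserve.\<close>

definition l2_restrict :: "'a::euclidean_space set \<Rightarrow> 'a l2 \<Rightarrow> 'a l2" where
  "l2_restrict \<Omega> h = emb \<Omega> (rep_l2 h)"

lemma rep_l2_in_L2: "\<Omega> \<in> sets lebesgue \<Longrightarrow> rep_l2 h \<in> L2 \<Omega>"
  by (simp add: L2_iff_square_integrable square_integrable_restrict rep_l2)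

text \<open>Makes the representative picked by \<open>rep_l2\<close> immaterial, which is why
  \<open>l2_restrict\<close> is linear.\<close>

lemma emb_AE_cong:
  assumes "\<Omega> \<in> sets lebesgue" "square_integrable f" "square_integrable g" "abs_l2 f = abs_l2 g"
  shows "emb \<Omega> f = emb \<Omega> g"
proof -
  have "AE x in lebesgue. f x = g x"
    using assms abs_l2_eq_iff by blast
  then have "AE x in lebesgue_on \<Omega>. f x = g x"
    using assms(1) by (auto simp: AE_restrict_space_iff elim: eventually_mono)
  then show ?thesis
    using assms by (subst emb_eq_iff) (simp_all add: L2_iff_square_integrable square_integrable_restrict)
qed

lemma l2_restrict_emb:
  assumes "\<Omega> \<in> sets lebesgue" "f \<in> L2 \<Omega>"
  shows "l2_restrict \<Omega> (emb \<Omega> f) = emb \<Omega> f"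
proof -
  have "l2_restrict \<Omega> (emb \<Omega> f) = emb \<Omega> (\<lambda>x. indicator \<Omega> x * f x)"
    unfolding l2_restrict_def using assms
    by (intro emb_AE_cong) (auto simp: rep_l2 emb_def L2_iff_square_integrable)
  also have "\<dots> = emb \<Omega> f"
    unfolding emb_def by (intro arg_cong[of _ _ abs_l2]) (auto simp: indicator_def)
  finally show ?thesis .
qed

lemma l2_restrict_in: "\<Omega> \<in> sets lebesgue \<Longrightarrow> l2_restrict \<Omega> h \<in> l2_on \<Omega>"
  by (simp add: l2_restrict_def l2_on_def rep_l2_in_L2)

lemma l2_on_iff: "\<Omega> \<in> sets lebesgue \<Longrightarrow> h \<in> l2_on \<Omega> \<longleftrightarrow> l2_restrict \<Omega> h = h"
  using l2_restrict_in[of \<Omega> h] by (auto simp: l2_on_def l2_restrict_emb)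

lemma bounded_linear_l2_restrict:
  assumes "\<Omega> \<in> sets lebesgue"
  shows "bounded_linear (l2_restrict \<Omega>)"
proof (rule bounded_linear_intro[where K = 1])
  fix x y :: "'a l2" and c :: real
  have "l2_restrict \<Omega> (x + y) = emb \<Omega> (\<lambda>t. rep_l2 x t + rep_l2 y t)"
    unfolding l2_restrict_def using assms
    by (intro emb_AE_cong) (auto simp: rep_l2 abs_l2_add square_integrable_add)
  then show "l2_restrict \<Omega> (x + y) = l2_restrict \<Omega> x + l2_restrict \<Omega> y"
    using assms by (simp add: l2_restrict_def emb_add rep_l2_in_L2)
  have "l2_restrict \<Omega> (c *\<^sub>R x) = emb \<Omega> (\<lambda>t. c * rep_l2 x t)"
    unfolding l2_restrict_def using assms
    by (intro emb_AE_cong) (auto simp: rep_l2 abs_l2_scaleR square_integrable_cmult)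
  then show "l2_restrict \<Omega> (c *\<^sub>R x) = c *\<^sub>R l2_restrict \<Omega> x"
    using assms by (simp add: l2_restrict_def emb_cmult rep_l2_in_L2)
  have "(norm (l2_restrict \<Omega> x))\<^sup>2 = (\<integral>t. (indicator \<Omega> t * rep_l2 x t)\<^sup>2 \<partial>lebesgue)"
    unfolding l2_restrict_def emb_def
    using assms by (intro norm_abs_l2) (simp add: square_integrable_restrict rep_l2)
  also have "\<dots> \<le> (\<integral>t. (rep_l2 x t)\<^sup>2 \<partial>lebesgue)"
    using assms square_integrable_restrict[OF rep_l2(1), of \<Omega> x] rep_l2(1)[of x]
    by (intro integral_mono) (auto simp: square_integrable_def indicator_def)
  also have "\<dots> = (norm x)\<^sup>2"
    using norm_abs_l2[OF rep_l2(1), of x] by (simp add: rep_l2)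
  finally show "norm (l2_restrict \<Omega> x) \<le> norm x * 1"
    by (simp add: power2_le_iff_abs_le)
qed

text \<open>A bounded linear map commutes with the integral, so the projection fixes the integral if
  it fixes the integrand.\<close>

lemma l2_on_integral:
  fixes f :: "real \<Rightarrow> 'a::euclidean_space l2"
  assumes "\<Omega> \<in> sets lebesgue" "f integrable_on S" "\<And>t. t \<in> S \<Longrightarrow> f t \<in> l2_on \<Omega>"
  shows "integral S f \<in> l2_on \<Omega>"
proof -
  have "l2_restrict \<Omega> (integral S f) = integral S (l2_restrict \<Omega> \<circ> f)"
    by (rule integral_linear[symmetric, OF assms(2) bounded_linear_l2_restrict[OF assms(1)]])
  also have "\<dots> = integral S f"
    using assms by (intro integral_cong) (simp add: l2_on_iff)
  finally show ?thesis
    using assms(1) by (simp add: l2_on_iff)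
qed

lemma l2_on_diff: "\<Omega> \<in> sets lebesgue \<Longrightarrow> g \<in> l2_on \<Omega> \<Longrightarrow> h \<in> l2_on \<Omega> \<Longrightarrow> g - h \<in> l2_on \<Omega>"
  by (simp add: l2_on_iff linear_diff[OF bounded_linear.linear[OF bounded_linear_l2_restrict]])

section \<open>Smooth functions and test functions\<close>

lemma partials_append: "partials (\<alpha> @ \<beta>) f = partials \<alpha> (partials \<beta> f)"
  by (induction \<alpha>) simp_all

lemma smooth_on_UNIV_differentiable: "smooth_on UNIV f \<Longrightarrow> f differentiable (at x)"
  unfolding smooth_on_def by (drule spec[of _ "[]"]) simp

lemma smooth_on_UNIV_partials:
  assumes "smooth_on UNIV f" "set \<beta> \<subseteq> Basis"
  shows "smooth_on UNIV (partials \<beta> f)"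
  using assms unfolding smooth_on_def by (auto simp flip: partials_append)

text \<open>Smoothness is the largest property that implies differentiability and is inherited by
  partial derivatives. An invariant class \<open>X\<close> avoids formulas for iterated partials of
  products.\<close>

lemma smooth_on_coinduct:
  assumes "f \<in> X"
    and diff: "\<And>g x. g \<in> X \<Longrightarrow> g differentiable (at x)"
    and closed: "\<And>g i. g \<in> X \<Longrightarrow> i \<in> Basis \<Longrightarrow> partials [i] g \<in> X"
  shows "smooth_on UNIV f"
proof -
  have "partials \<beta> f \<in> X" if "set \<beta> \<subseteq> Basis" for \<beta>
    using that by (induction \<beta>) (use assms in auto)
  then show ?thesis
    using diff by (auto simp: smooth_on_def)
qed

text \<open>The algebra generated by \<open>B\<close> and the smooth functions. Partials of a
  product are sums of products, so an invariant class must be closed under both operations;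
  \<open>B\<close> is a seed whose own partials lie in the hull, such as the functions built from
  \<open>flat k\<close>.\<close>

inductive_set algebra_hull :: "('a::euclidean_space \<Rightarrow> real) set \<Rightarrow> ('a \<Rightarrow> real) set"
  for B :: "('a \<Rightarrow> real) set" where
  base: "f \<in> B \<Longrightarrow> f \<in> algebra_hull B"
| smooth: "smooth_on UNIV f \<Longrightarrow> f \<in> algebra_hull B"
| add: "f \<in> algebra_hull B \<Longrightarrow> g \<in> algebra_hull B \<Longrightarrow> (\<lambda>x. f x + g x) \<in> algebra_hull B"
| mult: "f \<in> algebra_hull B \<Longrightarrow> g \<in> algebra_hull B \<Longrightarrow> (\<lambda>x. f x * g x) \<in> algebra_hull B"

lemma partials_add:
  assumes "\<And>x. f differentiable (at x)" "\<And>x. g differentiable (at x)"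
  shows "partials [i] (\<lambda>x. f x + g x) = (\<lambda>x. partials [i] f x + partials [i] g x)"
proof
  fix x
  have "((\<lambda>x. f x + g x) has_derivative
      (\<lambda>h. frechet_derivative f (at x) h + frechet_derivative g (at x) h)) (at x)"
    using assms by (intro has_derivative_add) (simp_all flip: frechet_derivative_works)
  from frechet_derivative_at[OF this, symmetric]
  show "partials [i] (\<lambda>x. f x + g x) x = partials [i] f x + partials [i] g x"
    by simp
qed

lemma partials_mult:
  assumes "\<And>x. f differentiable (at x)" "\<And>x. g differentiable (at x)"
  shows "partials [i] (\<lambda>x. f x * g x) = (\<lambda>x. f x * partials [i] g x + partials [i] f x * g x)"
proof
  fix x
  have "((\<lambda>x. f x * g x) has_derivative
      (\<lambda>h. f x * frechet_derivative g (at x) h + frechet_derivative f (at x) h * g x)) (at x)"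
    using assms by (intro has_derivative_mult) (simp_all flip: frechet_derivative_works)
  from frechet_derivative_at[OF this, symmetric]
  show "partials [i] (\<lambda>x. f x * g x) x = f x * partials [i] g x + partials [i] f x * g x"
    by simp
qed

lemma smooth_on_algebra_hull:
  assumes "f \<in> algebra_hull B"
    and diff: "\<And>g x. g \<in> B \<Longrightarrow> g differentiable (at x)"
    and closed: "\<And>g i. g \<in> B \<Longrightarrow> i \<in> Basis \<Longrightarrow> partials [i] g \<in> algebra_hull B"
  shows "smooth_on UNIV f"
proof -
  have *: "(\<forall>x. g differentiable (at x)) \<and> (\<forall>i\<in>Basis. partials [i] g \<in> algebra_hull B)"
    if "g \<in> algebra_hull B" for g
    using that
  proof induction
    case (base f)
    then show ?case using assms by blast
  next
    case (smooth f)
    then show ?case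
      using smooth_on_UNIV_partials[of f "[_]"]
      by (auto intro: smooth_on_UNIV_differentiable algebra_hull.smooth simp del: partials.simps)
  next
    case (add f g)
    then show ?case
      by (auto simp: partials_add simp del: partials.simps intro!: algebra_hull.add)
  next
    case (mult f g)
    then show ?case
      by (auto simp: partials_mult simp del: partials.simps intro!: algebra_hull.add algebra_hull.mult)
  qed
  show ?thesis
    by (rule smooth_on_coinduct[OF assms(1)]) (use * in blast)+
qed

lemma smooth_on_UNIV_add: "smooth_on UNIV f \<Longrightarrow> smooth_on UNIV g \<Longrightarrow> smooth_on UNIV (\<lambda>x. f x + g x)"
  by (rule smooth_on_algebra_hull[of _ "{}"]) (auto intro: algebra_hull.intros)

lemma smooth_on_UNIV_mult: "smooth_on UNIV f \<Longrightarrow> smooth_on UNIV g \<Longrightarrow> smooth_on UNIV (\<lambda>x. f x * g x)"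
  by (rule smooth_on_algebra_hull[of _ "{}"]) (auto intro: algebra_hull.intros)

lemma partials_const: "partials [i] (\<lambda>x. c) = (\<lambda>x. 0)"
proof
  fix x
  show "partials [i] (\<lambda>x. c) x = 0"
    using frechet_derivative_at[OF has_derivative_const[of c "at x"], symmetric] by simp
qed

lemma partials_inner: "partials [i] (\<lambda>x. x \<bullet> v) = (\<lambda>x. i \<bullet> v)"
proof
  fix x
  have "((\<lambda>x. x \<bullet> v) has_derivative (\<lambda>h. h \<bullet> v)) (at x)"
    by (auto intro!: derivative_eq_intros)
  from frechet_derivative_at[OF this, symmetric]
  show "partials [i] (\<lambda>x. x \<bullet> v) x = i \<bullet> v"
    by simp
qed

lemma smooth_on_UNIV_const: "smooth_on UNIV (\<lambda>x. c)"
  by (rule smooth_on_coinduct[of _ "range (\<lambda>c x. c)"])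
     (auto simp: partials_const simp del: partials.simps)

lemma smooth_on_UNIV_inner: "smooth_on UNIV (\<lambda>x. x \<bullet> v)"
  by (rule smooth_on_coinduct[of _ "insert (\<lambda>x. x \<bullet> v) (range (\<lambda>c x. c))"])
     (auto simp: partials_const partials_inner simp del: partials.simps)

lemma smooth_on_UNIV_diff:
  "smooth_on UNIV f \<Longrightarrow> smooth_on UNIV g \<Longrightarrow> smooth_on UNIV (\<lambda>x. f x - g x)"
  using smooth_on_UNIV_add[of f "\<lambda>x. (-1) * g x"] smooth_on_UNIV_mult[of "\<lambda>x. -1" g]
  by (simp add: smooth_on_UNIV_const)

lemma smooth_on_UNIV_prod:
  assumes "\<And>i. i \<in> I \<Longrightarrow> smooth_on UNIV (f i)"
  shows "smooth_on UNIV (\<lambda>x. \<Prod>i\<in>I. f i x)"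
  using assms by (induction I rule: infinite_finite_induct)
     (simp_all add: smooth_on_UNIV_const smooth_on_UNIV_mult)

text \<open>The derivative of \<open>flat k\<close> is a linear combination of further members of this family.\<close>

definition flat :: "nat \<Rightarrow> real \<Rightarrow> real" where
  "flat k t = (if t > 0 then inverse t ^ k * exp (- inverse t) else 0)"

text \<open>From the right, \<open>inverse t\<close> tends to infinity and the exponential beats the
  power; on the left the function is zero.\<close>

lemma flat_tendsto_0: "(flat k \<longlongrightarrow> 0) (at 0)"
proof -
  have "((\<lambda>t. inverse t ^ k / exp (inverse t)) \<longlongrightarrow> 0) (at_right (0::real))"
    by (rule filterlim_compose[OF tendsto_power_div_exp_0 filterlim_inverse_at_top_right])
  then have "(flat k \<longlongrightarrow> 0) (at_right 0)"
    by (rule Lim_transform_eventually)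
       (auto simp: flat_def exp_minus divide_inverse eventually_at_right_less eventually_at_filter)
  moreover have "(flat k \<longlongrightarrow> 0) (at_left 0)"
    by (rule tendsto_eventually) (auto simp: flat_def eventually_at_filter)
  ultimately show ?thesis
    by (simp add: filterlim_split_at)
qed

lemma DERIV_flat: "(flat k has_real_derivative (flat (k + 2) t - real k * flat (k + 1) t)) (at t)"
proof -
  consider "t > 0" | "t < 0" | "t = 0" by linarith
  then show ?thesis
  proof cases
    case 1
    have "((\<lambda>t. inverse t ^ k * exp (- inverse t)) has_real_derivative
        (flat (k + 2) t - real k * flat (k + 1) t)) (at t)"
    proof (rule DERIV_cong)
      show "((\<lambda>t. inverse t ^ k * exp (- inverse t)) has_real_derivative
          real k * inverse t ^ (k - 1) * (- (inverse t * inverse t)) * exp (- inverse t)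
          + exp (- inverse t) * (inverse t * inverse t) * inverse t ^ k) (at t)"
        using 1 by (intro DERIV_mult) (auto intro!: derivative_eq_intros)
      show "real k * inverse t ^ (k - 1) * (- (inverse t * inverse t)) * exp (- inverse t)
          + exp (- inverse t) * (inverse t * inverse t) * inverse t ^ k
          = flat (k + 2) t - real k * flat (k + 1) t"
        \<comment> \<open>For \<open>k = 0\<close> the truncated \<open>k - 1\<close> is harmless,
          because its term carries the factor \<open>real k\<close>.\<close>
        using 1 by (cases k) (simp_all add: flat_def power2_eq_square algebra_simps)
    qed
    then show ?thesis
      by (rule has_field_derivative_transform_within_open[of _ _ _ "{0<..}"])
         (use 1 in \<open>auto simp: flat_def\<close>)
  next
    case 2
    have "((\<lambda>t. 0) has_real_derivative (flat (k + 2) t - real k * flat (k + 1) t)) (at t)"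
      using 2 by (simp add: flat_def)
    then show ?thesis
      by (rule has_field_derivative_transform_within_open[of _ _ _ "{..<0}"])
         (use 2 in \<open>auto simp: flat_def\<close>)
  next
    case 3
    \<comment> \<open>At the origin the difference quotient is itself a member of the family, so its
      limit is already known.\<close>
    have "(\<lambda>h. (flat k (0 + h) - flat k 0) / h) = flat (k + 1)"
      by (auto simp: flat_def fun_eq_iff divide_inverse)
    with flat_tendsto_0[of "k + 1"] show ?thesis
      by (simp add: 3 DERIV_def flat_def)
  qed
qed

lemma partials_flat:
  "(\<lambda>x. flat k (x \<bullet> v + c)) differentiable (at x)"
  "partials [i] (\<lambda>x. flat k (x \<bullet> v + c)) =
     (\<lambda>x. (i \<bullet> v) * flat (k + 2) (x \<bullet> v + c) + (- real k * (i \<bullet> v)) * flat (k + 1) (x \<bullet> v + c))"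
proof -
  let ?D = "\<lambda>x. flat (k + 2) (x \<bullet> v + c) - real k * flat (k + 1) (x \<bullet> v + c)"
  have D: "((\<lambda>x. flat k (x \<bullet> v + c)) has_derivative (\<lambda>h. (h \<bullet> v) * ?D x)) (at x)" for x
    by (rule has_derivative_eq_rhs, rule DERIV_compose_FDERIV[OF DERIV_flat])
       (auto intro!: derivative_eq_intros)
  show "(\<lambda>x. flat k (x \<bullet> v + c)) differentiable (at x)"
    using D unfolding differentiable_def by blast
  show "partials [i] (\<lambda>x. flat k (x \<bullet> v + c)) =
     (\<lambda>x. (i \<bullet> v) * flat (k + 2) (x \<bullet> v + c) + (- real k * (i \<bullet> v)) * flat (k + 1) (x \<bullet> v + c))"
    using frechet_derivative_at[OF D, symmetric] by (simp add: fun_eq_iff algebra_simps)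
qed

lemma smooth_on_flat: "smooth_on UNIV (\<lambda>x. flat k (x \<bullet> v + c))"
proof -
  let ?B = "range (\<lambda>k x. flat k (x \<bullet> v + c))"
  have "partials [i] g \<in> algebra_hull ?B" if "g \<in> ?B" for g i
  proof -
    obtain m where g: "g = (\<lambda>x. flat m (x \<bullet> v + c))" using \<open>g \<in> ?B\<close> by auto
    show ?thesis
      unfolding g partials_flat
      by (intro algebra_hull.add algebra_hull.mult algebra_hull.smooth[OF smooth_on_UNIV_const] algebra_hull.base rangeI)
  qed
  then show ?thesis
    by (intro smooth_on_algebra_hull[of _ ?B]) (auto intro: partials_flat algebra_hull.base)
qed

section \<open>Closure properties and bounds of test functions\<close>

lemma test_function_smooth: "test_function \<Omega> \<phi> \<Longrightarrow> smooth_on UNIV \<phi>"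
  by (simp add: test_function_def)

lemma test_function_differentiable: "test_function \<Omega> \<phi> \<Longrightarrow> \<phi> differentiable (at x)"
  by (simp add: test_function_def smooth_on_UNIV_differentiable)

lemma test_function_continuous: "test_function \<Omega> \<phi> \<Longrightarrow> continuous_on S \<phi>"
  by (intro differentiable_imp_continuous_on)
     (auto simp: differentiable_on_def intro: differentiable_at_withinI test_function_differentiable)

lemma test_function_outside: "test_function \<Omega> \<phi> \<Longrightarrow> x \<notin> \<Omega> \<Longrightarrow> \<phi> x = 0"
  using closure_subset[of "{x. \<phi> x \<noteq> 0}"] by (auto simp: test_function_def)

text \<open>A partial derivative may be nonzero at zeros of \<open>\<phi>\<close>, but only inside
  the closed support; hence the closure in the hypothesis.\<close>

lemma test_functionI_support:
  assumes "test_function \<Omega> \<phi>" "smooth_on UNIV \<psi>" "{x. \<psi> x \<noteq> 0} \<subseteq> closure {x. \<phi> x \<noteq> 0}"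
  shows "test_function \<Omega> \<psi>"
proof -
  have "closure {x. \<psi> x \<noteq> 0} \<subseteq> closure {x. \<phi> x \<noteq> 0}"
    using assms(3) by (rule closure_minimal) simp
  moreover from this have "compact (closure {x. \<psi> x \<noteq> 0})"
    using assms(1) compact_Int_closed[of "closure {x. \<phi> x \<noteq> 0}" "closure {x. \<psi> x \<noteq> 0}"]
    by (simp add: test_function_def Int_absorb1)
  moreover have "closure {x. \<psi> x \<noteq> 0} \<subseteq> \<Omega>"
    using calculation(1) assms(1) unfolding test_function_def by (blast intro: subset_trans)
  ultimately show ?thesis
    using assms(2) unfolding test_function_def by simp
qed

lemma test_function_partial:
  assumes "test_function \<Omega> \<phi>" "i \<in> Basis"
  shows "test_function \<Omega> (partials [i] \<phi>)"
proof (rule test_functionI_support[OF assms(1)])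
  show "smooth_on UNIV (partials [i] \<phi>)"
    using assms by (intro smooth_on_UNIV_partials) (auto simp: test_function_def)
  show "{x. partials [i] \<phi> x \<noteq> 0} \<subseteq> closure {x. \<phi> x \<noteq> 0}"
  proof (rule subsetI, rule ccontr)
    fix x assume x: "x \<in> {x. partials [i] \<phi> x \<noteq> 0}" "x \<notin> closure {x. \<phi> x \<noteq> 0}"
    have "(\<phi> has_derivative (\<lambda>h. 0)) (at x)"
    proof (rule has_derivative_transform_within_open)
      show "((\<lambda>x. 0) has_derivative (\<lambda>h. 0)) (at x)" by simp
      show "open (- closure {x. \<phi> x \<noteq> 0})" by (rule open_Compl[OF closed_closure])
      show "x \<in> - closure {x. \<phi> x \<noteq> 0}" using x by simp
      show "0 = \<phi> y" if "y \<in> - closure {x. \<phi> x \<noteq> 0}" for y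
        using that closure_subset[of "{x. \<phi> x \<noteq> 0}"] by auto
    qed
    from frechet_derivative_at[OF this, symmetric] x show False
      by simp
  qed
qed

lemma test_function_partials:
  "test_function \<Omega> \<phi> \<Longrightarrow> set \<beta> \<subseteq> Basis \<Longrightarrow> test_function \<Omega> (partials \<beta> \<phi>)"
proof (induction \<beta>)
  case (Cons i \<beta>)
  then have "test_function \<Omega> (partials [i] (partials \<beta> \<phi>))"
    by (intro test_function_partial) auto
  then show ?case by simp
qed simp

lemma test_function_mult:
  assumes "test_function \<Omega> \<phi>" "smooth_on UNIV \<psi>"
  shows "test_function \<Omega> (\<lambda>x. \<psi> x * \<phi> x)"
proof (rule test_functionI_support[OF assms(1)])
  show "smooth_on UNIV (\<lambda>x. \<psi> x * \<phi> x)"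
    using assms by (intro smooth_on_UNIV_mult) (auto simp: test_function_def)
  show "{x. \<psi> x * \<phi> x \<noteq> 0} \<subseteq> closure {x. \<phi> x \<noteq> 0}"
    by (rule order_trans[OF _ closure_subset]) auto
qed

lemma test_function_diff:
  assumes "test_function \<Omega> \<phi>" "test_function \<Omega> \<psi>"
  shows "test_function \<Omega> (\<lambda>x. \<phi> x - \<psi> x)"
proof -
  have "closure {x. \<phi> x - \<psi> x \<noteq> 0} \<subseteq> closure {x. \<phi> x \<noteq> 0} \<union> closure {x. \<psi> x \<noteq> 0}"
    unfolding closure_Un[symmetric] by (intro closure_mono) auto
  moreover have "compact (closure {x. \<phi> x \<noteq> 0} \<union> closure {x. \<psi> x \<noteq> 0})"
    using assms by (intro compact_Un) (auto simp: test_function_def)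
  moreover from calculation have "compact (closure {x. \<phi> x - \<psi> x \<noteq> 0})"
    using compact_Int_closed[of "closure {x. \<phi> x \<noteq> 0} \<union> closure {x. \<psi> x \<noteq> 0}" "closure {x. \<phi> x - \<psi> x \<noteq> 0}"]
    by (simp add: Int_absorb1)
  ultimately show ?thesis
    using assms unfolding test_function_def
    by (simp add: smooth_on_UNIV_diff subset_trans)
qed

lemma partials_diff_test_function:
  assumes "test_function \<Omega> \<phi>" "test_function \<Omega> \<psi>"
  shows "partials [i] (\<lambda>x. \<phi> x - \<psi> x) = (\<lambda>x. partials [i] \<phi> x - partials [i] \<psi> x)"
proof
  fix x
  have "((\<lambda>x. \<phi> x - \<psi> x) has_derivative
      (\<lambda>h. frechet_derivative \<phi> (at x) h - frechet_derivative \<psi> (at x) h)) (at x)"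
    using assms test_function_differentiable
    by (intro has_derivative_diff) (auto simp flip: frechet_derivative_works)
  from frechet_derivative_at[OF this, symmetric]
  show "partials [i] (\<lambda>x. \<phi> x - \<psi> x) x = partials [i] \<phi> x - partials [i] \<psi> x"
    by simp
qed

lemma test_function_bounded_support:
  assumes "test_function \<Omega> \<phi>"
  shows "\<exists>M R. M \<ge> 0 \<and> (\<forall>x. \<bar>\<phi> x\<bar> \<le> M) \<and> (\<forall>x. \<phi> x \<noteq> 0 \<longrightarrow> x \<in> cball 0 R)"
proof -
  let ?K = "closure {x. \<phi> x \<noteq> 0}"
  have K: "compact ?K" using assms by (simp add: test_function_def)
  then have "bounded (\<phi> ` ?K)"
    using assms by (intro compact_imp_bounded compact_continuous_image test_function_continuous)
  then obtain M where M: "\<And>x. x \<in> ?K \<Longrightarrow> \<bar>\<phi> x\<bar> \<le> M"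
    unfolding bounded_iff by auto
  obtain R where R: "?K \<subseteq> cball 0 R"
    using compact_imp_bounded[OF K] by (auto simp: bounded_iff subset_iff)
  show ?thesis
  proof (intro exI conjI allI impI)
    show "\<bar>\<phi> x\<bar> \<le> max M 0" for x
      using M[of x] closure_subset[of "{x. \<phi> x \<noteq> 0}"] by (cases "\<phi> x = 0") auto
    show "x \<in> cball 0 R" if "\<phi> x \<noteq> 0" for x
      using that R closure_subset[of "{x. \<phi> x \<noteq> 0}"] by auto
  qed simp
qed

lemma integrable_indicator_cball: "integrable lborel (\<lambda>x. indicator (cball 0 R) x * (M::real))"
  by (intro integrable_mult_left integrable_real_indicator[OF _ emeasure_bounded_finite[OF bounded_cball]]) simp

lemma test_function_borel_measurable: "test_function \<Omega> \<phi> \<Longrightarrow> \<phi> \<in> borel_measurable borel"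
  by (intro borel_measurable_continuous_onI test_function_continuous)

lemma test_function_integrable:
  assumes "test_function \<Omega> \<phi>"
  shows "integrable lborel \<phi>"
proof -
  obtain M R where MR: "\<forall>x. \<bar>\<phi> x\<bar> \<le> M" "\<forall>x. \<phi> x \<noteq> 0 \<longrightarrow> x \<in> cball 0 R"
    using test_function_bounded_support[OF assms] by blast
  show ?thesis
  proof (rule Bochner_Integration.integrable_bound[OF integrable_indicator_cball[of R M]])
    show "\<phi> \<in> borel_measurable lborel"
      using test_function_borel_measurable[OF assms] by simp
    have "norm (\<phi> x) \<le> norm (indicator (cball 0 R) x * M)" for x
    proof (cases "\<phi> x = 0")
      case False
      then have "x \<in> cball 0 R" using MR(2) by blast
      then show ?thesis using spec[OF MR(1), of x] by (simp add: indicator_def)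
    qed simp
    then show "AE x in lborel. norm (\<phi> x) \<le> norm (indicator (cball 0 R) x * M)"
      by (intro AE_I2)
  qed
qed

section \<open>The fundamental lemma of the calculus of variations\<close>

lemma test_function_line_derivative:
  assumes "test_function \<Omega> \<phi>"
  shows "((\<lambda>s. \<phi> (x + s *\<^sub>R i)) has_real_derivative partials [i] \<phi> (x + t *\<^sub>R i)) (at t)"
proof -
  have "(\<phi> has_derivative frechet_derivative \<phi> (at (x + t *\<^sub>R i))) (at (x + t *\<^sub>R i))"
    using test_function_differentiable[OF assms] by (simp flip: frechet_derivative_works)
  then have "((\<lambda>s. \<phi> (x + s *\<^sub>R i)) has_derivative
      (\<lambda>s. frechet_derivative \<phi> (at (x + t *\<^sub>R i)) (s *\<^sub>R i))) (at t)"
    by (rule has_derivative_compose[rotated]) (auto intro!: derivative_eq_intros)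
  moreover have "linear (frechet_derivative \<phi> (at (x + t *\<^sub>R i)))"
    using test_function_differentiable[OF assms] linear_frechet_derivative by blast
  ultimately show ?thesis
    by (simp add: has_field_derivative_def linear_scale mult.commute[of _ "frechet_derivative _ _ _"])
qed

lemma test_function_difference_bound:
  assumes "test_function \<Omega> \<phi>" "\<And>x. \<bar>partials [i] \<phi> x\<bar> \<le> M" "h > 0"
  shows "\<bar>\<phi> (x + h *\<^sub>R i) - \<phi> x\<bar> \<le> M * h"
proof -
  obtain z where "\<phi> (x + h *\<^sub>R i) - \<phi> (x + 0 *\<^sub>R i) = (h - 0) * partials [i] \<phi> (x + z *\<^sub>R i)"
    using MVT2[of 0 h "\<lambda>s. \<phi> (x + s *\<^sub>R i)" "\<lambda>s. partials [i] \<phi> (x + s *\<^sub>R i)"]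
      test_function_line_derivative[OF assms(1)] \<open>h > 0\<close> by blast
  then have "\<bar>\<phi> (x + h *\<^sub>R i) - \<phi> x\<bar> = h * \<bar>partials [i] \<phi> (x + z *\<^sub>R i)\<bar>"
    using \<open>h > 0\<close> by (simp add: abs_mult del: partials.simps)
  also have "\<dots> \<le> h * M"
    using assms(2) \<open>h > 0\<close> by (intro mult_left_mono) auto
  finally show "\<bar>\<phi> (x + h *\<^sub>R i) - \<phi> x\<bar> \<le> M * h"
    by (simp add: mult.commute)
qed

text \<open>By translation invariance the difference quotients integrate to zero; pass to the limit.\<close>

lemma integral_partial_test_function:
  assumes "test_function \<Omega> \<phi>" "i \<in> Basis"
  shows "(\<integral>x. partials [i] \<phi> x \<partial>lborel) = 0"
proof -
  define q where "q = (\<lambda>n x. (\<phi> (x + inverse (real (Suc n)) *\<^sub>R i) - \<phi> x) / inverse (real (Suc n)))"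
  obtain M where "M \<ge> 0" and "\<forall>x. \<bar>partials [i] \<phi> x\<bar> \<le> M"
    using test_function_bounded_support[OF test_function_partial[OF assms]] by blast
  then have M: "\<bar>partials [i] \<phi> x\<bar> \<le> M" for x by blast
  obtain R where "\<forall>x. \<phi> x \<noteq> 0 \<longrightarrow> x \<in> cball 0 R"
    using test_function_bounded_support[OF assms(1)] by blast
  then have R: "x \<in> cball 0 R" if "\<phi> x \<noteq> 0" for x using that by blast
  have int: "integrable lborel \<phi>"
    by (rule test_function_integrable[OF assms(1)])
  have trans: "(\<integral>x. \<phi> (x + v) \<partial>lborel) = (\<integral>x. \<phi> x \<partial>lborel)" "integrable lborel (\<lambda>x. \<phi> (x + v))" for v
  proof -
    have "(\<integral>x. \<phi> x \<partial>lborel) = (\<integral>x. \<phi> x \<partial>distr lborel borel ((+) v))"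
      by (simp add: lborel_distr_plus)
    also have "\<dots> = (\<integral>x. \<phi> (v + x) \<partial>lborel)"
      using test_function_borel_measurable[OF assms(1)] by (intro integral_distr) simp_all
    finally show "(\<integral>x. \<phi> (x + v) \<partial>lborel) = (\<integral>x. \<phi> x \<partial>lborel)"
      by (simp add: add.commute)
    have "integrable (distr lborel borel ((+) v)) \<phi>"
      using int by (simp add: lborel_distr_plus)
    then have "integrable lborel (\<lambda>x. \<phi> (v + x))"
      using test_function_borel_measurable[OF assms(1)] by (subst (asm) integrable_distr_eq) simp_all
    then show "integrable lborel (\<lambda>x. \<phi> (x + v))"
      by (simp add: add.commute)
  qed
  have q0: "(\<integral>x. q n x \<partial>lborel) = 0" for n
    unfolding q_def using int trans by simp
  have "(\<lambda>n. \<integral>x. q n x \<partial>lborel) \<longlonglongrightarrow> (\<integral>x. partials [i] \<phi> x \<partial>lborel)"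
  \<comment> \<open>The shift has length at most 1, so all quotients vanish outside the ball of
    radius \<open>R + 1\<close>; the mean value theorem bounds them by \<open>M\<close>.\<close>
  proof (rule integral_dominated_convergence[where w = "\<lambda>x. indicator (cball 0 (R + 1)) x * M"])
    show "partials [i] \<phi> \<in> borel_measurable lborel"
      using test_function_borel_measurable[OF test_function_partial[OF assms]] by simp
    show "q n \<in> borel_measurable lborel" for n
      unfolding q_def using borel_measurable_integrable[OF trans(2)] borel_measurable_integrable[OF int]
      by (intro borel_measurable_divide borel_measurable_diff borel_measurable_const)
    show "integrable lborel (\<lambda>x. indicator (cball 0 (R + 1)) x * M)"
      by (rule integrable_indicator_cball)
    show "AE x in lborel. (\<lambda>n. q n x) \<longlonglongrightarrow> partials [i] \<phi> x"
    proof (rule AE_I2)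
      fix x
      have "((\<lambda>s. \<phi> (x + s *\<^sub>R i)) has_real_derivative partials [i] \<phi> (x + 0 *\<^sub>R i)) (at 0)"
        using test_function_line_derivative[OF assms(1)] .
      then have "((\<lambda>h. (\<phi> (x + h *\<^sub>R i) - \<phi> x) / h) \<longlongrightarrow> partials [i] \<phi> x) (at 0)"
        by (simp add: DERIV_def del: partials.simps)
      moreover have "filterlim (\<lambda>n. inverse (real (Suc n))) (at 0) sequentially"
        using LIMSEQ_inverse_real_of_nat by (auto simp: filterlim_at)
      ultimately show "(\<lambda>n. q n x) \<longlonglongrightarrow> partials [i] \<phi> x"
        unfolding q_def by (rule filterlim_compose)
    qed
    show "AE x in lborel. norm (q n x) \<le> indicator (cball 0 (R + 1)) x * M" for n
    proof (rule AE_I2)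
      fix x
      let ?h = "inverse (real (Suc n))"
      have h: "?h > 0" "?h \<le> 1" by (auto simp: field_simps)
      have "norm (q n x) \<le> M"
        using test_function_difference_bound[OF assms(1) M h(1), of x] h(1)
        by (simp add: q_def abs_divide pos_divide_le_eq del: partials.simps of_nat_Suc inverse_eq_divide)
      moreover have "q n x = 0" if "x \<notin> cball 0 (R + 1)"
      proof -
        have "norm x > R + 1" using that by simp
        moreover have "norm x - 1 \<le> norm (x + ?h *\<^sub>R i)"
        proof -
          have "norm (?h *\<^sub>R i) \<le> 1" using assms(2) h by simp
          then show ?thesis using norm_diff_ineq[of x "?h *\<^sub>R i"] by linarith
        qed
        ultimately have "\<phi> (x + ?h *\<^sub>R i) = 0" "\<phi> x = 0"
          using R[of "x + ?h *\<^sub>R i"] R[of x] by force+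
        then show ?thesis by (simp add: q_def)
      qed
      ultimately show "norm (q n x) \<le> indicator (cball 0 (R + 1)) x * M"
        by (auto simp: indicator_def)
    qed
  qed
  then show ?thesis
    by (simp add: q0 LIMSEQ_const_iff del: partials.simps)
qed

lemma test_function_L2:
  assumes "\<Omega> \<in> sets lebesgue" "test_function \<Omega>' \<phi>"
  shows "\<phi> \<in> L2 \<Omega>"
proof -
  have "test_function \<Omega>' (\<lambda>x. \<phi> x * \<phi> x)"
    by (rule test_function_mult[OF assms(2) test_function_smooth[OF assms(2)]])
  from test_function_integrable[OF this] have "integrable lborel (\<lambda>x. (\<phi> x)\<^sup>2)"
    by (simp add: power2_eq_square)
  moreover have m: "\<phi> \<in> borel_measurable lborel"
    using test_function_borel_measurable[OF assms(2)] by simp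
  ultimately have "square_integrable \<phi>"
    unfolding square_integrable_def using measurable_completion[OF m]
    by (subst integrable_completion) (rule borel_measurable_power[OF m], blast)
  then show ?thesis
    unfolding L2_iff_square_integrable[OF assms(1)] using assms(1) by (rule square_integrable_restrict)
qed

lemma integral_test_function:
  assumes "\<Omega> \<in> sets lebesgue" "test_function \<Omega> \<phi>"
  shows "(\<integral>x. \<phi> x \<partial>lebesgue_on \<Omega>) = (\<integral>x. \<phi> x \<partial>lborel)"
proof -
  have "(\<integral>x. \<phi> x \<partial>lebesgue_on \<Omega>) = (\<integral>x. indicator \<Omega> x *\<^sub>R \<phi> x \<partial>lebesgue)"
    using assms by (simp add: integral_restrict_space)
  also have "(\<lambda>x. indicator \<Omega> x *\<^sub>R \<phi> x) = \<phi>"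
    using test_function_outside[OF assms(2)] by (auto simp: indicator_def fun_eq_iff)
  finally show ?thesis
    using test_function_borel_measurable[OF assms(2)] by (simp add: integral_completion)
qed

text \<open>The integral of a partial derivative of the product \<phi> \<psi> vanishes; expanding it
  by the product rule is integration by parts.\<close>

lemma is_weak_deriv_test_function:
  assumes \<Omega>: "\<Omega> \<in> sets lebesgue" and "test_function \<Omega> \<phi>" "i \<in> Basis"
  shows "is_weak_deriv \<Omega> [i] \<phi> (partials [i] \<phi>)"
  unfolding is_weak_deriv_def
proof (intro allI impI)
  fix \<psi> assume \<psi>: "test_function \<Omega> \<psi>"
  let ?I = "\<lambda>f. \<integral>x. f x \<partial>lebesgue_on \<Omega>"
  have prod: "test_function \<Omega> (\<lambda>x. \<phi> x * \<psi> x)"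
    by (rule test_function_mult[OF \<psi> test_function_smooth[OF assms(2)]])
  have "?I (partials [i] (\<lambda>x. \<phi> x * \<psi> x)) = 0"
    using integral_test_function[OF \<Omega> test_function_partial[OF prod assms(3)]]
      integral_partial_test_function[OF prod assms(3)]
    by (rule trans)
  also have "partials [i] (\<lambda>x. \<phi> x * \<psi> x) = (\<lambda>x. \<phi> x * partials [i] \<psi> x + partials [i] \<phi> x * \<psi> x)"
    using assms \<psi> by (intro partials_mult test_function_differentiable)
  also have "?I \<dots> = ?I (\<lambda>x. \<phi> x * partials [i] \<psi> x) + ?I (\<lambda>x. partials [i] \<phi> x * \<psi> x)"
  proof -
    have "integrable (lebesgue_on \<Omega>) (\<lambda>x. f x * g x)" if "f \<in> L2 \<Omega>" "g \<in> L2 \<Omega>" for f g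
    proof -
      have "integrable lebesgue (\<lambda>x. (indicator \<Omega> x * f x) * (indicator \<Omega> x * g x))"
        using that \<Omega> by (intro square_integrable_mult) (auto simp: L2_iff_square_integrable)
      also have "(\<lambda>x. (indicator \<Omega> x * f x) * (indicator \<Omega> x * g x)) = (\<lambda>x. indicator \<Omega> x *\<^sub>R (f x * g x))"
        by (auto simp: indicator_def)
      finally show ?thesis
        using \<Omega> by (simp add: integrable_restrict_space)
    qed
    then show ?thesis
      using assms \<psi> by (intro Bochner_Integration.integral_add) (auto intro: test_function_L2 test_function_partial simp del: partials.simps)
  qed
  finally show "?I (\<lambda>x. \<phi> x * partials [i] \<psi> x) = (- 1) ^ length [i] * ?I (\<lambda>x. partials [i] \<phi> x * \<psi> x)"
    by simp
qed

text \<open>Two factors per coordinate, one for each face of the box. As exp (-1/t) tends to 1 for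
  large t, stretching the distance to each face by \<open>Suc n\<close> makes the products converge
  to the indicator of the open box while they stay between 0 and 1. The arguments have the affine
  form of \<open>smooth_on_flat\<close>.\<close>

definition bump :: "'a::euclidean_space \<Rightarrow> 'a \<Rightarrow> nat \<Rightarrow> 'a \<Rightarrow> real" where
  "bump a b n x = (\<Prod>i\<in>Basis. flat 0 (x \<bullet> (real (Suc n) *\<^sub>R i) + - real (Suc n) * (a \<bullet> i))
                          * flat 0 (x \<bullet> (- real (Suc n) *\<^sub>R i) + real (Suc n) * (b \<bullet> i)))"

lemma flat_0_bounds: "0 \<le> flat 0 t" "flat 0 t \<le> 1"
  by (auto simp: flat_def)

lemma bump_outside: "x \<notin> box a b \<Longrightarrow> bump a b n x = 0"
proof -
  assume "x \<notin> box a b"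
  then obtain i where i: "i \<in> Basis" "x \<bullet> i \<le> a \<bullet> i \<or> b \<bullet> i \<le> x \<bullet> i"
    by (auto simp: mem_box not_less)
  have flat0: "flat 0 t = 0" if "t \<le> 0" for t using that by (simp add: flat_def)
  from i(2) have "flat 0 (x \<bullet> (real (Suc n) *\<^sub>R i) + - real (Suc n) * (a \<bullet> i)) = 0 \<or>
      flat 0 (x \<bullet> (- real (Suc n) *\<^sub>R i) + real (Suc n) * (b \<bullet> i)) = 0"
  proof
    assume "x \<bullet> i \<le> a \<bullet> i"
    then have "real (Suc n) * (x \<bullet> i) \<le> real (Suc n) * (a \<bullet> i)" by (intro mult_left_mono) auto
    then show ?thesis by (intro disjI1 flat0) (simp del: of_nat_Suc)
  next
    assume "b \<bullet> i \<le> x \<bullet> i"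
    then have "real (Suc n) * (b \<bullet> i) \<le> real (Suc n) * (x \<bullet> i)" by (intro mult_left_mono) auto
    then show ?thesis by (intro disjI2 flat0) (simp del: of_nat_Suc)
  qed
  then show ?thesis
    unfolding bump_def using i(1) by (intro prod_zero bexI[of _ i]) auto
qed

lemma bump_bounds: "\<bar>bump a b n x\<bar> \<le> 1"
proof -
  have "0 \<le> bump a b n x"
    unfolding bump_def by (intro prod_nonneg mult_nonneg_nonneg flat_0_bounds ballI)
  moreover have "bump a b n x \<le> 1"
    unfolding bump_def by (intro prod_le_1 conjI mult_nonneg_nonneg mult_le_one flat_0_bounds)
  ultimately show ?thesis by simp
qed

lemma bump_tendsto: "(\<lambda>n. bump a b n x) \<longlonglongrightarrow> indicator (box a b) x"
proof (cases "x \<in> box a b")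
  case False
  then show ?thesis by (simp add: bump_outside)
next
  case True
  have *: "(\<lambda>n. flat 0 (real (Suc n) * t)) \<longlonglongrightarrow> 1" if "t > 0" for t
  proof -
    have "(\<lambda>n. exp (- (inverse (real (Suc n)) * inverse t))) \<longlonglongrightarrow> exp (- (0 * inverse t))"
      by (intro tendsto_intros LIMSEQ_inverse_real_of_nat)
    then show ?thesis
      using that by (simp add: flat_def del: of_nat_Suc)
  qed
  have "(\<lambda>n. \<Prod>i\<in>Basis. flat 0 (real (Suc n) * (x \<bullet> i - a \<bullet> i)) * flat 0 (real (Suc n) * (b \<bullet> i - x \<bullet> i)))
      \<longlonglongrightarrow> (\<Prod>i\<in>(Basis :: 'a set). 1 * 1)"
    using True by (intro tendsto_prod tendsto_mult *) (auto simp: mem_box)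
  then show ?thesis
    using True by (simp add: bump_def algebra_simps)
qed

lemma test_function_bump:
  assumes "cbox a b \<subseteq> \<Omega>"
  shows "test_function \<Omega> (bump a b n)"
proof -
  have "{x. bump a b n x \<noteq> 0} \<subseteq> cbox a b"
    using bump_outside[of _ a b n] box_subset_cbox[of a b] by blast
  then have sub: "closure {x. bump a b n x \<noteq> 0} \<subseteq> cbox a b"
    by (rule closure_minimal) (rule closed_cbox)
  then have "compact (closure {x. bump a b n x \<noteq> 0})"
    using compact_Int_closed[OF compact_cbox closed_closure, of a b "{x. bump a b n x \<noteq> 0}"]
    by (simp add: Int_absorb1)
  moreover have "smooth_on UNIV (bump a b n)"
    unfolding bump_def[abs_def] by (intro smooth_on_UNIV_prod smooth_on_UNIV_mult smooth_on_flat)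
  ultimately show ?thesis
    using sub assms by (auto simp: test_function_def)
qed

text \<open>Open boxes are an intersection-stable generator of the Borel sets, so vanishing
  integrals spread to all Borel sets; the total integral serves the complements. Then
  \<open>g\<close> and 0 have the same integral over every Borel set.\<close>

lemma AE_zero_if_box_integrals_zero:
  fixes g :: "'a::euclidean_space \<Rightarrow> real"
  assumes g: "integrable lborel g" and box: "\<And>a b. (LINT x:box a b|lborel. g x) = 0"
    and total: "(\<integral>x. g x \<partial>lborel) = 0"
  shows "AE x in lborel. g x = 0"
proof -
  have si: "set_integrable lborel A g" if "A \<in> sets borel" for A
    using that g unfolding set_integrable_def by (intro integrable_mult_indicator) auto
  have "(LINT x:A|lborel. g x) = 0" if "A \<in> sets borel" for A
  proof -
    let ?E = "range (\<lambda>(a, b). box a b :: 'a set)"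
    have "Int_stable ?E"
      by (auto simp: Int_stable_def box_Int_box)
    moreover have "?E \<subseteq> Pow UNIV" by simp
    moreover have "A \<in> sigma_sets UNIV ?E"
      using that by (simp add: borel_eq_box)
    ultimately show ?thesis
    proof (induction rule: sigma_sets_induct_disjoint)
      case (basic A)
      then show ?case using box by auto
    next
      case empty
      then show ?case by (simp add: set_lebesgue_integral_def)
    next
      case (compl A)
      have A: "A \<in> sets borel" using compl(1) by (simp add: borel_eq_box)
      have "(\<integral>x. g x \<partial>lborel) = (LINT x:A \<union> (UNIV - A)|lborel. g x)"
        by (simp add: set_lebesgue_integral_def)
      also have "\<dots> = (LINT x:A|lborel. g x) + (LINT x:UNIV - A|lborel. g x)"
        using A by (intro set_integral_Un si) auto
      finally show ?case
        using total compl by simp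
    next
      case (union F)
      have F: "F i \<in> sets borel" for i
        using union(2) by (auto simp: borel_eq_box)
      have "(LINT x:(\<Union>i. F i)|lborel. g x) = (\<Sum>i. (LINT x:F i|lborel. g x))"
        using union(1) F by (intro lebesgue_integral_countable_add si) (auto simp: disjoint_family_on_def)
      then show ?case
        using union by simp
    qed
  qed
  then show ?thesis
    using density_unique_real[OF g, of "\<lambda>x. 0"] by simp
qed

text \<open>The bumps replace mollification: inside a closed box in \<Omega> they make the integrals
  over all smaller boxes vanish. A Borel representative \<open>g\<close> is taken because boxes
  generate only the Borel sets; countably many closed boxes then exhaust \<Omega>.\<close>

lemma fundamental_lemma_calculus_of_variations:
  assumes "open \<Omega>" "f \<in> L2 \<Omega>"
    and zero: "\<And>\<phi>. test_function \<Omega> \<phi> \<Longrightarrow> (\<integral>x. f x * \<phi> x \<partial>lebesgue_on \<Omega>) = 0"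
  shows "AE x in lebesgue_on \<Omega>. f x = 0"
proof -
  have \<Omega>: "\<Omega> \<in> sets lebesgue" using assms(1) by auto
  define F where "F = (\<lambda>x. indicator \<Omega> x * f x)"
  have F: "square_integrable F"
    using assms(2) \<Omega> by (simp add: F_def L2_iff_square_integrable)
  then obtain g where g: "g \<in> borel_measurable lborel" and Fg: "AE x in lborel. F x = g x"
    using completion_ex_borel_measurable_real[of F lborel] by (auto simp: square_integrable_def)
  have g_sq: "integrable lborel (\<lambda>x. (g x)\<^sup>2)"
  proof -
    have "integrable lebesgue (\<lambda>x. (g x)\<^sup>2) \<longleftrightarrow> integrable lebesgue (\<lambda>x. (F x)\<^sup>2)"
    proof (rule integrable_cong_AE)
      show "AE x in lebesgue. (g x)\<^sup>2 = (F x)\<^sup>2"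
        using AE_completion[OF Fg] by eventually_elim simp
    qed (use F g in \<open>auto simp: square_integrable_def intro: measurable_completion\<close>)
    then show ?thesis
      using F g by (simp add: square_integrable_def integrable_completion)
  qed
  have zero_cbox: "AE x in lborel. x \<in> box a b \<longrightarrow> g x = 0" if ab: "cbox a b \<subseteq> \<Omega>" for a b
  proof -
    \<comment> \<open>So far \<open>g\<close> is only known to be square-integrable; cut off to a
      box of finite measure it is integrable, since |t| \<le> 1 + t^2.\<close>
    define h where "h = (\<lambda>x. indicator (box a b) x *\<^sub>R g x)"
    have h: "integrable lborel h"
    proof (rule Bochner_Integration.integrable_bound)
      show "integrable lborel (\<lambda>x. indicator (box a b) x + (g x)\<^sup>2)"
        using g_sq
        by (intro Bochner_Integration.integrable_add integrable_real_indicator[OF _ emeasure_bounded_finite[OF bounded_box]]) auto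
      show "h \<in> borel_measurable lborel"
        unfolding h_def using g by (intro borel_measurable_scaleR borel_measurable_indicator) auto
      have "\<bar>t\<bar> \<le> 1 + t\<^sup>2" for t :: real
        using zero_le_power2[of "\<bar>t\<bar> - 1"] zero_le_power2[of t] by (simp add: power2_diff)
      then show "AE x in lborel. norm (h x) \<le> norm (indicator (box a b) x + (g x)\<^sup>2)"
        by (intro AE_I2) (auto simp: h_def indicator_def)
    qed
    have small: "(LINT x:box c d|lborel. g x) = 0" if cd: "cbox c d \<subseteq> cbox a b" for c d
    proof -
      have cd': "box c d \<subseteq> box a b"
        using interior_mono[OF cd] by (simp add: interior_cbox)
      have "(\<lambda>n. \<integral>x. bump c d n x * h x \<partial>lborel) \<longlonglongrightarrow> (\<integral>x. indicator (box c d) x * h x \<partial>lborel)"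
      proof (rule integral_dominated_convergence[where w = "\<lambda>x. norm (h x)"])
        show "(\<lambda>x. indicator (box c d) x * h x) \<in> borel_measurable lborel"
          using borel_measurable_integrable[OF h] by (intro borel_measurable_times borel_measurable_indicator) auto
        show "(\<lambda>x. bump c d n x * h x) \<in> borel_measurable lborel" for n
          using borel_measurable_integrable[OF h] test_function_borel_measurable[OF test_function_bump[of c d UNIV n]]
          by (intro borel_measurable_times) auto
        show "integrable lborel (\<lambda>x. norm (h x))" using h by simp
        show "AE x in lborel. (\<lambda>n. bump c d n x * h x) \<longlonglongrightarrow> indicator (box c d) x * h x"
          by (intro AE_I2 tendsto_mult bump_tendsto tendsto_const)
        show "AE x in lborel. norm (bump c d n x * h x) \<le> norm (h x)" for n
          using bump_bounds[of c d n] by (intro AE_I2) (auto simp: abs_mult intro: mult_left_le_one_le)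
      qed
      moreover have "(\<integral>x. bump c d n x * h x \<partial>lborel) = 0" for n
      proof -
        have t: "test_function \<Omega> (bump c d n)"
          using cd ab by (intro test_function_bump) auto
        have "0 = (\<integral>x. indicator \<Omega> x *\<^sub>R (f x * bump c d n x) \<partial>lebesgue)"
          using zero[OF t] \<Omega> by (simp add: integral_restrict_space)
        also have "\<dots> = (\<integral>x. F x * bump c d n x \<partial>lebesgue)"
          by (simp add: F_def mult.assoc)
        also have "\<dots> = (\<integral>x. g x * bump c d n x \<partial>lebesgue)"
        proof (rule integral_cong_AE)
          show "AE x in lebesgue. F x * bump c d n x = g x * bump c d n x"
            using AE_completion[OF Fg] by eventually_elim simp
        qed (use F g test_function_borel_measurable[OF t] in
             \<open>auto simp: square_integrable_def intro!: borel_measurable_times intro: measurable_completion\<close>)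
        also have "\<dots> = (\<integral>x. g x * bump c d n x \<partial>lborel)"
          using g test_function_borel_measurable[OF t] by (intro integral_completion) (intro borel_measurable_times, auto)
        also have "(\<lambda>x. g x * bump c d n x) = (\<lambda>x. bump c d n x * h x)"
        proof
          fix x show "g x * bump c d n x = bump c d n x * h x"
            using bump_outside[of x c d n] cd' by (cases "x \<in> box c d") (auto simp: h_def)
        qed
        finally show ?thesis by simp
      qed
      ultimately have "(\<integral>x. indicator (box c d) x * h x \<partial>lborel) = 0"
        by (simp add: LIMSEQ_const_iff)
      moreover have "(\<lambda>x. indicator (box c d) x * h x) = (\<lambda>x. indicator (box c d) x *\<^sub>R g x)"
        using cd' by (auto simp: h_def indicator_def fun_eq_iff)
      ultimately show ?thesis
        by (simp add: set_lebesgue_integral_def)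
    qed
    have "AE x in lborel. h x = 0"
    proof (rule AE_zero_if_box_integrals_zero[OF h])
      show "(\<integral>x. h x \<partial>lborel) = 0"
        using small[of a b] by (simp add: h_def set_lebesgue_integral_def)
      fix c d :: 'a
      obtain c' d' where c': "box c d \<inter> box a b = box c' d'"
        unfolding box_Int_box by blast
      have "(LINT x:box c d|lborel. h x) = (LINT x:box c' d'|lborel. g x)"
        unfolding set_lebesgue_integral_def h_def c'[symmetric]
        by (intro Bochner_Integration.integral_cong) (auto simp: indicator_def)
      also have "\<dots> = 0"
      proof (cases "box c' d' = {}")
        case False
        \<comment> \<open>The step \<open>small\<close> asks for an inclusion of closed boxes, which
          follows from that of the open ones by taking closures.\<close>
        have "closure (box c' d') \<subseteq> closure (box a b)"
          using c' by (intro closure_mono) auto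
        moreover have "closure (box a b) \<subseteq> cbox a b"
          by (rule closure_minimal[OF box_subset_cbox closed_cbox])
        ultimately have "cbox c' d' \<subseteq> cbox a b"
          using closure_box[OF False] by auto
        then show ?thesis by (rule small)
      qed (simp add: set_lebesgue_integral_def)
      finally show "(LINT x:box c d|lborel. h x) = 0" .
    qed
    then show ?thesis
      by eventually_elim (auto simp: h_def)
  qed
  obtain \<D> where \<D>: "countable \<D>" "\<D> \<subseteq> Pow \<Omega>" "\<And>X. X \<in> \<D> \<Longrightarrow> \<exists>a b. X = cbox a b" "\<Union>\<D> = \<Omega>"
    by (rule open_countable_Union_open_cbox[OF assms(1)]) (rule that)
  have "AE x in lebesgue. x \<in> X \<longrightarrow> F x = 0" if X: "X \<in> \<D>" for X
  proof -
    obtain a b where ab: "X = cbox a b" using \<D>(3)[OF X] by blast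
    have "cbox a b \<subseteq> \<Omega>" using ab X \<D>(2) by auto
    from AE_completion[OF zero_cbox[OF this]] have 1: "AE x in lebesgue. x \<in> box a b \<longrightarrow> g x = 0" .
    \<comment> \<open>The bumps say nothing about the faces of a box, which form a null set.\<close>
    have 2: "AE x in lebesgue. x \<notin> cbox a b - box a b"
      using negligible_frontier_interval[of a b] by (intro AE_not_in) (simp add: negligible_iff_null_sets)
    from 1 2 AE_completion[OF Fg] show ?thesis
      by eventually_elim (auto simp: ab)
  qed
  then have "AE x in lebesgue. \<forall>X\<in>\<D>. x \<in> X \<longrightarrow> F x = 0"
    using \<D>(1) by (subst AE_ball_countable) auto
  then have "AE x in lebesgue. x \<in> \<Omega> \<longrightarrow> f x = 0"
    by eventually_elim (use \<D>(4) in \<open>auto simp: F_def indicator_def\<close>)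
  then show ?thesis
    using \<Omega> by (simp add: AE_restrict_space_iff)
qed

section \<open>Weak derivatives and the Dirichlet Laplacian\<close>

text \<open>The relation \<open>is_weak_deriv\<close> between classes. It is given by pairings with
  fixed vectors, so it passes to sums and to integrals of curves without a choice of
  representatives.\<close>

definition weak_deriv :: "'a::euclidean_space set \<Rightarrow> 'a list \<Rightarrow> 'a l2 \<Rightarrow> 'a l2 \<Rightarrow> bool" where
  "weak_deriv \<Omega> \<beta> F G \<longleftrightarrow> (\<forall>\<phi>. test_function \<Omega> \<phi> \<longrightarrow>
     F \<bullet> emb \<Omega> (partials \<beta> \<phi>) = (- 1) ^ length \<beta> * (G \<bullet> emb \<Omega> \<phi>))"

lemma weak_deriv_emb:
  assumes "\<Omega> \<in> sets lebesgue" "f \<in> L2 \<Omega>" "g \<in> L2 \<Omega>" "set \<beta> \<subseteq> Basis"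
  shows "weak_deriv \<Omega> \<beta> (emb \<Omega> f) (emb \<Omega> g) \<longleftrightarrow> is_weak_deriv \<Omega> \<beta> f g"
proof -
  have "emb \<Omega> f \<bullet> emb \<Omega> (partials \<beta> \<phi>) = (\<integral>x. f x * partials \<beta> \<phi> x \<partial>lebesgue_on \<Omega>)"
    "emb \<Omega> g \<bullet> emb \<Omega> \<phi> = (\<integral>x. g x * \<phi> x \<partial>lebesgue_on \<Omega>)"
    if "test_function \<Omega> \<phi>" for \<phi>
    using test_function_L2[OF assms(1) that] test_function_L2[OF assms(1) test_function_partials[OF that assms(4)]] assms
    by (simp_all add: inner_emb)
  then show ?thesis
    by (simp add: weak_deriv_def is_weak_deriv_def)
qed

text \<open>Test functions see only \<Omega>, so both derivatives must be supported there; the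
  fundamental lemma applies to their difference.\<close>

lemma weak_deriv_unique:
  assumes "open \<Omega>" "G \<in> l2_on \<Omega>" "H \<in> l2_on \<Omega>" "weak_deriv \<Omega> \<beta> F G" "weak_deriv \<Omega> \<beta> F H"
  shows "G = H"
proof -
  have \<Omega>: "\<Omega> \<in> sets lebesgue" using assms(1) by auto
  obtain h where h: "h \<in> L2 \<Omega>" "G - H = emb \<Omega> h"
    using l2_on_diff[OF \<Omega> assms(2,3)] by (auto simp: l2_on_def)
  have "AE x in lebesgue_on \<Omega>. h x = 0"
  proof (rule fundamental_lemma_calculus_of_variations[OF assms(1) h(1)])
    fix \<phi> assume \<phi>: "test_function \<Omega> \<phi>"
    have "(-1) ^ length \<beta> * (G \<bullet> emb \<Omega> \<phi>) = (-1) ^ length \<beta> * (H \<bullet> emb \<Omega> \<phi>)"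
      using assms(4,5) \<phi> by (simp add: weak_deriv_def)
    then have "(G - H) \<bullet> emb \<Omega> \<phi> = 0"
      by (simp add: inner_diff_left)
    then show "(\<integral>x. h x * \<phi> x \<partial>lebesgue_on \<Omega>) = 0"
      using inner_emb[OF \<Omega> h(1) test_function_L2[OF \<Omega> \<phi>]] h(2) by simp
  qed
  then have "emb \<Omega> h = emb \<Omega> (\<lambda>x. 0)"
    using emb_eq_iff[OF \<Omega> h(1) L2_zero[OF \<Omega>]] by simp
  then show ?thesis
    using h(2) by (simp add: emb_zero)
qed

lemma weak_deriv_add:
  "weak_deriv \<Omega> \<beta> F G \<Longrightarrow> weak_deriv \<Omega> \<beta> F' G' \<Longrightarrow> weak_deriv \<Omega> \<beta> (F + F') (G + G')"
  by (simp add: weak_deriv_def inner_add_left distrib_left)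

lemma weak_deriv_diff:
  "weak_deriv \<Omega> \<beta> F G \<Longrightarrow> weak_deriv \<Omega> \<beta> F' G' \<Longrightarrow> weak_deriv \<Omega> \<beta> (F - F') (G - G')"
  by (simp add: weak_deriv_def inner_diff_left right_diff_distrib)

lemma weak_deriv_scaleR:
  "weak_deriv \<Omega> \<beta> F G \<Longrightarrow> weak_deriv \<Omega> \<beta> (c *\<^sub>R F) (c *\<^sub>R G)"
  by (simp add: weak_deriv_def)

lemma weak_deriv_sum:
  "(\<And>i. i \<in> I \<Longrightarrow> weak_deriv \<Omega> \<beta> (F i) (G i)) \<Longrightarrow> weak_deriv \<Omega> \<beta> (\<Sum>i\<in>I. F i) (\<Sum>i\<in>I. G i)"
  by (simp add: weak_deriv_def inner_sum_left sum_distrib_left)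

lemma integral_inner_const:
  fixes F :: "'b::euclidean_space \<Rightarrow> 'c::{real_inner,banach}"
  assumes "F integrable_on S"
  shows "integral S F \<bullet> v = integral S (\<lambda>t. F t \<bullet> v)"
  using integral_linear[OF assms bounded_linear_inner_left[of v]] by (simp add: o_def)

lemma weak_deriv_integral:
  fixes F G :: "real \<Rightarrow> 'a::euclidean_space l2"
  assumes "F integrable_on S" "G integrable_on S" "\<And>t. t \<in> S \<Longrightarrow> weak_deriv \<Omega> \<beta> (F t) (G t)"
  shows "weak_deriv \<Omega> \<beta> (integral S F) (integral S G)"
  unfolding weak_deriv_def integral_inner_const[OF assms(1)] integral_inner_const[OF assms(2)]
proof (intro allI impI)
  fix \<phi> assume \<phi>: "test_function \<Omega> \<phi>"
  have "integral S (\<lambda>t. F t \<bullet> emb \<Omega> (partials \<beta> \<phi>)) = integral S (\<lambda>t. (- 1) ^ length \<beta> * (G t \<bullet> emb \<Omega> \<phi>))"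
    using assms(3) \<phi> by (intro integral_cong) (simp add: weak_deriv_def)
  then show "integral S (\<lambda>t. F t \<bullet> emb \<Omega> (partials \<beta> \<phi>)) = (- 1) ^ length \<beta> * integral S (\<lambda>t. G t \<bullet> emb \<Omega> \<phi>)"
    by simp
qed

text \<open>Use \<open>partials \<beta> \<phi>\<close> as test function for the derivative along
  \<open>\<gamma>\<close>; the signs multiply.\<close>

lemma weak_deriv_append:
  assumes "weak_deriv \<Omega> \<gamma> F G" "weak_deriv \<Omega> (\<gamma> @ \<beta>) F K" "set \<beta> \<subseteq> Basis"
  shows "weak_deriv \<Omega> \<beta> G K"
  unfolding weak_deriv_def
proof (intro allI impI)
  fix \<phi> assume \<phi>: "test_function \<Omega> \<phi>"
  have "F \<bullet> emb \<Omega> (partials \<gamma> (partials \<beta> \<phi>)) = (- 1) ^ length \<gamma> * (G \<bullet> emb \<Omega> (partials \<beta> \<phi>))"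
    using assms(1) test_function_partials[OF \<phi> assms(3)] by (simp add: weak_deriv_def)
  moreover have "F \<bullet> emb \<Omega> (partials (\<gamma> @ \<beta>) \<phi>) = (- 1) ^ length (\<gamma> @ \<beta>) * (K \<bullet> emb \<Omega> \<phi>)"
    using assms(2) \<phi> by (simp add: weak_deriv_def)
  ultimately have "(- 1) ^ length \<gamma> * (G \<bullet> emb \<Omega> (partials \<beta> \<phi>)) =
      (- 1) ^ length \<gamma> * ((- 1) ^ length \<beta> * (K \<bullet> emb \<Omega> \<phi>))"
    by (simp add: partials_append power_add mult.assoc)
  then show "G \<bullet> emb \<Omega> (partials \<beta> \<phi>) = (- 1) ^ length \<beta> * (K \<bullet> emb \<Omega> \<phi>)"
    by simp
qed

section \<open>Chosen weak derivatives and Sobolev norms\<close>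

definition emb_deriv :: "'a::euclidean_space set \<Rightarrow> 'a list \<Rightarrow> ('a \<Rightarrow> real) \<Rightarrow> 'a l2" where
  "emb_deriv \<Omega> \<beta> f = emb \<Omega> (wderiv \<Omega> \<beta> f)"

text \<open>The way through the choice in \<open>wderiv\<close>: one qualifying class
  \<open>G\<close> makes the choice legitimate, and uniqueness makes the class of the chosen
  function equal to \<open>G\<close>.\<close>

lemma emb_deriv_eqI:
  assumes "open \<Omega>" "f \<in> L2 \<Omega>" "G \<in> l2_on \<Omega>" "weak_deriv \<Omega> \<beta> (emb \<Omega> f) G" "set \<beta> \<subseteq> Basis"
  shows "wderiv \<Omega> \<beta> f \<in> L2 \<Omega>" "emb_deriv \<Omega> \<beta> f = G"
proof -
  have \<Omega>: "\<Omega> \<in> sets lebesgue" using assms(1) by auto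
  obtain g where g: "g \<in> L2 \<Omega>" "G = emb \<Omega> g"
    using assms(3) by (auto simp: l2_on_def)
  then have "g \<in> L2 \<Omega> \<and> is_weak_deriv \<Omega> \<beta> f g"
    using assms weak_deriv_emb[OF \<Omega> assms(2) g(1) assms(5)] by simp
  from someI[of "\<lambda>g. g \<in> L2 \<Omega> \<and> is_weak_deriv \<Omega> \<beta> f g", OF this]
  have w: "wderiv \<Omega> \<beta> f \<in> L2 \<Omega>" "is_weak_deriv \<Omega> \<beta> f (wderiv \<Omega> \<beta> f)"
    by (simp_all add: wderiv_def)
  then show "wderiv \<Omega> \<beta> f \<in> L2 \<Omega>" by simp
  have "weak_deriv \<Omega> \<beta> (emb \<Omega> f) (emb_deriv \<Omega> \<beta> f)"
    using weak_deriv_emb[OF \<Omega> assms(2) w(1) assms(5)] w(2) by (simp add: emb_deriv_def)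
  then show "emb_deriv \<Omega> \<beta> f = G"
    using w(1) by (intro weak_deriv_unique[OF assms(1) _ assms(3) _ assms(4)]) (auto simp: emb_deriv_def l2_on_def)
qed

lemma multi_indicesD: "\<beta> \<in> multi_indices k \<Longrightarrow> set \<beta> \<subseteq> Basis"
  by (simp add: multi_indices_def)

lemma finite_multi_indices: "finite (multi_indices k)"
  unfolding multi_indices_def by (rule finite_lists_length_le) simp

lemma sobolev_L2: "f \<in> sobolev \<Omega> k \<Longrightarrow> f \<in> L2 \<Omega>"
  by (simp add: sobolev_def)

lemma sobolev_mono: "f \<in> sobolev \<Omega> k \<Longrightarrow> j \<le> k \<Longrightarrow> f \<in> sobolev \<Omega> j"
  unfolding sobolev_def multi_indices_def by auto

lemma sobolev_emb_deriv:
  assumes "open \<Omega>" "f \<in> sobolev \<Omega> k" "\<beta> \<in> multi_indices k"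
  shows "wderiv \<Omega> \<beta> f \<in> L2 \<Omega>" "weak_deriv \<Omega> \<beta> (emb \<Omega> f) (emb_deriv \<Omega> \<beta> f)" "emb_deriv \<Omega> \<beta> f \<in> l2_on \<Omega>"
proof -
  have \<Omega>: "\<Omega> \<in> sets lebesgue" using assms(1) by auto
  have f: "f \<in> L2 \<Omega>" using assms(2) by (rule sobolev_L2)
  obtain g where g: "g \<in> L2 \<Omega>" "is_weak_deriv \<Omega> \<beta> f g"
    using assms(2,3) unfolding sobolev_def by blast
  then have *: "weak_deriv \<Omega> \<beta> (emb \<Omega> f) (emb \<Omega> g)" "emb \<Omega> g \<in> l2_on \<Omega>"
    using weak_deriv_emb[OF \<Omega> f g(1) multi_indicesD[OF assms(3)]] by (auto simp: l2_on_def)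
  note ** = emb_deriv_eqI[OF assms(1) f *(2,1) multi_indicesD[OF assms(3)]]
  show "wderiv \<Omega> \<beta> f \<in> L2 \<Omega>" by (rule **(1))
  show "weak_deriv \<Omega> \<beta> (emb \<Omega> f) (emb_deriv \<Omega> \<beta> f)" "emb_deriv \<Omega> \<beta> f \<in> l2_on \<Omega>"
    using * ** by simp_all
qed

text \<open>One summand of the Sobolev norm. Through this bound convergence in H^k becomes
  convergence of every derivative in the Hilbert space.\<close>

lemma norm_emb_deriv_le:
  assumes "\<Omega> \<in> sets lebesgue" "\<beta> \<in> multi_indices k" "wderiv \<Omega> \<beta> f \<in> L2 \<Omega>"
  shows "norm (emb_deriv \<Omega> \<beta> f) \<le> sobolev_norm \<Omega> k f"
proof -
  have "norm (emb_deriv \<Omega> \<beta> f) = sqrt ((L2_norm \<Omega> (wderiv \<Omega> \<beta> f))\<^sup>2)"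
    using norm_emb[OF assms(1,3)] norm_ge_zero[of "emb_deriv \<Omega> \<beta> f"] by (simp add: emb_deriv_def)
  also have "\<dots> \<le> sobolev_norm \<Omega> k f"
    unfolding sobolev_norm_def using assms(2) finite_multi_indices
    by (intro real_sqrt_le_mono member_le_sum) auto
  finally show ?thesis .
qed

lemma emb_laplacian:
  assumes "open \<Omega>" "f \<in> sobolev \<Omega> 2"
  shows "laplacian \<Omega> f \<in> L2 \<Omega>" "emb \<Omega> (laplacian \<Omega> f) = (\<Sum>i\<in>Basis. emb_deriv \<Omega> [i, i] f)"
proof -
  have \<Omega>: "\<Omega> \<in> sets lebesgue" using assms(1) by auto
  have *: "wderiv \<Omega> [i, i] f \<in> L2 \<Omega>" if "i \<in> Basis" for i
    using that by (intro sobolev_emb_deriv[OF assms]) (simp add: multi_indices_def)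
  show "laplacian \<Omega> f \<in> L2 \<Omega>"
    unfolding laplacian_def[abs_def] using \<Omega> * by (rule L2_sum)
  show "emb \<Omega> (laplacian \<Omega> f) = (\<Sum>i\<in>Basis. emb_deriv \<Omega> [i, i] f)"
    unfolding laplacian_def[abs_def] emb_deriv_def using \<Omega> * by (rule emb_sum)
qed

lemma laplacian_sobolev:
  assumes "open \<Omega>" "f \<in> sobolev \<Omega> (k + 2)"
  shows "laplacian \<Omega> f \<in> sobolev \<Omega> k"
proof -
  have \<Omega>: "\<Omega> \<in> sets lebesgue" using assms(1) by auto
  have f2: "f \<in> sobolev \<Omega> 2" by (rule sobolev_mono[OF assms(2)]) simp
  note lap = emb_laplacian[OF assms(1) f2]
  have "\<exists>g\<in>L2 \<Omega>. is_weak_deriv \<Omega> \<beta> (laplacian \<Omega> f) g" if \<beta>: "\<beta> \<in> multi_indices k" for \<beta>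
  proof
    let ?g = "\<lambda>x. \<Sum>i\<in>Basis. wderiv \<Omega> ([i, i] @ \<beta>) f x"
    have mi: "[i, i] @ \<beta> \<in> multi_indices (k + 2)" "[i, i] \<in> multi_indices 2" if "i \<in> Basis" for i
      using that \<beta> by (auto simp: multi_indices_def)
    have *: "wderiv \<Omega> ([i, i] @ \<beta>) f \<in> L2 \<Omega>" if "i \<in> Basis" for i
      by (rule sobolev_emb_deriv(1)[OF assms mi(1)[OF that]])
    show g: "?g \<in> L2 \<Omega>" using \<Omega> * by (rule L2_sum)
    have "weak_deriv \<Omega> \<beta> (\<Sum>i\<in>Basis. emb_deriv \<Omega> [i, i] f) (\<Sum>i\<in>Basis. emb_deriv \<Omega> ([i, i] @ \<beta>) f)"
    proof (rule weak_deriv_sum)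
      fix i :: 'a assume i: "i \<in> Basis"
      show "weak_deriv \<Omega> \<beta> (emb_deriv \<Omega> [i, i] f) (emb_deriv \<Omega> ([i, i] @ \<beta>) f)"
        by (rule weak_deriv_append[OF sobolev_emb_deriv(2)[OF assms(1) f2 mi(2)[OF i]]
              sobolev_emb_deriv(2)[OF assms mi(1)[OF i]] multi_indicesD[OF \<beta>]])
    qed
    moreover have "(\<Sum>i\<in>Basis. emb_deriv \<Omega> ([i, i] @ \<beta>) f) = emb \<Omega> ?g"
      unfolding emb_deriv_def using \<Omega> * by (rule emb_sum[symmetric])
    ultimately show "is_weak_deriv \<Omega> \<beta> (laplacian \<Omega> f) ?g"
      using weak_deriv_emb[OF \<Omega> lap(1) g multi_indicesD[OF \<beta>]] lap(2) by simp
  qed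
  then show ?thesis
    using lap(1) by (simp add: sobolev_def)
qed

text \<open>The relation \<open>dirichlet_laplacian \<Omega> w g l\<close> says that \<open>w\<close> is an \<open>H\<^sup>1\<^sub>0\<close> function with gradient
  \<open>g\<close> and weak Laplacian \<open>l\<close>. It is stated for classes, so that differences of solutions need no representatives.\<close>

definition dirichlet_laplacian ::
  "'a::euclidean_space set \<Rightarrow> 'a l2 \<Rightarrow> ('a \<Rightarrow> 'a l2) \<Rightarrow> 'a l2 \<Rightarrow> bool" where
  "dirichlet_laplacian \<Omega> w g l \<longleftrightarrow>
     (\<exists>\<phi>. (\<forall>k::nat. test_function \<Omega> (\<phi> k)) \<and> (\<lambda>k. emb \<Omega> (\<phi> k)) \<longlonglongrightarrow> w \<and>
        (\<forall>i\<in>Basis. (\<lambda>k. emb \<Omega> (partials [i] (\<phi> k))) \<longlonglongrightarrow> g i)) \<and>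
     (\<forall>\<psi>. test_function \<Omega> \<psi> \<longrightarrow> (\<Sum>i\<in>Basis. g i \<bullet> emb \<Omega> (partials [i] \<psi>)) = - (l \<bullet> emb \<Omega> \<psi>))"

text \<open>Use test functions approximating \<open>w'\<close> in the weak equation for
  \<open>w\<close> and pass to the limit. No boundary term arises because \<open>w'\<close> has zero
  trace.\<close>

lemma dirichlet_laplacian_green:
  assumes "dirichlet_laplacian \<Omega> w g l" "dirichlet_laplacian \<Omega> w' g' l'"
  shows "l \<bullet> w' = - (\<Sum>i\<in>Basis. g i \<bullet> g' i)"
proof -
  obtain \<phi> where \<phi>: "\<forall>k::nat. test_function \<Omega> (\<phi> k)" "(\<lambda>k. emb \<Omega> (\<phi> k)) \<longlonglongrightarrow> w'"
      "\<forall>i\<in>Basis. (\<lambda>k. emb \<Omega> (partials [i] (\<phi> k))) \<longlonglongrightarrow> g' i"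
    using assms(2) unfolding dirichlet_laplacian_def by blast
  have "(\<Sum>i\<in>Basis. g i \<bullet> emb \<Omega> (partials [i] (\<phi> k))) = - (l \<bullet> emb \<Omega> (\<phi> k))" for k
    using assms(1) \<phi>(1) unfolding dirichlet_laplacian_def by blast
  moreover have "(\<lambda>k. \<Sum>i\<in>Basis. g i \<bullet> emb \<Omega> (partials [i] (\<phi> k))) \<longlonglongrightarrow> (\<Sum>i\<in>Basis. g i \<bullet> g' i)"
    using \<phi>(3) by (intro tendsto_sum tendsto_inner tendsto_const) blast
  moreover have "(\<lambda>k. - (l \<bullet> emb \<Omega> (\<phi> k))) \<longlonglongrightarrow> - (l \<bullet> w')"
    using \<phi>(2) by (intro tendsto_minus tendsto_inner tendsto_const)
  ultimately have "(\<Sum>i\<in>Basis. g i \<bullet> g' i) = - (l \<bullet> w')"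
    by (simp add: LIMSEQ_unique)
  then show ?thesis by simp
qed

lemma dirichlet_laplacian_diff:
  assumes \<Omega>: "\<Omega> \<in> sets lebesgue"
    and 1: "dirichlet_laplacian \<Omega> w g l" and 2: "dirichlet_laplacian \<Omega> w' g' l'"
  shows "dirichlet_laplacian \<Omega> (w - w') (\<lambda>i. g i - g' i) (l - l')"
proof -
  obtain \<phi> where \<phi>: "\<forall>k::nat. test_function \<Omega> (\<phi> k)" "(\<lambda>k. emb \<Omega> (\<phi> k)) \<longlonglongrightarrow> w"
      "\<forall>i\<in>Basis. (\<lambda>k. emb \<Omega> (partials [i] (\<phi> k))) \<longlonglongrightarrow> g i"
    using 1 unfolding dirichlet_laplacian_def by blast
  obtain \<psi> where \<psi>: "\<forall>k::nat. test_function \<Omega> (\<psi> k)" "(\<lambda>k. emb \<Omega> (\<psi> k)) \<longlonglongrightarrow> w'"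
      "\<forall>i\<in>Basis. (\<lambda>k. emb \<Omega> (partials [i] (\<psi> k))) \<longlonglongrightarrow> g' i"
    using 2 unfolding dirichlet_laplacian_def by blast
  have L2: "\<phi> k \<in> L2 \<Omega>" "\<psi> k \<in> L2 \<Omega>"
    "i \<in> Basis \<Longrightarrow> partials [i] (\<phi> k) \<in> L2 \<Omega>" "i \<in> Basis \<Longrightarrow> partials [i] (\<psi> k) \<in> L2 \<Omega>" for k i
    using \<phi>(1) \<psi>(1) test_function_L2[OF \<Omega>] test_function_partial by blast+
  show ?thesis
    unfolding dirichlet_laplacian_def
  proof (intro conjI exI allI ballI impI)
    show "test_function \<Omega> (\<lambda>x. \<phi> k x - \<psi> k x)" for k
      using \<phi>(1) \<psi>(1) by (intro test_function_diff) blast+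
    show "(\<lambda>k. emb \<Omega> (\<lambda>x. \<phi> k x - \<psi> k x)) \<longlonglongrightarrow> w - w'"
      using \<phi>(2) \<psi>(2) by (simp add: emb_diff[OF \<Omega> L2(1,2)] tendsto_diff)
    show "(\<lambda>k. emb \<Omega> (partials [i] (\<lambda>x. \<phi> k x - \<psi> k x))) \<longlonglongrightarrow> g i - g' i" if i: "i \<in> Basis" for i
    proof -
      have "emb \<Omega> (partials [i] (\<lambda>x. \<phi> k x - \<psi> k x)) = emb \<Omega> (partials [i] (\<phi> k)) - emb \<Omega> (partials [i] (\<psi> k))" for k
        unfolding partials_diff_test_function[OF spec[OF \<phi>(1)] spec[OF \<psi>(1)]] by (rule emb_diff[OF \<Omega> L2(3,4)[OF i]])
      then show ?thesis
        using \<phi>(3) \<psi>(3) i by (simp add: tendsto_diff del: partials.simps)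
    qed
    fix \<xi> assume "test_function \<Omega> \<xi>"
    then have "(\<Sum>i\<in>Basis. g i \<bullet> emb \<Omega> (partials [i] \<xi>)) = - (l \<bullet> emb \<Omega> \<xi>)"
      "(\<Sum>i\<in>Basis. g' i \<bullet> emb \<Omega> (partials [i] \<xi>)) = - (l' \<bullet> emb \<Omega> \<xi>)"
      using 1 2 unfolding dirichlet_laplacian_def by blast+
    then show "(\<Sum>i\<in>Basis. (g i - g' i) \<bullet> emb \<Omega> (partials [i] \<xi>)) = - ((l - l') \<bullet> emb \<Omega> \<xi>)"
      by (simp add: inner_diff_left sum_subtractf del: partials.simps)
  qed
qed

text \<open>The norm in \<open>H10\<close> involves the derivative chosen for the difference f -
  \<phi>_k; its class has to be identified with the difference of the derivatives before the limit
  can be taken.\<close>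

lemma dirichlet_laplacian_H10:
  assumes "open \<Omega>" "f \<in> sobolev \<Omega> 2" "f \<in> H10 \<Omega>"
  shows "dirichlet_laplacian \<Omega> (emb \<Omega> f) (\<lambda>i. emb_deriv \<Omega> [i] f) (emb \<Omega> (laplacian \<Omega> f))"
proof -
  have \<Omega>: "\<Omega> \<in> sets lebesgue" using assms(1) by auto
  have f: "f \<in> L2 \<Omega>" using assms(2) by (rule sobolev_L2)
  obtain \<phi> where \<phi>: "\<And>k::nat. test_function \<Omega> (\<phi> k)"
      and lim: "(\<lambda>k. sobolev_norm \<Omega> 1 (\<lambda>x. f x - \<phi> k x)) \<longlonglongrightarrow> 0"
    using assms(3) unfolding H10_def by blast
  have \<phi>L2: "\<phi> k \<in> L2 \<Omega>" for k by (rule test_function_L2[OF \<Omega> \<phi>])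
  \<comment> \<open>Stated for multi-indices, so that \<open>[]\<close> gives convergence of the
    functions and \<open>[i]\<close> that of their gradients.\<close>
  have conv: "(\<lambda>k. emb \<Omega> (partials \<beta> (\<phi> k))) \<longlonglongrightarrow> emb_deriv \<Omega> \<beta> f"
    if \<beta>: "\<beta> \<in> multi_indices 1"
      and wd: "\<And>k. weak_deriv \<Omega> \<beta> (emb \<Omega> (\<phi> k)) (emb \<Omega> (partials \<beta> (\<phi> k)))" for \<beta>
  proof -
    have \<beta>2: "\<beta> \<in> multi_indices 2" using \<beta> by (auto simp: multi_indices_def)
    note fd = sobolev_emb_deriv[OF assms(1,2) \<beta>2]
    have L2: "partials \<beta> (\<phi> k) \<in> L2 \<Omega>" for k
      by (rule test_function_L2[OF \<Omega> test_function_partials[OF \<phi> multi_indicesD[OF \<beta>]]])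
    have bound: "norm (emb \<Omega> (partials \<beta> (\<phi> k)) - emb_deriv \<Omega> \<beta> f) \<le> sobolev_norm \<Omega> 1 (\<lambda>x. f x - \<phi> k x)" for k
    proof -
      have G: "emb_deriv \<Omega> \<beta> f - emb \<Omega> (partials \<beta> (\<phi> k)) \<in> l2_on \<Omega>"
        using L2 by (intro l2_on_diff[OF \<Omega> fd(3)]) (auto simp: l2_on_def)
      have "weak_deriv \<Omega> \<beta> (emb \<Omega> (\<lambda>x. f x - \<phi> k x)) (emb_deriv \<Omega> \<beta> f - emb \<Omega> (partials \<beta> (\<phi> k)))"
        unfolding emb_diff[OF \<Omega> f \<phi>L2] by (rule weak_deriv_diff[OF fd(2) wd])
      note * = emb_deriv_eqI[OF assms(1) L2_diff[OF \<Omega> f \<phi>L2] G this multi_indicesD[OF \<beta>]]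
      show ?thesis
        using norm_emb_deriv_le[OF \<Omega> \<beta> *(1)] *(2) by (simp add: norm_minus_commute)
    qed
    have "(\<lambda>k. emb \<Omega> (partials \<beta> (\<phi> k)) - emb_deriv \<Omega> \<beta> f) \<longlonglongrightarrow> 0"
      by (rule Lim_null_comparison[OF _ lim]) (intro always_eventually allI bound)
    then show ?thesis by (simp add: LIM_zero_iff)
  qed
  have f0: "emb_deriv \<Omega> [] f = emb \<Omega> f"
    by (rule emb_deriv_eqI[OF assms(1) f]) (use f in \<open>auto simp: l2_on_def weak_deriv_def\<close>)
  have "(\<lambda>k. emb \<Omega> (partials [] (\<phi> k))) \<longlonglongrightarrow> emb_deriv \<Omega> [] f"
    by (rule conv) (auto simp: multi_indices_def weak_deriv_def)
  then have 1: "(\<lambda>k. emb \<Omega> (\<phi> k)) \<longlonglongrightarrow> emb \<Omega> f" by (simp add: f0)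
  have 2: "(\<lambda>k. emb \<Omega> (partials [i] (\<phi> k))) \<longlonglongrightarrow> emb_deriv \<Omega> [i] f" if i: "i \<in> Basis" for i
  proof (rule conv)
    show "[i] \<in> multi_indices 1" using i by (simp add: multi_indices_def)
    show "weak_deriv \<Omega> [i] (emb \<Omega> (\<phi> k)) (emb \<Omega> (partials [i] (\<phi> k)))" for k
      using weak_deriv_emb[OF \<Omega> \<phi>L2 test_function_L2[OF \<Omega> test_function_partial[OF \<phi> i]], of "[i]" k]
        is_weak_deriv_test_function[OF \<Omega> \<phi> i] i by simp
  qed
  have 3: "(\<Sum>i\<in>Basis. emb_deriv \<Omega> [i] f \<bullet> emb \<Omega> (partials [i] \<psi>)) = - (emb \<Omega> (laplacian \<Omega> f) \<bullet> emb \<Omega> \<psi>)"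
    if \<psi>: "test_function \<Omega> \<psi>" for \<psi>
  proof -
    have "emb_deriv \<Omega> [i] f \<bullet> emb \<Omega> (partials [i] \<psi>) = - (emb_deriv \<Omega> [i, i] f \<bullet> emb \<Omega> \<psi>)" if i: "i \<in> Basis" for i
    proof -
      have "weak_deriv \<Omega> [i] (emb_deriv \<Omega> [i] f) (emb_deriv \<Omega> [i, i] f)"
        by (rule weak_deriv_append[OF sobolev_emb_deriv(2)[OF assms(1,2)] , of "[i]" "[i]"])
           (use i sobolev_emb_deriv(2)[OF assms(1,2), of "[i, i]"] in \<open>auto simp: multi_indices_def\<close>)
      then show ?thesis
        using \<psi> by (simp add: weak_deriv_def del: partials.simps)
    qed
    then show ?thesis
      by (simp add: emb_laplacian[OF assms(1,2)] inner_sum_left sum_negf del: partials.simps)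
  qed
  show ?thesis
    unfolding dirichlet_laplacian_def using \<phi> 1 2 3 by blast
qed

text \<open>Testing \<open>\<nabla>w = 0\<close> with \<open>x\<^sub>i \<phi>\<close>, where \<open>\<phi> \<longlonglongrightarrow> w\<close> in \<open>H\<^sup>1\<^sub>0\<close>, gives \<open>\<integral>w\<^sup>2 = 0\<close>.\<close>

lemma dirichlet_laplacian_grad_zero:
  assumes "open \<Omega>" "bounded \<Omega>" "dirichlet_laplacian \<Omega> w g l" "\<And>i. i \<in> Basis \<Longrightarrow> g i = 0"
  shows "w = 0"
proof -
  have \<Omega>: "\<Omega> \<in> sets lebesgue" using assms(1) by auto
  obtain \<phi> where \<phi>: "\<And>k::nat. test_function \<Omega> (\<phi> k)" and lim: "(\<lambda>k. emb \<Omega> (\<phi> k)) \<longlonglongrightarrow> w"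
      and limd: "\<forall>i\<in>Basis. (\<lambda>k. emb \<Omega> (partials [i] (\<phi> k))) \<longlonglongrightarrow> g i"
    using assms(3) unfolding dirichlet_laplacian_def by blast
  obtain i :: 'a where i: "i \<in> Basis" using nonempty_Basis by blast
  obtain R where R: "\<forall>x\<in>\<Omega>. norm x \<le> R" using assms(2) by (auto simp: bounded_iff)
  \<comment> \<open>For empty \<Omega> the bound \<open>R\<close> may be negative.\<close>
  define R' where "R' = max R 0"
  \<comment> \<open>A vanishing i-th derivative means that \<open>w\<close> is orthogonal to the
    i-th partials of all test functions.\<close>
  have w0: "w \<bullet> emb \<Omega> (partials [i] \<psi>) = 0" if \<psi>: "test_function \<Omega> \<psi>" for \<psi>
  proof -
    have "emb \<Omega> (\<phi> k) \<bullet> emb \<Omega> (partials [i] \<psi>) = - (emb \<Omega> (partials [i] (\<phi> k)) \<bullet> emb \<Omega> \<psi>)" for k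
      using weak_deriv_emb[OF \<Omega> test_function_L2[OF \<Omega> \<phi>] test_function_L2[OF \<Omega> test_function_partial[OF \<phi> i]], of "[i]" k k]
        is_weak_deriv_test_function[OF \<Omega> \<phi> i, of k] i \<psi> by (simp add: weak_deriv_def del: partials.simps)
    moreover have "(\<lambda>k. emb \<Omega> (\<phi> k) \<bullet> emb \<Omega> (partials [i] \<psi>)) \<longlonglongrightarrow> w \<bullet> emb \<Omega> (partials [i] \<psi>)"
      by (intro tendsto_inner lim tendsto_const)
    moreover have "(\<lambda>k. - (emb \<Omega> (partials [i] (\<phi> k)) \<bullet> emb \<Omega> \<psi>)) \<longlonglongrightarrow> - (g i \<bullet> emb \<Omega> \<psi>)"
      using limd i by (intro tendsto_minus tendsto_inner tendsto_const) blast
    ultimately have "w \<bullet> emb \<Omega> (partials [i] \<psi>) = - (g i \<bullet> emb \<Omega> \<psi>)"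
      by (simp add: LIMSEQ_unique)
    then show ?thesis using assms(4)[OF i] by simp
  qed
  have xi: "smooth_on UNIV (\<lambda>x::'a. x \<bullet> i)" by (rule smooth_on_UNIV_inner)
  let ?h = "\<lambda>k x. (x \<bullet> i) * partials [i] (\<phi> k) x"
  have hL2: "?h k \<in> L2 \<Omega>" for k
    by (rule test_function_L2[OF \<Omega> test_function_mult[OF test_function_partial[OF \<phi> i] xi]])
  have h0: "(\<lambda>k. emb \<Omega> (?h k)) \<longlonglongrightarrow> 0"
  proof (rule Lim_null_comparison)
    show "(\<lambda>k. R' * norm (emb \<Omega> (partials [i] (\<phi> k)))) \<longlonglongrightarrow> 0"
      using limd i assms(4)[OF i] by (auto intro!: tendsto_mult_right_zero tendsto_norm_zero simp del: partials.simps)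
    have "norm (emb \<Omega> (?h k)) \<le> R' * norm (emb \<Omega> (partials [i] (\<phi> k)))" for k
    proof -
      let ?d = "partials [i] (\<phi> k)"
      have dL2: "?d \<in> L2 \<Omega>" by (rule test_function_L2[OF \<Omega> test_function_partial[OF \<phi> i]])
      have "(\<integral>x. (?h k x)\<^sup>2 \<partial>lebesgue_on \<Omega>) \<le> (\<integral>x. R'\<^sup>2 * (?d x)\<^sup>2 \<partial>lebesgue_on \<Omega>)"
      proof (rule integral_mono)
        show "integrable (lebesgue_on \<Omega>) (\<lambda>x. (?h k x)\<^sup>2)"
          "integrable (lebesgue_on \<Omega>) (\<lambda>x. R'\<^sup>2 * (?d x)\<^sup>2)"
          using hL2[of k] dL2 by (simp_all add: L2_def del: partials.simps)
        fix x assume "x \<in> space (lebesgue_on \<Omega>)"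
        then have "x \<in> \<Omega>" by simp
        have "\<bar>x \<bullet> i\<bar> \<le> R'"
          using Basis_le_norm[OF i, of x] R \<open>x \<in> \<Omega>\<close> unfolding R'_def by force
        then have "(x \<bullet> i)\<^sup>2 \<le> R'\<^sup>2" by (rule abs_le_square_iff[THEN iffD1, OF order_trans[OF _ abs_ge_self]])
        then show "(?h k x)\<^sup>2 \<le> R'\<^sup>2 * (?d x)\<^sup>2"
          unfolding power_mult_distrib by (rule mult_right_mono) simp
      qed
      moreover have "(norm (emb \<Omega> f))\<^sup>2 = (\<integral>x. (f x)\<^sup>2 \<partial>lebesgue_on \<Omega>)" if "f \<in> L2 \<Omega>" for f
        by (simp only: power2_norm_eq_inner inner_emb[OF \<Omega> that that]) (simp only: power2_eq_square)
      ultimately have "(norm (emb \<Omega> (?h k)))\<^sup>2 \<le> (R' * norm (emb \<Omega> ?d))\<^sup>2"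
        unfolding power_mult_distrib[of R'] using hL2[of k] dL2 by (simp del: partials.simps)
      then show ?thesis
        by (rule power2_le_imp_le) (simp add: R'_def)
    qed
    then show "\<forall>\<^sub>F k in sequentially. norm (emb \<Omega> (?h k)) \<le> R' * norm (emb \<Omega> (partials [i] (\<phi> k)))"
      by simp
  qed
  \<comment> \<open>The sum is the class of the i-th partial of
    \<open>(x \<bullet> i) * \<phi> k x\<close>, to which \<open>w\<close> is orthogonal. Its first
    summand tends to 0, because \<Omega> is bounded.\<close>
  have "w \<bullet> (emb \<Omega> (?h k) + emb \<Omega> (\<phi> k)) = 0" for k
  proof -
    have "partials [i] (\<lambda>x. (x \<bullet> i) * \<phi> k x) = (\<lambda>x. ?h k x + \<phi> k x)"
      using partials_mult[of "\<lambda>x. x \<bullet> i" "\<phi> k" i] i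
      by (simp add: partials_inner smooth_on_UNIV_differentiable[OF xi] test_function_differentiable[OF \<phi>] inner_same_Basis del: partials.simps)
    then have "emb \<Omega> (partials [i] (\<lambda>x. (x \<bullet> i) * \<phi> k x)) = emb \<Omega> (?h k) + emb \<Omega> (\<phi> k)"
      using emb_add[OF \<Omega> hL2 test_function_L2[OF \<Omega> \<phi>]] by simp
    then show ?thesis
      using w0[OF test_function_mult[OF \<phi> xi], of k] by simp
  qed
  moreover have "(\<lambda>k. w \<bullet> (emb \<Omega> (?h k) + emb \<Omega> (\<phi> k))) \<longlonglongrightarrow> w \<bullet> (0 + w)"
    by (intro tendsto_inner tendsto_add h0 lim tendsto_const)
  ultimately have "w \<bullet> w = 0"
    by (simp add: LIMSEQ_const_iff)
  then show ?thesis by simp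
qed

section \<open>Logarithmic convexity\<close>

lemma nondecreasing_of_DERIV:
  fixes f :: "real \<Rightarrow> real"
  assumes "a \<le> b" "\<And>x. a \<le> x \<Longrightarrow> x \<le> b \<Longrightarrow> (f has_real_derivative f' x) (at x)"
    "\<And>x. a \<le> x \<Longrightarrow> x \<le> b \<Longrightarrow> 0 \<le> f' x"
  shows "f a \<le> f b"
  by (rule DERIV_nonneg_imp_nondecreasing[OF assms(1)]) (use assms(2,3) in blast)

text \<open>With \<open>y = f' - m\<close> the hypotheses give \<open>(y/f)' \<ge> - (m/f) (y/f)\<close>. Since \<open>f\<close> grows at least
  quadratically, \<open>m/f\<close> is integrable, so that \<open>y/f\<close> stays away from zero.\<close>

lemma exponential_growth:
  fixes f f' f'' :: "real \<Rightarrow> real"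
  assumes D1: "\<And>t. t \<ge> t1 \<Longrightarrow> (f has_real_derivative f' t) (at t)"
    and D2: "\<And>t. t \<ge> t1 \<Longrightarrow> (f' has_real_derivative f'' t) (at t)"
    and conv: "\<And>t. t \<ge> t1 \<Longrightarrow> (f' t - m)\<^sup>2 \<le> f t * f'' t"
    and lower: "\<And>t. t \<ge> t1 \<Longrightarrow> \<epsilon> \<le> f'' t" and "\<epsilon> > 0" "m \<ge> 0"
  shows "\<exists>t2\<ge>t1. \<exists>\<kappa>>0. f t2 > 0 \<and> (\<forall>t\<ge>t2. f t2 * exp (\<kappa> * (t - t2)) \<le> f t)"
proof -
  have f'_mono: "f' s + \<epsilon> * (t - s) \<le> f' t" if "t1 \<le> s" "s \<le> t" for s t
  proof -
    have "f' s - \<epsilon> * s \<le> f' t - \<epsilon> * t"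
      using that lower
      by (intro nondecreasing_of_DERIV[where f = "\<lambda>t. f' t - \<epsilon> * t" and f' = "\<lambda>t. f'' t - \<epsilon>"])
         (auto intro!: derivative_eq_intros D2)
    then show ?thesis by (simp add: algebra_simps)
  qed
  \<comment> \<open>By this time the growth \<epsilon> (s1 - t1) of f' has made up for a negative
    \<open>f' t1\<close> and leaves at least m + 1.\<close>
  define s1 where "s1 = t1 + (m + 1 + \<bar>f' t1\<bar>) / \<epsilon>"
  have s1: "s1 \<ge> t1" using \<open>\<epsilon> > 0\<close> \<open>m \<ge> 0\<close> by (simp add: s1_def)
  have f's1: "f' t \<ge> m + 1" if "t \<ge> s1" for t
  proof -
    have "\<epsilon> * (t - t1) \<ge> \<epsilon> * (s1 - t1)"
      using that \<open>\<epsilon> > 0\<close> by simp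
    also have "\<epsilon> * (s1 - t1) = m + 1 + \<bar>f' t1\<bar>"
      using \<open>\<epsilon> > 0\<close> by (simp add: s1_def)
    finally show ?thesis
      using f'_mono[of t1 t] s1 that by linarith
  qed
  have f_lin: "f s1 + (t - s1) \<le> f t" if "t \<ge> s1" for t
  proof -
    have "f s1 - s1 \<le> f t - t"
    proof (rule nondecreasing_of_DERIV[where f = "\<lambda>t. f t - t" and f' = "\<lambda>t. f' t - 1"])
      show "((\<lambda>t. f t - t) has_real_derivative f' x - 1) (at x)" if "s1 \<le> x" for x
        using that s1 by (auto intro!: derivative_eq_intros D1)
      show "0 \<le> f' x - 1" if "s1 \<le> x" for x
        using f's1[OF that] \<open>m \<ge> 0\<close> by simp
    qed (rule that)
    then show ?thesis by simp
  qed
  \<comment> \<open>From \<open>s1\<close> on, f has slope at least 1, so this delay lifts it to at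
    least 1.\<close>
  define t2 where "t2 = s1 + \<bar>f s1\<bar> + 1"
  have t2: "t2 \<ge> s1" "t2 \<ge> t1" using s1 by (auto simp: t2_def)
  have ft2: "f t2 \<ge> 1" using f_lin[of t2] by (simp add: t2_def)
  have f'_pos: "f' t \<ge> m + 1" if "t \<ge> t2" for t
    using f's1 that t2 by simp
  have f_quad: "f t2 + \<epsilon> / 2 * (t - t2)\<^sup>2 \<le> f t" if "t \<ge> t2" for t
  proof -
    have "f t2 - \<epsilon> / 2 * (t2 - t2)\<^sup>2 \<le> f t - \<epsilon> / 2 * (t - t2)\<^sup>2"
    proof (rule nondecreasing_of_DERIV[where f = "\<lambda>t. f t - \<epsilon> / 2 * (t - t2)\<^sup>2" and f' = "\<lambda>t. f' t - \<epsilon> * (t - t2)"])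
      show "((\<lambda>t. f t - \<epsilon> / 2 * (t - t2)\<^sup>2) has_real_derivative f' x - \<epsilon> * (x - t2)) (at x)" if "t2 \<le> x" for x
        using that t2 by (auto intro!: derivative_eq_intros D1)
      show "0 \<le> f' x - \<epsilon> * (x - t2)" if "t2 \<le> x" for x
        using f'_mono[OF t2(2) that] f'_pos[of t2] \<open>m \<ge> 0\<close> by simp
    qed (rule that)
    then show ?thesis by simp
  qed
  \<comment> \<open>The two bounds in the minimum match the two terms of (1 + s)^2 \<le> 2 + 2 s^2
    with the constant and the quadratic term in \<open>f_quad\<close>.\<close>
  define \<delta> where "\<delta> = min (f t2) (\<epsilon> / 2) / 2"
  have \<delta>: "\<delta> > 0" "2 * \<delta> \<le> f t2" "2 * \<delta> \<le> \<epsilon> / 2"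
    using ft2 \<open>\<epsilon> > 0\<close> by (auto simp: \<delta>_def)
  have f_low: "\<delta> * (1 + (t - t2))\<^sup>2 \<le> f t" if "t \<ge> t2" for t
  proof -
    have "(1 + (t - t2))\<^sup>2 \<le> 2 + 2 * (t - t2)\<^sup>2"
      using zero_le_power2[of "1 - (t - t2)"] by (simp add: power2_eq_square algebra_simps)
    then have "\<delta> * (1 + (t - t2))\<^sup>2 \<le> \<delta> * (2 + 2 * (t - t2)\<^sup>2)"
      using \<delta>(1) by (intro mult_left_mono) auto
    also have "\<dots> = 2 * \<delta> + (2 * \<delta>) * (t - t2)\<^sup>2" by (simp add: algebra_simps)
    also have "\<dots> \<le> f t2 + \<epsilon> / 2 * (t - t2)\<^sup>2"
      using \<delta> by (intro add_mono mult_right_mono) auto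
    finally show ?thesis using f_quad[OF that] by linarith
  qed
  have f_pos: "f t > 0" if "t \<ge> t2" for t
  proof -
    have "0 \<le> \<epsilon> / 2 * (t - t2)\<^sup>2" using \<open>\<epsilon> > 0\<close> by simp
    then show ?thesis using f_quad[OF that] ft2 by linarith
  qed
  \<comment> \<open>Integrating factor: its logarithmic derivative (m / \<delta>) / (1 + (t - t2))^2
    dominates m / f by \<open>f_low\<close>. It starts at exp (- m / \<delta>) > 0 and stays below
    1, so m costs only a constant factor in the rate.\<close>
  define e where "e = (\<lambda>t. exp (- (m / \<delta>) / (1 + (t - t2))))"
  define w where "w = (\<lambda>t. (f' t - m) / f t * e t)"
  define w' where "w' = (\<lambda>t. ((f'' t * f t - (f' t - m) * f' t) / (f t * f t)) * e t
      + (f' t - m) / f t * (e t * (m / \<delta> / (1 + (t - t2))\<^sup>2)))"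
  have e_pos: "e t > 0" and e_le: "t \<ge> t2 \<Longrightarrow> e t \<le> 1" for t
    using \<delta>(1) \<open>m \<ge> 0\<close> by (simp_all add: e_def)
  have w_mono: "w t2 \<le> w t" if "t \<ge> t2" for t
  proof (rule nondecreasing_of_DERIV[OF that, where f' = w'])
    fix x assume x: "t2 \<le> x"
    have de: "(e has_real_derivative e x * (m / \<delta> / (1 + (x - t2))\<^sup>2)) (at x)"
      unfolding e_def using x \<delta>(1) by (auto intro!: derivative_eq_intros simp: power2_eq_square)
    have dq: "((\<lambda>t. (f' t - m) / f t) has_real_derivative
        (f'' x * f x - (f' x - m) * f' x) / (f x * f x)) (at x)"
      using f_pos[OF x] x t2 by (auto intro!: derivative_eq_intros D1 D2)
    show "(w has_real_derivative w' x) (at x)"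
      unfolding w_def by (rule DERIV_cong[OF DERIV_mult[OF dq de]]) (simp add: w'_def mult.commute)
    have fx: "f x > 0" by (rule f_pos[OF x])
    have xx: "(1 + (x - t2))\<^sup>2 > 0" using x by simp
    define p where "p = m / \<delta> / (1 + (x - t2))\<^sup>2"
    have "m * (\<delta> * (1 + (x - t2))\<^sup>2) \<le> m * f x"
      using f_low[OF x] \<open>m \<ge> 0\<close> by (rule mult_left_mono)
    then have "m \<le> f x * p"
      using \<delta>(1) xx by (simp add: p_def field_simps)
    then have "(f' x - m) * m \<le> (f' x - m) * (f x * p)"
      using f'_pos[OF x] by (intro mult_left_mono) auto
    then have "0 \<le> f'' x * f x - (f' x - m) * f' x + (f' x - m) * (f x * p)"
      using conv[of x] x t2 by (simp add: power2_eq_square algebra_simps)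
    moreover have "w' x = e x / (f x * f x) * (f'' x * f x - (f' x - m) * f' x + (f' x - m) * (f x * p))"
      unfolding w'_def p_def[symmetric] using fx by (simp add: field_simps)
    ultimately show "0 \<le> w' x"
      using e_pos[of x] fx by simp
  qed
  define \<kappa> where "\<kappa> = w t2"
  have \<kappa>: "\<kappa> > 0"
    using f_pos[of t2] f'_pos[of t2] e_pos[of t2] by (simp add: \<kappa>_def w_def)
  have growth: "\<kappa> * f t \<le> f' t" if "t \<ge> t2" for t
  proof -
    have "\<kappa> \<le> (f' t - m) / f t * e t"
      using w_mono[OF that] by (simp add: \<kappa>_def w_def)
    also have "\<dots> \<le> (f' t - m) / f t * 1"
      using e_le[OF that] f_pos[OF that] f'_pos[OF that] by (intro mult_left_mono) auto
    finally have "\<kappa> * f t \<le> f' t - m"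
      using f_pos[OF that] by (simp add: pos_le_divide_eq)
    then show ?thesis using \<open>m \<ge> 0\<close> by simp
  qed
  have "f t2 * exp (\<kappa> * (t - t2)) \<le> f t" if "t \<ge> t2" for t
  proof -
    have "f t2 * exp (- (\<kappa> * t2)) \<le> f t * exp (- (\<kappa> * t))"
    proof (rule nondecreasing_of_DERIV[OF that, where f' = "\<lambda>t. (f' t - \<kappa> * f t) * exp (- (\<kappa> * t))"])
      show "((\<lambda>t. f t * exp (- (\<kappa> * t))) has_real_derivative (f' x - \<kappa> * f x) * exp (- (\<kappa> * x))) (at x)"
        if "t2 \<le> x" for x
        using that t2 by (auto intro!: derivative_eq_intros D1 simp: algebra_simps)
      show "0 \<le> (f' x - \<kappa> * f x) * exp (- (\<kappa> * x))" if "t2 \<le> x" for x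
        using growth[OF that] by simp
    qed
    then have "f t2 * exp (- (\<kappa> * t2)) * exp (\<kappa> * t) \<le> f t * exp (- (\<kappa> * t)) * exp (\<kappa> * t)"
      by (rule mult_right_mono) simp
    then show ?thesis
      by (simp add: mult.assoc right_diff_distrib flip: exp_add)
  qed
  then show ?thesis
    using t2(2) \<kappa> f_pos[of t2] by blast
qed

text \<open>Where \<open>f > 0\<close>, the quotient \<open>f'/f\<close> is nondecreasing, so \<open>f\<close> cannot leave zero.\<close>

lemma log_convex_zero:
  fixes f f' f'' :: "real \<Rightarrow> real"
  assumes cont: "continuous_on {0..T} f" and f0: "f 0 = 0" and nonneg: "\<And>t. t \<in> {0..T} \<Longrightarrow> f t \<ge> 0"
    and D1: "\<And>t. 0 < t \<Longrightarrow> t < T \<Longrightarrow> (f has_real_derivative f' t) (at t)"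
    and D2: "\<And>t. 0 < t \<Longrightarrow> t < T \<Longrightarrow> (f' has_real_derivative f'' t) (at t)"
    and conv: "\<And>t. 0 < t \<Longrightarrow> t < T \<Longrightarrow> (f' t)\<^sup>2 \<le> f t * f'' t"
    and t: "t \<in> {0..T}"
  shows "f t = 0"
proof -
  have zero: "f t0 = 0" if t0: "0 \<le> t0" "t0 < T" for t0
  proof (rule ccontr)
    assume "f t0 \<noteq> 0"
    then have ft0: "f t0 > 0" using nonneg[of t0] t0 by force
    \<comment> \<open>The maximum of this set is the last zero before \<open>t0\<close>; behind it f
      is positive.\<close>
    let ?S = "{s \<in> {0..t0}. f s = 0}"
    have c0: "continuous_on {0..t0} f" using cont t0 by (auto intro: continuous_on_subset)
    have "closed ?S"
      by (rule continuous_closed_preimage_constant[OF c0 closed_atLeastAtMost])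
    then have "compact ({0..t0} \<inter> ?S)"
      by (rule compact_Int_closed[OF compact_Icc])
    moreover have "{0..t0} \<inter> ?S = ?S" by auto
    ultimately have "compact ?S" by simp
    moreover have "0 \<in> ?S" using f0 t0 by simp
    ultimately obtain \<tau> where \<tau>: "\<tau> \<in> ?S" "\<And>s. s \<in> ?S \<Longrightarrow> s \<le> \<tau>"
      using compact_attains_sup[of ?S] by blast
    have \<tau>t0: "\<tau> < t0" "0 \<le> \<tau>" using \<tau>(1) ft0 by (auto simp: less_le)
    have pos: "f s > 0" if "\<tau> < s" "s \<le> t0" for s
      using \<tau>(2)[of s] that \<tau>t0 t0 nonneg[of s] by (force simp: less_le)
    define K where "K = f' t0 / f t0"
    have quot: "f' s \<le> K * f s" if s: "\<tau> < s" "s \<le> t0" for s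
    proof -
      have "f' s / f s \<le> f' t0 / f t0"
      proof (rule nondecreasing_of_DERIV[OF s(2), where f = "\<lambda>s. f' s / f s" and f' = "\<lambda>s. (f'' s * f s - f' s * f' s) / (f s * f s)"])
        fix x assume "s \<le> x" "x \<le> t0"
        then have x: "0 < x" "x < T" "f x > 0" using s \<tau>t0 t0 pos[of x] by auto
        show "((\<lambda>s. f' s / f s) has_real_derivative (f'' x * f x - f' x * f' x) / (f x * f x)) (at x)"
          using x by (auto intro!: derivative_eq_intros D1 D2)
        show "0 \<le> (f'' x * f x - f' x * f' x) / (f x * f x)"
          using conv[OF x(1,2)] x(3) by (simp add: power2_eq_square mult.commute)
      qed
      then show ?thesis using pos[OF s] by (simp add: K_def pos_divide_le_eq)
    qed
    have "f t0 * exp (- (K * t0)) \<le> f \<tau> * exp (- (K * \<tau>))"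
    proof (rule DERIV_nonpos_imp_decreasing_open[of \<tau> t0 "\<lambda>s. f s * exp (- (K * s))"])
      show "\<tau> \<le> t0" using \<tau>t0 by simp
      show "continuous_on {\<tau>..t0} (\<lambda>s. f s * exp (- (K * s)))"
        using \<tau>t0 by (intro continuous_intros continuous_on_subset[OF c0]) auto
      fix x assume x: "\<tau> < x" "x < t0"
      have "((\<lambda>s. f s * exp (- (K * s))) has_real_derivative (f' x - K * f x) * exp (- (K * x))) (at x)"
        using x \<tau>t0 t0 by (auto intro!: derivative_eq_intros D1 simp: algebra_simps)
      moreover have "(f' x - K * f x) * exp (- (K * x)) \<le> 0"
        using quot[of x] x by (simp add: mult_nonpos_nonneg)
      ultimately show "\<exists>y. ((\<lambda>s. f s * exp (- (K * s))) has_real_derivative y) (at x) \<and> y \<le> 0"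
        by blast
    qed
    moreover have "f t0 * exp (- (K * t0)) > 0" using ft0 by simp
    moreover have "f \<tau> = 0" using \<tau>(1) by simp
    ultimately show False by simp
  qed
  show ?thesis
  proof (cases "t < T")
    case True then show ?thesis using zero t by simp
  next
    case False
    then have tT: "t = T" using t by simp
    show ?thesis
    proof (cases "T = 0")
      case True then show ?thesis using tT f0 by simp
    next
      case False
      then have "T > 0" using t by simp
      then have cl: "closure {0..<T} = {0..T}" by (simp add: closure_atLeastLessThan)
      show ?thesis
        by (rule continuous_constant_on_closure[of "{0..<T}" f 0]) (use cl cont zero t in auto)
    qed
  qed
qed

text \<open>Cauchy-Schwarz for a form that mixes inner products, time integrals and numbers, without
  building a product space. The quadratic is evaluated at its minimiser.\<close>

lemma discriminant_bound:
  fixes A P Q :: real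
  assumes "\<And>x. 0 \<le> A - 2 * x * P + x\<^sup>2 * Q" "Q \<ge> 0"
  shows "P\<^sup>2 \<le> A * Q"
proof (cases "Q = 0")
  case True
  have "P = 0"
  proof (rule ccontr)
    assume "P \<noteq> 0"
    \<comment> \<open>At this point the quadratic has the value A - (A + 1) = -1.\<close>
    then show False
      using assms(1)[of "(A + 1) / (2 * P)"] True by simp
  qed
  then show ?thesis using True by simp
next
  case False
  then have Q: "Q > 0" using assms(2) by simp
  have "0 \<le> A - 2 * (P / Q) * P + (P / Q)\<^sup>2 * Q" by (rule assms(1))
  also have "\<dots> = A - P\<^sup>2 / Q" using Q by (simp add: power2_eq_square field_simps)
  finally show ?thesis using Q by (simp add: field_simps)
qed

text \<open>The system seen in \<open>L\<^sup>2\<close>: \<open>X\<close> is \<open>\<Delta>u\<close>, the family \<open>Z\<close> consists of the components of \<open>\<nabla>\<Psi>\<close> and of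
  \<open>\<Delta>\<Psi>\<close>, and \<open>Y\<close> is its time derivative. The last four assumptions are the equations, tested and
  integrated by parts.\<close>

locale thermoelastic_plate =
  fixes T \<rho> a c \<eta> :: real and J :: "'j set" and wt :: "'j \<Rightarrow> real"
    and U V W X X' \<Theta> \<Theta>' :: "real \<Rightarrow> 'h::real_inner" and Y Z :: "'j \<Rightarrow> real \<Rightarrow> 'h"
  assumes T: "T > 0" and \<rho>: "\<rho> > 0" and a: "a > 0" and c: "c < 0"
    and J: "finite J" and wt: "\<And>j. j \<in> J \<Longrightarrow> wt j > 0"
    and U: "\<And>t. t \<in> {0..T} \<Longrightarrow> (U has_vector_derivative V t) (at t within {0..T})"
    and V: "\<And>t. t \<in> {0..T} \<Longrightarrow> (V has_vector_derivative W t) (at t within {0..T})"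
    and X: "\<And>t. t \<in> {0..T} \<Longrightarrow> (X has_vector_derivative X' t) (at t within {0..T})"
    and \<Theta>: "\<And>t. t \<in> {0..T} \<Longrightarrow> (\<Theta> has_vector_derivative \<Theta>' t) (at t within {0..T})"
    and Z: "\<And>t j. j \<in> J \<Longrightarrow> t \<in> {0..T} \<Longrightarrow> (Z j has_vector_derivative Y j t) (at t within {0..T})"
    and Y: "\<And>j. j \<in> J \<Longrightarrow> continuous_on {0..T} (Y j)"
    and eq_UV: "\<And>t. t \<in> {0<..T} \<Longrightarrow> \<rho> * (W t \<bullet> V t) = - c * (X t \<bullet> X' t) + \<eta> * (\<Theta> t \<bullet> X' t)"
    and eq_UU: "\<And>t. t \<in> {0<..T} \<Longrightarrow> \<rho> * (W t \<bullet> U t) = - c * (X t \<bullet> X t) + \<eta> * (\<Theta> t \<bullet> X t)"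
    and eq_\<Theta>: "\<And>t. t \<in> {0<..T} \<Longrightarrow> a * (\<Theta>' t \<bullet> \<Theta> t) = - (\<Sum>j\<in>J. wt j * (Y j t \<bullet> Y j t)) - \<eta> * (X' t \<bullet> \<Theta> t)"
    and eq_Z: "\<And>t. t \<in> {0<..T} \<Longrightarrow> (\<Sum>j\<in>J. wt j * (Y j t \<bullet> Z j t)) = - (a * (\<Theta> t \<bullet> \<Theta> t) + \<eta> * (X t \<bullet> \<Theta> t))"
begin

text \<open>In the plate these three are B(\<theta>), its polar form at \<theta> and \<Psi>, and
  B(\<Psi>).\<close>

definition "BYY t = (\<Sum>j\<in>J. wt j * (Y j t \<bullet> Y j t))"
definition "BYZ t = (\<Sum>j\<in>J. wt j * (Y j t \<bullet> Z j t))"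
definition "BZZ t = (\<Sum>j\<in>J. wt j * (Z j t \<bullet> Z j t))"
definition "En t = 1 / 2 * (\<rho> * (V t \<bullet> V t) + c * (X t \<bullet> X t) + a * (\<Theta> t \<bullet> \<Theta> t))"
definition "Fn \<omega> t = \<rho> * (U t \<bullet> U t) + integral {0..t} BZZ + \<omega> * t\<^sup>2"
definition "Fn' \<omega> t = 2 * \<rho> * (U t \<bullet> V t) + BZZ t + 2 * \<omega> * t"
definition "Qn \<omega> t = \<rho> * (V t \<bullet> V t) + integral {0..t} BYY + \<omega>"

lemma inner_deriv:
  fixes f g :: "real \<Rightarrow> 'h"
  assumes "(f has_vector_derivative f') (at t within S)" "(g has_vector_derivative g') (at t within S)"
  shows "((\<lambda>t. f t \<bullet> g t) has_real_derivative f t \<bullet> g' + f' \<bullet> g t) (at t within S)"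
  unfolding has_field_derivative_def
  by (rule has_derivative_eq_rhs[OF has_derivative_inner[OF assms[unfolded has_vector_derivative_def]]])
     (simp add: fun_eq_iff algebra_simps)

lemma continuous_Z: "j \<in> J \<Longrightarrow> continuous_on {0..T} (Z j)"
  unfolding continuous_on_eq_continuous_within using has_vector_derivative_continuous[OF Z] by blast

lemma continuous_BYY: "continuous_on {0..T} BYY"
  unfolding BYY_def[abs_def] using Y by (intro continuous_intros) auto

lemma continuous_BYZ: "continuous_on {0..T} BYZ"
  unfolding BYZ_def[abs_def] using Y continuous_Z by (intro continuous_intros) auto

lemma continuous_BZZ: "continuous_on {0..T} BZZ"
  unfolding BZZ_def[abs_def] using continuous_Z by (intro continuous_intros) auto

lemma BYY_nonneg: "BYY t \<ge> 0" and BZZ_nonneg: "BZZ t \<ge> 0"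
  unfolding BYY_def BZZ_def using wt by (auto intro!: sum_nonneg simp: less_imp_le)

lemma BZZ_deriv:
  assumes "t \<in> {0..T}"
  shows "(BZZ has_real_derivative 2 * BYZ t) (at t within {0..T})"
proof -
  have "(BZZ has_real_derivative (\<Sum>j\<in>J. wt j * (Z j t \<bullet> Y j t + Y j t \<bullet> Z j t))) (at t within {0..T})"
    unfolding BZZ_def[abs_def] using assms by (intro DERIV_sum DERIV_cmult inner_deriv Z)
  also have "(\<Sum>j\<in>J. wt j * (Z j t \<bullet> Y j t + Y j t \<bullet> Z j t)) = 2 * BYZ t"
    unfolding BYZ_def sum_distrib_left by (intro sum.cong) (simp_all add: inner_commute)
  finally show ?thesis .
qed

lemma integral_deriv:
  fixes f :: "real \<Rightarrow> real"
  assumes "continuous_on {0..T} f" "t \<in> {0..T}"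
  shows "((\<lambda>t. integral {0..t} f) has_real_derivative f t) (at t within {0..T})"
  using integral_has_real_derivative[OF assms] .

lemma at_interior: "0 < t \<Longrightarrow> t < T \<Longrightarrow> at t within {0..T} = at t"
  by (rule at_within_Icc_at)

text \<open>The coupling terms of \<open>eq_UV\<close> and \<open>eq_\<Theta>\<close> cancel and
  leave the dissipation. The equations hold at positive times only, so constancy is derived from the
  open interval and continuity.\<close>

lemma energy_identity:
  assumes "t \<in> {0..T}"
  shows "En t = En 0 - integral {0..t} BYY"
proof -
  have E': "(En has_real_derivative \<rho> * (W s \<bullet> V s) + c * (X s \<bullet> X' s) + a * (\<Theta>' s \<bullet> \<Theta> s)) (at s within {0..T})"
    if s: "s \<in> {0..T}" for s
    unfolding En_def[abs_def]
    by (auto intro!: derivative_eq_intros inner_deriv[THEN DERIV_cong] V[OF s] X[OF s] \<Theta>[OF s]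
        simp: inner_commute algebra_simps)
  have D: "((\<lambda>t. En t + integral {0..t} BYY) has_real_derivative
      \<rho> * (W s \<bullet> V s) + c * (X s \<bullet> X' s) + a * (\<Theta>' s \<bullet> \<Theta> s) + BYY s) (at s within {0..T})"
    if s: "s \<in> {0..T}" for s
    by (intro DERIV_add E' integral_deriv continuous_BYY s)
  have zero: "\<rho> * (W s \<bullet> V s) + c * (X s \<bullet> X' s) + a * (\<Theta>' s \<bullet> \<Theta> s) + BYY s = 0" if "s \<in> {0<..T}" for s
    using eq_UV[OF that] eq_\<Theta>[OF that] by (simp add: BYY_def inner_commute)
  show ?thesis
  proof (cases "t = 0")
    case False
    then have "0 < t" using assms by simp
    have "En t + integral {0..t} BYY = En 0 + integral {0..0} BYY"
    proof (rule DERIV_isconst_end[OF \<open>0 < t\<close>])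
      have "continuous_on {0..T} (\<lambda>t. En t + integral {0..t} BYY)"
        using D by (rule DERIV_continuous_on)
      then show "continuous_on {0..t} (\<lambda>t. En t + integral {0..t} BYY)"
        by (rule continuous_on_subset) (use assms in auto)
      show "((\<lambda>t. En t + integral {0..t} BYY) has_real_derivative 0) (at s)" if "0 < s" "s < t" for s
        using D[of s] zero[of s] that assms by (simp add: at_interior)
    qed
    then show ?thesis by simp
  qed simp
qed

lemma Fn_deriv:
  assumes "t \<in> {0..T}"
  shows "(Fn \<omega> has_real_derivative Fn' \<omega> t) (at t within {0..T})"
  unfolding Fn_def[abs_def] Fn'_def
  by (auto intro!: derivative_eq_intros inner_deriv[THEN DERIV_cong] U[OF assms]
      integral_deriv[OF continuous_BZZ assms] simp: inner_commute algebra_simps)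

text \<open>The coupling terms of \<open>eq_UU\<close> and \<open>eq_Z\<close> cancel and leave -2
  (c |X|^2 + a |\<Theta>|^2). By definition of the energy this is 2 \<rho> |V|^2 - 4
  \<open>En t\<close>, and the energy identity brings in \<open>En 0\<close>.\<close>

lemma Fn'_deriv:
  assumes "0 < t" "t < T"
  shows "(Fn' \<omega> has_real_derivative 4 * (\<rho> * (V t \<bullet> V t) + integral {0..t} BYY) - 4 * En 0 + 2 * \<omega>) (at t)"
proof -
  have t: "t \<in> {0..T}" "t \<in> {0<..T}" using assms by auto
  have "(Fn' \<omega> has_real_derivative 2 * \<rho> * (U t \<bullet> W t + V t \<bullet> V t) + 2 * BYZ t + 2 * \<omega>) (at t within {0..T})"
    unfolding Fn'_def[abs_def]
    by (auto intro!: derivative_eq_intros inner_deriv[THEN DERIV_cong] U[OF t(1)] V[OF t(1)] BZZ_deriv[OF t(1)]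
        simp: algebra_simps)
  moreover have "2 * \<rho> * (U t \<bullet> W t + V t \<bullet> V t) + 2 * BYZ t + 2 * \<omega>
      = 4 * (\<rho> * (V t \<bullet> V t) + integral {0..t} BYY) - 4 * En 0 + 2 * \<omega>"
  proof -
    have 1: "2 * \<rho> * (U t \<bullet> W t) = 2 * (- c * (X t \<bullet> X t) + \<eta> * (\<Theta> t \<bullet> X t))"
      using eq_UU[OF t(2)] by (simp add: inner_commute)
    have 2: "2 * BYZ t = - 2 * (a * (\<Theta> t \<bullet> \<Theta> t)) - 2 * (\<eta> * (X t \<bullet> \<Theta> t))"
      using eq_Z[OF t(2)] by (simp add: BYZ_def)
    have 3: "4 * En 0 = 4 * En t + 4 * integral {0..t} BYY"
      using energy_identity[OF t(1)] by simp
    have 4: "4 * En t = 2 * (\<rho> * (V t \<bullet> V t)) + 2 * (c * (X t \<bullet> X t)) + 2 * (a * (\<Theta> t \<bullet> \<Theta> t))"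
      by (simp add: En_def)
    show ?thesis
      using 1 2 3 4 by (simp add: inner_commute algebra_simps)
  qed
  ultimately show ?thesis
    using assms by (simp add: at_interior)
qed

lemma integral_BYZ:
  assumes "t \<in> {0..T}"
  shows "2 * integral {0..t} BYZ = BZZ t - BZZ 0"
proof -
  have "((\<lambda>s. 2 * BYZ s) has_integral BZZ t - BZZ 0) {0..t}"
  proof (rule fundamental_theorem_of_calculus)
    show "0 \<le> t" using assms by simp
    show "(BZZ has_vector_derivative 2 * BYZ s) (at s within {0..t})" if "s \<in> {0..t}" for s
      using BZZ_deriv[of s] that assms
      by (auto simp: has_real_derivative_iff_has_vector_derivative intro: has_vector_derivative_within_subset)
  qed
  then show ?thesis
    by (simp add: integral_unique flip: integral_mult_right)
qed

text \<open>Cauchy-Schwarz for the triples (U t, Z on [0,t], t) and (V t, Y on [0,t], 1) with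
  weights \<rho>, \<open>wt\<close> and \<omega>. Their squares are F and Q. Twice their product
  \<open>P\<close> is F' minus the initial value of \<open>BZZ\<close>, as \<open>BYZ\<close>
  integrates to half the increment of \<open>BZZ\<close>.\<close>

lemma Fn_convex:
  assumes t: "t \<in> {0..T}" and \<omega>: "\<omega> \<ge> 0"
  shows "(Fn' \<omega> t - BZZ 0)\<^sup>2 \<le> 4 * (Fn \<omega> t * Qn \<omega> t)"
proof -
  define P where "P = \<rho> * (U t \<bullet> V t) + integral {0..t} BYZ + \<omega> * t"
  have sub: "continuous_on {0..t} f" if "continuous_on {0..T} f" for f :: "real \<Rightarrow> real"
    using that by (rule continuous_on_subset) (use t in auto)
  note cont = sub[OF continuous_BYY] sub[OF continuous_BYZ] sub[OF continuous_BZZ]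
  note int = cont[THEN integrable_continuous_real]
  have "0 \<le> Fn \<omega> t - 2 * x * P + x\<^sup>2 * Qn \<omega> t" for x
  proof -
    have "0 \<le> BZZ s - 2 * x * BYZ s + x\<^sup>2 * BYY s" for s
    proof -
      have "0 \<le> (\<Sum>j\<in>J. wt j * ((Z j s - x *\<^sub>R Y j s) \<bullet> (Z j s - x *\<^sub>R Y j s)))"
        using wt by (auto intro!: sum_nonneg simp: less_imp_le)
      also have "\<dots> = BZZ s - 2 * x * BYZ s + x\<^sup>2 * BYY s"
        unfolding BZZ_def BYZ_def BYY_def sum_distrib_left sum_subtractf[symmetric] sum.distrib[symmetric]
        by (intro sum.cong)
           (simp_all add: inner_diff_left inner_diff_right inner_commute power2_eq_square algebra_simps)
      finally show ?thesis .
    qed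
    then have "0 \<le> integral {0..t} (\<lambda>s. BZZ s - 2 * x * BYZ s + x\<^sup>2 * BYY s)"
      by (intro Henstock_Kurzweil_Integration.integral_nonneg integrable_continuous_real continuous_intros cont)
    also have "\<dots> = integral {0..t} BZZ - 2 * x * integral {0..t} BYZ + x\<^sup>2 * integral {0..t} BYY"
      using int by (simp add: Henstock_Kurzweil_Integration.integral_add Henstock_Kurzweil_Integration.integral_diff
          integrable_diff integrable_on_mult_right)
    finally have 1: "0 \<le> integral {0..t} BZZ - 2 * x * integral {0..t} BYZ + x\<^sup>2 * integral {0..t} BYY" .
    have 2: "0 \<le> \<rho> * ((U t - x *\<^sub>R V t) \<bullet> (U t - x *\<^sub>R V t))" using \<rho> by simp
    have 3: "0 \<le> \<omega> * (t - x)\<^sup>2" using \<omega> by simp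
    have "Fn \<omega> t - 2 * x * P + x\<^sup>2 * Qn \<omega> t =
      (integral {0..t} BZZ - 2 * x * integral {0..t} BYZ + x\<^sup>2 * integral {0..t} BYY)
      + \<rho> * ((U t - x *\<^sub>R V t) \<bullet> (U t - x *\<^sub>R V t)) + \<omega> * (t - x)\<^sup>2"
      by (simp add: Fn_def P_def Qn_def inner_diff_left inner_diff_right inner_commute power2_eq_square algebra_simps)
    then show ?thesis using 1 2 3 by simp
  qed
  moreover have "Qn \<omega> t \<ge> 0"
    unfolding Qn_def using \<rho> \<omega> int BYY_nonneg by (intro add_nonneg_nonneg Henstock_Kurzweil_Integration.integral_nonneg) auto
  ultimately have "P\<^sup>2 \<le> Fn \<omega> t * Qn \<omega> t"
    by (rule discriminant_bound)
  moreover have "Fn' \<omega> t - BZZ 0 = 2 * P"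
    using integral_BYZ[OF t] by (simp add: Fn'_def P_def)
  ultimately show ?thesis by (simp add: power_mult_distrib)
qed

lemma Fn_nonneg:
  assumes "t \<in> {0..T}" "\<omega> \<ge> 0"
  shows "Fn \<omega> t \<ge> 0"
proof -
  have "continuous_on {0..t} BZZ"
    using continuous_BZZ by (rule continuous_on_subset) (use assms in auto)
  then have "integral {0..t} BZZ \<ge> 0"
    using BZZ_nonneg by (intro Henstock_Kurzweil_Integration.integral_nonneg integrable_continuous_real) auto
  then show ?thesis
    using \<rho> assms by (simp add: Fn_def)
qed

lemma zero_has_vector_derivative:
  assumes "s \<in> {0..T}" "((\<lambda>s. 0) has_vector_derivative d) (at s within {0..T})"
  shows "d = 0"
proof (rule vector_derivative_unique_within[OF _ assms(2)])
  show "at s within {0..T} \<noteq> bot"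
    using assms(1) T by (simp add: trivial_limit_within islimpt_Icc)
  show "((\<lambda>s. 0) has_vector_derivative 0) (at s within {0..T})" by simp
qed

text \<open>With \<omega> = 0 and zero energy F'' = 4 Q, and Z = 0 at time 0 removes the
  disturbance, so \<open>log_convex_zero\<close> applies. F = 0 gives U = 0; then F' = 0 reduces to
  BZZ = 0, hence Z = 0, and Y is the derivative of Z.\<close>

lemma zero_initial_data:
  assumes "En 0 = 0" "U 0 = 0" "\<And>j. j \<in> J \<Longrightarrow> Z j 0 = 0" and t: "t \<in> {0..T}"
  shows "U t = 0" "BZZ t = 0" "j \<in> J \<Longrightarrow> Y j t = 0"
proof -
  have F0: "Fn 0 s = 0" if "s \<in> {0..T}" for s
  proof (rule log_convex_zero[OF _ _ _ _ _ _ that])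
    show "continuous_on {0..T} (Fn 0)"
      by (rule DERIV_continuous_on[OF Fn_deriv])
    show "Fn 0 0 = 0" using assms(2) by (simp add: Fn_def)
    show "Fn 0 s \<ge> 0" if "s \<in> {0..T}" for s using that by (rule Fn_nonneg) simp
    show "(Fn 0 has_real_derivative Fn' 0 s) (at s)" if "0 < s" "s < T" for s
      using Fn_deriv[of s 0] that by (simp add: at_interior)
    show "(Fn' 0 has_real_derivative 4 * Qn 0 s) (at s)" if "0 < s" "s < T" for s
      using Fn'_deriv[OF that, of 0] assms(1) by (simp add: Qn_def)
    have "BZZ 0 = 0" using assms(3) by (simp add: BZZ_def)
    then show "(Fn' 0 s)\<^sup>2 \<le> Fn 0 s * (4 * Qn 0 s)" if "0 < s" "s < T" for s
      using Fn_convex[of s 0] that by simp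
  qed
  have U0: "U s = 0" if s: "s \<in> {0..T}" for s
  proof -
    have "continuous_on {0..s} BZZ"
      using continuous_BZZ by (rule continuous_on_subset) (use s in auto)
    then have "integral {0..s} BZZ \<ge> 0"
      using BZZ_nonneg by (intro Henstock_Kurzweil_Integration.integral_nonneg integrable_continuous_real) auto
    moreover have "\<rho> * (U s \<bullet> U s) \<ge> 0" using \<rho> by simp
    moreover have "\<rho> * (U s \<bullet> U s) + integral {0..s} BZZ = 0"
      using F0[OF s] by (simp add: Fn_def)
    ultimately have "\<rho> * (U s \<bullet> U s) = 0" by linarith
    then show ?thesis using \<rho> by simp
  qed
  show "U t = 0" by (rule U0[OF t])
  have BZZ0: "BZZ s = 0" if s: "s \<in> {0..T}" for s
  proof -
    have "(Fn 0 has_vector_derivative Fn' 0 s) (at s within {0..T})"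
      using Fn_deriv[OF s, of 0] by (simp add: has_real_derivative_iff_has_vector_derivative)
    then have "((\<lambda>s. 0 :: real) has_vector_derivative Fn' 0 s) (at s within {0..T})"
      by (rule has_vector_derivative_transform[OF s, rotated]) (simp add: F0)
    then have "Fn' 0 s = 0" by (rule zero_has_vector_derivative[OF s])
    then show ?thesis using U0[OF s] by (simp add: Fn'_def)
  qed
  show "BZZ t = 0" by (rule BZZ0[OF t])
  assume j: "j \<in> J"
  have Z0: "Z j s = 0" if s: "s \<in> {0..T}" for s
  proof -
    have "wt j * (Z j s \<bullet> Z j s) = 0"
      using BZZ0[OF s] J wt j unfolding BZZ_def
      by (subst (asm) sum_nonneg_eq_0_iff) (auto simp: less_imp_le)
    then show ?thesis using wt[OF j] by simp
  qed
  have "((\<lambda>s. 0) has_vector_derivative Y j t) (at t within {0..T})"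
    by (rule has_vector_derivative_transform[OF t _ Z[OF j t]]) (simp add: Z0)
  then show "Y j t = 0" by (rule zero_has_vector_derivative[OF t])
qed

end

section \<open>The plate system in the Hilbert space\<close>

lemma dirichlet_laplacian_symmetric:
  assumes "dirichlet_laplacian \<Omega> w g l" "dirichlet_laplacian \<Omega> w' g' l'"
  shows "l \<bullet> w' = l' \<bullet> w"
  using dirichlet_laplacian_green[OF assms] dirichlet_laplacian_green[OF assms(2,1)]
  by (simp add: inner_commute)

text \<open>The second boundary condition enters here: \<Delta>w itself must have zero trace, while
  for \<open>w'\<close> only the first condition is required. So u_t is admissible as
  \<open>w'\<close>.\<close>

lemma dirichlet_bilaplacian:
  assumes "dirichlet_laplacian \<Omega> w g l" "dirichlet_laplacian \<Omega> l h m" "dirichlet_laplacian \<Omega> w' g' l'"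
  shows "m \<bullet> w' = l \<bullet> l'"
  using dirichlet_laplacian_symmetric[OF assms(2,3)] by (simp add: inner_commute)

lemma dirichlet_laplacian_zero:
  assumes "\<Omega> \<in> sets lebesgue" "dirichlet_laplacian \<Omega> w g l"
  shows "dirichlet_laplacian \<Omega> 0 (\<lambda>i. 0) 0"
  using dirichlet_laplacian_diff[OF assms(1,2,2)] by simp

text \<open>The endpoints are exempt in the last premise because the equations hold at positive
  times only.\<close>

lemma constant_if_DERIV_zero:
  fixes f :: "real \<Rightarrow> real"
  assumes "0 \<le> t" "\<And>s. s \<in> {0..t} \<Longrightarrow> (f has_real_derivative f' s) (at s within {0..t})"
    "\<And>s. s \<in> {0<..<t} \<Longrightarrow> f' s = 0"
  shows "f t = f 0"
proof (cases "t = 0")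
  case False
  then have "0 < t" using assms(1) by simp
  then show ?thesis
  proof (rule DERIV_isconst_end)
    show "continuous_on {0..t} f" by (rule DERIV_continuous_on[OF assms(2)])
    show "(f has_real_derivative 0) (at s)" if "0 < s" "s < t" for s
      using assms(2)[of s] assms(3)[of s] that by (simp add: at_within_Icc_at)
  qed
qed simp

text \<open>\<open>None\<close> stands for the Laplacian and \<open>Some i\<close> for the i-th
  partial derivative, so that B becomes a single weighted sum of squares, with weight d at
  \<open>None\<close> and b elsewhere.\<close>

definition grad_lap_index :: "'a::euclidean_space option set" where
  "grad_lap_index = insert None (Some ` Basis)"

definition grad_lap :: "'b \<Rightarrow> ('a \<Rightarrow> 'b) \<Rightarrow> 'a option \<Rightarrow> 'b" where
  "grad_lap l g j = (case j of None \<Rightarrow> l | Some i \<Rightarrow> g i)"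

lemma grad_lap_simps [simp]: "grad_lap l g None = l" "grad_lap l g (Some i) = g i"
  by (simp_all add: grad_lap_def)

lemma finite_grad_lap_index: "finite grad_lap_index"
  by (simp add: grad_lap_index_def)

lemma sum_grad_lap_index: "(\<Sum>j\<in>grad_lap_index. f j) = f None + (\<Sum>i\<in>Basis. f (Some i))"
proof -
  have "(\<Sum>j\<in>grad_lap_index. f j) = f None + (\<Sum>j\<in>Some ` Basis. f j)"
    unfolding grad_lap_index_def by (rule sum.insert) auto
  then show ?thesis
    by (simp add: sum.reindex)
qed

text \<open>In this order the curves are the classes of u, u_t, u_tt, \<Delta>u, \<Delta>u_t,
  \<Delta>^2 u, \<theta>, \<theta>_t, \<Delta>\<theta>, \<Delta>^2 \<theta> and the partials of
  \<theta>. Only the gradient of \<theta> is named, because it occurs in B; the others serve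
  integration by parts.\<close>

locale l2_solution =
  fixes \<Omega> :: "'a::euclidean_space set" and \<rho> a b c d \<eta> :: real and I :: "real set"
    and U V W X X' XX \<Theta> \<Theta>' L LL :: "real \<Rightarrow> 'a l2" and G :: "'a \<Rightarrow> real \<Rightarrow> 'a l2"
  assumes \<Omega>: "open \<Omega>" "bounded \<Omega>"
    and params: "\<rho> > 0" "a > 0" "b > 0" "d > 0" "\<eta> \<noteq> 0" "c < 0"
    and U: "\<And>t. t \<in> I \<Longrightarrow> (U has_vector_derivative V t) (at t within I)"
    and V: "\<And>t. t \<in> I \<Longrightarrow> (V has_vector_derivative W t) (at t within I)"
    and X: "\<And>t. t \<in> I \<Longrightarrow> (X has_vector_derivative X' t) (at t within I)"
    and \<Theta>: "\<And>t. t \<in> I \<Longrightarrow> (\<Theta> has_vector_derivative \<Theta>' t) (at t within I)"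
    and L: "continuous_on I L" and G: "\<And>i. i \<in> Basis \<Longrightarrow> continuous_on I (G i)"
    and lap_U: "\<And>t. t \<in> I \<Longrightarrow> \<exists>g. dirichlet_laplacian \<Omega> (U t) g (X t)"
    and lap_V: "\<And>t. t \<in> I \<Longrightarrow> \<exists>g. dirichlet_laplacian \<Omega> (V t) g (X' t)"
    and lap_X: "\<And>t. t \<in> I \<Longrightarrow> \<exists>g. dirichlet_laplacian \<Omega> (X t) g (XX t)"
    and lap_\<Theta>: "\<And>t. t \<in> I \<Longrightarrow> dirichlet_laplacian \<Omega> (\<Theta> t) (\<lambda>i. G i t) (L t)"
    and lap_L: "\<And>t. t \<in> I \<Longrightarrow> \<exists>g. dirichlet_laplacian \<Omega> (L t) g (LL t)"
    and eq_U: "\<And>t. t \<in> I \<Longrightarrow> t > 0 \<Longrightarrow> \<rho> *\<^sub>R W t = - c *\<^sub>R XX t + \<eta> *\<^sub>R L t"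
    and eq_\<Theta>: "\<And>t. t \<in> I \<Longrightarrow> t > 0 \<Longrightarrow> a *\<^sub>R \<Theta>' t = b *\<^sub>R L t - d *\<^sub>R LL t - \<eta> *\<^sub>R X' t"
begin

abbreviation "wt \<equiv> grad_lap d (\<lambda>i. b)"
abbreviation "Y \<equiv> grad_lap L G"

text \<open>The equation at time \<open>s\<close> is tested with \<theta> at another time
  \<open>t\<close>, so that it can be integrated over \<open>s\<close> with the test function
  fixed.\<close>

lemma tested_heat_equation:
  assumes "s \<in> I" "t \<in> I" "0 < s"
  shows "a * (\<Theta>' s \<bullet> \<Theta> t) + \<eta> * (X' s \<bullet> \<Theta> t) + (\<Sum>j\<in>grad_lap_index. wt j * (Y j s \<bullet> Y j t)) = 0"
proof -
  obtain g where g: "dirichlet_laplacian \<Omega> (L s) g (LL s)" using lap_L[OF assms(1)] by blast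
  have 1: "L s \<bullet> \<Theta> t = - (\<Sum>i\<in>Basis. G i s \<bullet> G i t)"
    by (rule dirichlet_laplacian_green[OF lap_\<Theta>[OF assms(1)] lap_\<Theta>[OF assms(2)]])
  have 2: "LL s \<bullet> \<Theta> t = L s \<bullet> L t"
    by (rule dirichlet_bilaplacian[OF lap_\<Theta>[OF assms(1)] g lap_\<Theta>[OF assms(2)]])
  have "a * (\<Theta>' s \<bullet> \<Theta> t) = (a *\<^sub>R \<Theta>' s) \<bullet> \<Theta> t" by simp
  also have "\<dots> = b * (L s \<bullet> \<Theta> t) - d * (LL s \<bullet> \<Theta> t) - \<eta> * (X' s \<bullet> \<Theta> t)"
    unfolding eq_\<Theta>[OF assms(1,3)] by (simp add: inner_diff_left)
  finally show ?thesis
    by (simp add: 1 2 sum_grad_lap_index sum_distrib_left)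
qed

lemma tested_wave_equation:
  assumes "t \<in> I" "0 < t" "dirichlet_laplacian \<Omega> w g l"
  shows "\<rho> * (W t \<bullet> w) = - c * (X t \<bullet> l) + \<eta> * (\<Theta> t \<bullet> l)"
proof -
  obtain gU where gU: "dirichlet_laplacian \<Omega> (U t) gU (X t)" using lap_U[OF assms(1)] by blast
  obtain gX where gX: "dirichlet_laplacian \<Omega> (X t) gX (XX t)" using lap_X[OF assms(1)] by blast
  have "\<rho> * (W t \<bullet> w) = (\<rho> *\<^sub>R W t) \<bullet> w" by simp
  also have "\<dots> = - c * (XX t \<bullet> w) + \<eta> * (L t \<bullet> w)"
    unfolding eq_U[OF assms(1,2)] by (simp add: inner_add_left inner_diff_left)
  also have "XX t \<bullet> w = X t \<bullet> l"
    by (rule dirichlet_bilaplacian[OF gU gX assms(3)])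
  also have "L t \<bullet> w = \<Theta> t \<bullet> l"
    using dirichlet_laplacian_symmetric[OF lap_\<Theta>[OF assms(1)] assms(3)] by (simp add: inner_commute)
  finally show ?thesis .
qed

end

locale l2_solution_Phi = l2_solution +
  fixes P :: "'a l2" and GP :: "'a \<Rightarrow> 'a l2" and LP LLP :: "'a l2"
  assumes lap_P: "dirichlet_laplacian \<Omega> P GP LP"
    and lap_LP: "\<exists>g. dirichlet_laplacian \<Omega> LP g LLP"
    and eq_P: "b *\<^sub>R LP - d *\<^sub>R LLP = a *\<^sub>R \<Theta> 0 + \<eta> *\<^sub>R X 0"
begin

text \<open>The derivatives of \<Psi> written as integrals of derivatives of \<theta>, so that
  nothing has to be differentiated under the integral at this level.\<close>

definition Z :: "'a option \<Rightarrow> real \<Rightarrow> 'a l2" where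
  "Z j t = grad_lap LP GP j + integral {0..t} (Y j)"

text \<open>The weak form of the equation for \<Phi>. It cancels the constant that arises when the
  heat equation is integrated from time 0.\<close>

lemma tested_P:
  assumes "dirichlet_laplacian \<Omega> w g l"
  shows "a * (\<Theta> 0 \<bullet> w) + \<eta> * (X 0 \<bullet> w) + (\<Sum>j\<in>grad_lap_index. wt j * (grad_lap LP GP j \<bullet> grad_lap l g j)) = 0"
proof -
  obtain h where h: "dirichlet_laplacian \<Omega> LP h LLP" using lap_LP by blast
  have 1: "LP \<bullet> w = - (\<Sum>i\<in>Basis. GP i \<bullet> g i)"
    by (rule dirichlet_laplacian_green[OF lap_P assms])
  have 2: "LLP \<bullet> w = LP \<bullet> l"
    by (rule dirichlet_bilaplacian[OF lap_P h assms])
  have "a * (\<Theta> 0 \<bullet> w) + \<eta> * (X 0 \<bullet> w) = (b *\<^sub>R LP - d *\<^sub>R LLP) \<bullet> w"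
    unfolding eq_P by (simp add: inner_add_left)
  also have "\<dots> = b * (LP \<bullet> w) - d * (LLP \<bullet> w)"
    by (simp add: inner_diff_left)
  finally show ?thesis
    by (simp add: 1 2 sum_grad_lap_index sum_distrib_left)
qed

lemma thermoelastic_plate:
  assumes T: "T > 0" "{0..T} \<subseteq> I"
  shows "thermoelastic_plate T \<rho> a c \<eta> grad_lap_index wt U V W X X' \<Theta> \<Theta>' Y Z"
proof
  note sub = has_vector_derivative_within_subset[OF _ T(2)]
  show "T > 0" "\<rho> > 0" "a > 0" "c < 0" using T params by auto
  show "finite grad_lap_index" by (rule finite_grad_lap_index)
  show "wt j > 0" if "j \<in> grad_lap_index" for j
    using that params by (auto simp: grad_lap_index_def)
  fix t
  show "(U has_vector_derivative V t) (at t within {0..T})"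
    "(V has_vector_derivative W t) (at t within {0..T})"
    "(X has_vector_derivative X' t) (at t within {0..T})"
    "(\<Theta> has_vector_derivative \<Theta>' t) (at t within {0..T})" if "t \<in> {0..T}"
    using that T(2) by (auto intro!: sub U V X \<Theta>)
  show Y: "continuous_on {0..T} (Y j)" if "j \<in> grad_lap_index" for j
    using that continuous_on_subset[OF L T(2)] continuous_on_subset[OF G T(2)]
    by (auto simp: grad_lap_index_def)
  show Z: "(Z j has_vector_derivative Y j t) (at t within {0..T})" if "j \<in> grad_lap_index" "t \<in> {0..T}" for t j
  proof -
    have "((\<lambda>t. grad_lap LP GP j + integral {0..t} (Y j)) has_vector_derivative 0 + Y j t) (at t within {0..T})"
      by (intro has_vector_derivative_add has_vector_derivative_const integral_has_vector_derivative Y that)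
    then show ?thesis by (simp add: Z_def[abs_def])
  qed
  assume t: "t \<in> {0<..T}"
  then have tI: "t \<in> I" "0 < t" using T(2) by auto
  show "\<rho> * (W t \<bullet> V t) = - c * (X t \<bullet> X' t) + \<eta> * (\<Theta> t \<bullet> X' t)"
    using lap_V[OF tI(1)] tested_wave_equation[OF tI] by blast
  show "\<rho> * (W t \<bullet> U t) = - c * (X t \<bullet> X t) + \<eta> * (\<Theta> t \<bullet> X t)"
    using lap_U[OF tI(1)] tested_wave_equation[OF tI] by blast
  show "a * (\<Theta>' t \<bullet> \<Theta> t) = - (\<Sum>j\<in>grad_lap_index. wt j * (Y j t \<bullet> Y j t)) - \<eta> * (X' t \<bullet> \<Theta> t)"
    using tested_heat_equation[OF tI(1) tI(1,2)] by linarith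
  \<comment> \<open>The time-integrated heat equation tested with the fixed \<theta>(t). Its
    derivative in \<open>s\<close> vanishes by \<open>tested_heat_equation\<close> and its value at
    0 by \<open>tested_P\<close>; at \<open>s = t\<close> it yields \<open>eq_Z\<close>.\<close>
  define h where "h = (\<lambda>s. a * (\<Theta> s \<bullet> \<Theta> t) + \<eta> * (X s \<bullet> \<Theta> t) + (\<Sum>j\<in>grad_lap_index. wt j * (Z j s \<bullet> Y j t)))"
  have inner_deriv: "((\<lambda>s. f s \<bullet> v) has_real_derivative f' \<bullet> v) (at s within {0..t})"
    if "(f has_vector_derivative f') (at s within A)" "{0..t} \<subseteq> A" for f f' v s and A
  proof -
    have "(f has_vector_derivative f') (at s within {0..t})"
      using that by (rule has_vector_derivative_within_subset)
    from bounded_linear.has_vector_derivative[OF bounded_linear_inner_left this]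
    show ?thesis by (simp add: has_real_derivative_iff_has_vector_derivative)
  qed
  have "h t = h 0"
  proof (rule constant_if_DERIV_zero)
    show "0 \<le> t" using t by simp
    show "(h has_real_derivative (a * (\<Theta>' s \<bullet> \<Theta> t) + \<eta> * (X' s \<bullet> \<Theta> t) + (\<Sum>j\<in>grad_lap_index. wt j * (Y j s \<bullet> Y j t))))
        (at s within {0..t})" if s: "s \<in> {0..t}" for s
    proof -
      have sT: "s \<in> {0..T}" "s \<in> I" "{0..t} \<subseteq> {0..T}" "{0..t} \<subseteq> I" using s t T(2) by auto
      show ?thesis
        unfolding h_def
        by (intro DERIV_add DERIV_sum DERIV_cmult inner_deriv[OF \<Theta>[OF sT(2)] sT(4)]
            inner_deriv[OF X[OF sT(2)] sT(4)] inner_deriv[OF Z[OF _ sT(1)] sT(3)])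
    qed
    show "a * (\<Theta>' s \<bullet> \<Theta> t) + \<eta> * (X' s \<bullet> \<Theta> t) + (\<Sum>j\<in>grad_lap_index. wt j * (Y j s \<bullet> Y j t)) = 0"
      if "s \<in> {0<..<t}" for s
      using that t T(2) by (intro tested_heat_equation) auto
  qed
  also have "h 0 = 0"
  proof -
    have "grad_lap (L t) (\<lambda>i. G i t) j = Y j t" for j by (cases j) simp_all
    then show ?thesis
      using tested_P[OF lap_\<Theta>[OF tI(1)]] by (simp add: h_def Z_def)
  qed
  finally show "(\<Sum>j\<in>grad_lap_index. wt j * (Y j t \<bullet> Z j t)) = - (a * (\<Theta> t \<bullet> \<Theta> t) + \<eta> * (X t \<bullet> \<Theta> t))"
    by (simp add: h_def inner_commute)
qed

lemma zero_initial_data: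
  assumes T: "T > 0" "{0..T} \<subseteq> I" and init: "U 0 = 0" "V 0 = 0" "\<Theta> 0 = 0" "LP = 0" "\<And>i. GP i = 0"
    and t: "t \<in> {0..T}"
  shows "U t = 0" "\<Theta> t = 0"
proof -
  interpret P: thermoelastic_plate T \<rho> a c \<eta> grad_lap_index wt U V W X X' \<Theta> \<Theta>' Y Z
    by (rule thermoelastic_plate[OF T])
  have "0 \<in> I" using T by auto
  then obtain g h where g: "dirichlet_laplacian \<Omega> (U 0) g (X 0)" and h: "dirichlet_laplacian \<Omega> (X 0) h (XX 0)"
    using lap_U lap_X by blast
  \<comment> \<open>Green's formula turns |\<Delta>u|^2 into the product of \<Delta>^2 u with
    u.\<close>
  have "X 0 \<bullet> X 0 = 0"
    using dirichlet_laplacian_symmetric[OF g h] init(1) by simp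
  then have E0: "P.En 0 = 0" by (simp add: P.En_def init)
  have Z0: "Z j 0 = 0" for j
    unfolding Z_def by (cases j) (simp_all add: init)
  note zero = P.zero_initial_data[OF E0 init(1) Z0]
  show "U t = 0" by (rule zero(1)[OF t])
  \<comment> \<open>As the gradient and the Laplacian of \<theta> vanish, the tested heat equation
    loses its dissipation, and its coupling term is the product of u_t with \<Delta>\<theta> = 0. So
    the norm of \<theta> is constant.\<close>
  have "\<Theta> t \<bullet> \<Theta> t = \<Theta> 0 \<bullet> \<Theta> 0"
  proof (rule constant_if_DERIV_zero[where f' = "\<lambda>s. \<Theta> s \<bullet> \<Theta>' s + \<Theta>' s \<bullet> \<Theta> s"])
    show "0 \<le> t" using t by simp
    show "((\<lambda>s. \<Theta> s \<bullet> \<Theta> s) has_real_derivative \<Theta> s \<bullet> \<Theta>' s + \<Theta>' s \<bullet> \<Theta> s) (at s within {0..t})"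
      if "s \<in> {0..t}" for s
    proof -
      have D: "(\<Theta> has_vector_derivative \<Theta>' s) (at s within {0..t})"
        by (rule has_vector_derivative_within_subset[OF \<Theta>]) (use that t T(2) in auto)
      show ?thesis by (rule P.inner_deriv[OF D D])
    qed
    fix s assume "s \<in> {0<..<t}"
    then have s: "s \<in> {0<..T}" "s \<in> {0..T}" "s \<in> I" using t T(2) by auto
    have Y0: "Y j s = 0" if "j \<in> grad_lap_index" for j using that by (rule zero(3)[OF s(2)])
    have "L s = 0" using Y0[of None] by (simp add: grad_lap_index_def)
    obtain g where "dirichlet_laplacian \<Omega> (V s) g (X' s)" using lap_V[OF s(3)] by blast
    from dirichlet_laplacian_symmetric[OF this lap_\<Theta>[OF s(3)]] have "X' s \<bullet> \<Theta> s = 0"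
      by (simp add: \<open>L s = 0\<close>)
    then have "a * (\<Theta>' s \<bullet> \<Theta> s) = 0"
      using P.eq_\<Theta>[OF s(1)] Y0 by simp
    then show "\<Theta> s \<bullet> \<Theta>' s + \<Theta>' s \<bullet> \<Theta> s = 0"
      using params by (simp add: inner_commute)
  qed
  then show "\<Theta> t = 0" by (simp add: init)
qed

end

lemma zero_at_left_endpoint:
  fixes f :: "real \<Rightarrow> 'b::real_normed_vector"
  assumes "continuous_on {0..T} f" "T > 0" "\<And>t. t \<in> {0<..T} \<Longrightarrow> f t = 0"
  shows "f 0 = 0"
proof (rule continuous_constant_on_closure[of "{0<..T}" f 0])
  have cl: "closure {0<..T} = {0..T}" using assms(2) by simp
  show "continuous_on (closure {0<..T}) f" "0 \<in> closure {0<..T}"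
    using cl assms by simp_all
qed (rule assms(3))

locale l2_global_solution = l2_solution_Phi where I = "{0..}"
begin

text \<open>The formulas do not contain T, so the plates on all intervals [0, T] share the same
  functions on the half-line.\<close>

abbreviation "BYY \<equiv> thermoelastic_plate.BYY grad_lap_index wt Y"
abbreviation "BZZ \<equiv> thermoelastic_plate.BZZ grad_lap_index wt Z"
abbreviation "En \<equiv> thermoelastic_plate.En \<rho> a c V X \<Theta>"
abbreviation "Fn \<equiv> thermoelastic_plate.Fn \<rho> grad_lap_index wt U Z"
abbreviation "Fn' \<equiv> thermoelastic_plate.Fn' \<rho> grad_lap_index wt U V Z"

lemma plate: "T > 0 \<Longrightarrow> thermoelastic_plate T \<rho> a c \<eta> grad_lap_index wt U V W X X' \<Theta> \<Theta>' Y Z"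
  by (rule thermoelastic_plate) auto

text \<open>Rules out the degenerate case of \<open>growth\<close>, in which no dissipation ever
  builds a lower bound for F''.\<close>

lemma stationary_temperature:
  assumes BYY0: "\<And>t. t \<ge> 0 \<Longrightarrow> BYY t = 0" and En0: "En 0 = 0"
  shows "Fn' 0 0 = 0"
proof -
  interpret P: thermoelastic_plate 1 \<rho> a c \<eta> grad_lap_index wt U V W X X' \<Theta> \<Theta>' Y Z
    by (rule plate) simp
  have Y0: "Y j t = 0" if "t \<ge> 0" "j \<in> grad_lap_index" for t j
  proof -
    have "wt j * (Y j t \<bullet> Y j t) = 0"
      using BYY0[OF that(1)] P.wt that(2) unfolding P.BYY_def
      by (subst (asm) sum_nonneg_eq_0_iff) (auto simp: less_imp_le finite_grad_lap_index)
    then show ?thesis using P.wt[OF that(2)] by simp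
  qed
  have L0: "L t = 0" and G0: "\<And>i. i \<in> Basis \<Longrightarrow> G i t = 0" if "t \<ge> 0" for t
    using Y0[OF that, of None] Y0[OF that, of "Some _"] by (auto simp: grad_lap_index_def)
  have \<Theta>0: "\<Theta> t = 0" if "t \<ge> 0" for t
    using dirichlet_laplacian_grad_zero[OF \<Omega> lap_\<Theta>] G0 that by simp
  have \<Theta>'0: "\<Theta>' t = 0" if "t \<in> {0..1}" for t
  proof (rule P.zero_has_vector_derivative[OF that])
    show "((\<lambda>s. 0) has_vector_derivative \<Theta>' t) (at t within {0..1})"
      by (rule has_vector_derivative_transform[OF that _ P.\<Theta>[OF that]]) (simp add: \<Theta>0)
  qed
  have V0: "V t = 0" if t: "t \<in> {0<..1}" for t
  proof -
    have t': "t \<in> {0..}" "0 < t" "t \<in> {0..1}" using t by auto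
    obtain g where g: "dirichlet_laplacian \<Omega> (V t) g (X' t)" using lap_V[OF t'(1)] by blast
    obtain h where h: "dirichlet_laplacian \<Omega> (L t) h (LL t)" using lap_L[OF t'(1)] by blast
    have "LL t \<bullet> V t = 0"
      using dirichlet_bilaplacian[OF lap_\<Theta>[OF t'(1)] h g] L0[of t] t' by simp
    \<comment> \<open>The heat equation with \<theta> = 0, tested with u_t. Since \<eta> \<noteq> 0,
      Green's formula then shows that the gradient of u_t vanishes.\<close>
    moreover have "0 = - d * (LL t \<bullet> V t) - \<eta> * (X' t \<bullet> V t)"
      using arg_cong[OF eq_\<Theta>[OF t'(1,2)], of "\<lambda>v. v \<bullet> V t"] \<Theta>'0[OF t'(3)] L0[of t] t'
      by (simp add: inner_diff_left)
    ultimately have "X' t \<bullet> V t = 0" using params by simp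
    then have "(\<Sum>i\<in>Basis. g i \<bullet> g i) = 0"
      using dirichlet_laplacian_green[OF g g] by simp
    then have "g i = 0" if "i \<in> Basis" for i
      using that by (simp add: sum_nonneg_eq_0_iff)
    then show ?thesis
      by (rule dirichlet_laplacian_grad_zero[OF \<Omega> g])
  qed
  have "continuous_on {0..1} V"
    unfolding continuous_on_eq_continuous_within using has_vector_derivative_continuous[OF P.V] by blast
  then have V00: "V 0 = 0" by (rule zero_at_left_endpoint) (use V0 in auto)
  have "c * (X 0 \<bullet> X 0) = 0"
    using En0 \<Theta>0[of 0] by (simp add: P.En_def V00)
  then have X00: "X 0 = 0" using params by simp
  have "BZZ 0 = (\<Sum>j\<in>grad_lap_index. wt j * (grad_lap LP GP j \<bullet> grad_lap LP GP j))"
    by (simp add: P.BZZ_def Z_def)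
  \<comment> \<open>The equation for \<Phi> tested with \<Phi> itself; its data a \<theta> + \<eta>
    \<Delta>u at time 0 vanish.\<close>
  also have "\<dots> = 0"
    using tested_P[OF lap_P] \<Theta>0[of 0] X00 by simp
  finally show ?thesis
    by (simp add: P.Fn'_def V00)
qed

lemma growth:
  assumes En0: "En 0 = - \<omega>" and \<omega>: "\<omega> > 0 \<or> \<omega> = 0 \<and> Fn' 0 0 > 0"
  shows "\<exists>C1>0. \<exists>\<kappa>>0. \<exists>C2\<ge>0. \<forall>t\<ge>0. Fn \<omega> t \<ge> C1 * exp (\<kappa> * t) - C2"
proof -
  interpret P1: thermoelastic_plate 1 \<rho> a c \<eta> grad_lap_index wt U V W X X' \<Theta> \<Theta>' Y Z
    by (rule plate) simp
  have \<omega>0: "\<omega> \<ge> 0" using \<omega> by auto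
  define I where "I = (\<lambda>t. integral {0..t} BYY)"
  have cont: "continuous_on {0..t} BYY" if "t > 0" for t
    using thermoelastic_plate.continuous_BYY[OF plate[OF that]] .
  have I_mono: "I s \<le> I t" if "0 \<le> s" "s \<le> t" for s t
  proof (cases "t = 0")
    case False
    then have "t > 0" using that by simp
    have int: "BYY integrable_on {0..t}"
      by (rule integrable_continuous_real[OF cont[OF \<open>t > 0\<close>]])
    show ?thesis
      unfolding I_def
      by (rule integral_subset_le) (use that P1.BYY_nonneg int integrable_on_subinterval[OF int] in auto)
  qed (use that in simp)
  have I0: "I t \<ge> 0" if "t \<ge> 0" for t
    using I_mono[of 0 t] that by (simp add: I_def)
  define F'' where "F'' = (\<lambda>t. 4 * (\<rho> * (V t \<bullet> V t) + I t) - 4 * En 0 + 2 * \<omega>)"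
  \<comment> \<open>For \<omega> > 0 the bound is -4 E(0) + 2 \<omega> = 6 \<omega>. For \<omega> =
    0 it is the dissipation accumulated by some time, which never decreases; its total absence would
    give F'(0) = 0.\<close>
  obtain t1 \<epsilon> where t1: "t1 > 0" "\<epsilon> > 0" "\<And>t. t \<ge> t1 \<Longrightarrow> \<epsilon> \<le> F'' t"
  proof -
    consider "\<omega> > 0" | t where "\<omega> = 0" "t > 0" "I t > 0" | "\<omega> = 0" "\<And>t. t > 0 \<Longrightarrow> I t \<le> 0"
      using \<omega> by (metis not_le)
    then show thesis
    proof cases
      case 1
      have "6 * \<omega> \<le> F'' t" if "t \<ge> 1" for t
        using I0[of t] that params by (simp add: F''_def En0)
      with 1 show thesis by (intro that[of 1 "6 * \<omega>"]) auto
    next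
      case (2 t)
      have "4 * I t \<le> F'' s" if "s \<ge> t" for s
      proof -
        have "0 \<le> \<rho> * (V s \<bullet> V s)" using params by simp
        then show ?thesis using I_mono[of t s] that 2 by (simp add: F''_def En0)
      qed
      with 2 show thesis by (intro that[of t "4 * I t"]) auto
    next
      case 3
      have "BYY t = 0" if "t \<ge> 0" for t
      proof -
        have "I (t + 1) = 0" using 3(2)[of "t + 1"] I0[of "t + 1"] that by simp
        then have "\<forall>s\<in>{0..t + 1}. BYY s = 0"
          using integral_eq_0_iff[OF cont[of "t + 1"]] P1.BYY_nonneg that by (simp add: I_def)
        then show ?thesis using that by simp
      qed
      then have "Fn' 0 0 = 0" using En0 3(1) by (intro stationary_temperature) auto
      with 3(1) \<omega> show thesis by simp
    qed
  qed
  \<comment> \<open>The plate is taken on [0, t + 1] to make t an interior point, where the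
    derivative within the interval is the full one.\<close>
  have at: "at t within {0..t + 1} = at t" if "t > 0" for t :: real
    using that by (intro at_within_Icc_at) auto
  have "\<exists>t2\<ge>t1. \<exists>\<kappa>>0. Fn \<omega> t2 > 0 \<and> (\<forall>t\<ge>t2. Fn \<omega> t2 * exp (\<kappa> * (t - t2)) \<le> Fn \<omega> t)"
  proof (rule exponential_growth[where f' = "Fn' \<omega>" and f'' = F'' and m = "BZZ 0" and \<epsilon> = \<epsilon>])
    fix t assume "t \<ge> t1"
    then have t: "t > 0" using t1 by simp
    interpret P: thermoelastic_plate "t + 1" \<rho> a c \<eta> grad_lap_index wt U V W X X' \<Theta> \<Theta>' Y Z
      by (rule plate) (use t in simp)
    show "(Fn \<omega> has_real_derivative Fn' \<omega> t) (at t)"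
      using P.Fn_deriv[of t \<omega>] t by (simp add: at)
    show "(Fn' \<omega> has_real_derivative F'' t) (at t)"
      using P.Fn'_deriv[of t \<omega>] t by (simp add: F''_def I_def)
    have "4 * P.Qn \<omega> t \<le> F'' t"
      using \<omega>0 by (simp add: P.Qn_def F''_def I_def En0)
    then have "Fn \<omega> t * (4 * P.Qn \<omega> t) \<le> Fn \<omega> t * F'' t"
      using P.Fn_nonneg[of t \<omega>] t \<omega>0 by (intro mult_left_mono) auto
    then show "(Fn' \<omega> t - BZZ 0)\<^sup>2 \<le> Fn \<omega> t * F'' t"
      using P.Fn_convex[of t \<omega>] t \<omega>0 by simp
  qed (use t1 P1.BZZ_nonneg in auto)
  then obtain t2 \<kappa> where t2: "t2 \<ge> t1" "\<kappa> > 0" "Fn \<omega> t2 > 0"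
      "\<And>t. t \<ge> t2 \<Longrightarrow> Fn \<omega> t2 * exp (\<kappa> * (t - t2)) \<le> Fn \<omega> t"
    by blast
  \<comment> \<open>C1 shifts the exponential so that it has the value F(t2) at \<open>t2\<close>.
    Before \<open>t2\<close> it is smaller, so subtracting C2 = F(t2) makes the bound nonpositive
    there.\<close>
  have "Fn \<omega> t \<ge> Fn \<omega> t2 * exp (- \<kappa> * t2) * exp (\<kappa> * t) - Fn \<omega> t2" if t: "t \<ge> 0" for t
  proof -
    have eq: "Fn \<omega> t2 * exp (- \<kappa> * t2) * exp (\<kappa> * t) = Fn \<omega> t2 * exp (\<kappa> * (t - t2))"
      by (simp add: mult.assoc right_diff_distrib flip: exp_add)
    show ?thesis
    proof (cases "t \<ge> t2")
      case True
      then show ?thesis using t2(4)[of t] t2(3) unfolding eq by linarith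
    next
      case False
      then have "Fn \<omega> t2 * exp (\<kappa> * (t - t2)) \<le> Fn \<omega> t2 * 1"
        using t2(2,3) by (intro mult_left_mono) (auto simp: mult_le_0_iff)
      moreover have "Fn \<omega> t \<ge> 0"
        using thermoelastic_plate.Fn_nonneg[OF plate[of "t + 1"], of t \<omega>] t \<omega>0 by simp
      ultimately show ?thesis unfolding eq by simp
    qed
  qed
  then show ?thesis
    using t2(2,3) by (intro exI[of _ "Fn \<omega> t2 * exp (- \<kappa> * t2)"] exI[of _ \<kappa>] exI[of _ "Fn \<omega> t2"] conjI) auto
qed

end

section \<open>Curves of functions as curves in the Hilbert space\<close>

text \<open>Initial data are given only as functions equal almost everywhere to values of the
  solution; completeness of Lebesgue measure makes them measurable and hence elements of L2.\<close>

lemma L2_AE_cong: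
  assumes \<Omega>: "\<Omega> \<in> sets lebesgue" and f: "f \<in> L2 \<Omega>" and ae: "AE x in lebesgue_on \<Omega>. f x = g x"
  shows "g \<in> L2 \<Omega>" "emb \<Omega> g = emb \<Omega> f"
proof -
  have ae': "AE x in lebesgue. indicator \<Omega> x * f x = indicator \<Omega> x * g x"
    using ae \<Omega> by (simp add: AE_restrict_space_iff) (auto simp: indicator_def elim: eventually_mono)
  have f': "square_integrable (\<lambda>x. indicator \<Omega> x * f x)"
    using f \<Omega> by (simp add: L2_iff_square_integrable)
  have meas: "(\<lambda>x. indicator \<Omega> x * g x) \<in> borel_measurable lebesgue"
    using borel_measurable_AE[OF _ ae'] f' by (simp add: square_integrable_def)
  have "integrable lebesgue (\<lambda>x. (indicator \<Omega> x * f x)\<^sup>2) \<longleftrightarrow> integrable lebesgue (\<lambda>x. (indicator \<Omega> x * g x)\<^sup>2)"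
  proof (rule integrable_cong_AE)
    show "(\<lambda>x. (indicator \<Omega> x * f x)\<^sup>2) \<in> borel_measurable lebesgue"
      using f' unfolding square_integrable_def by (intro borel_measurable_power) simp
    show "(\<lambda>x. (indicator \<Omega> x * g x)\<^sup>2) \<in> borel_measurable lebesgue"
      by (intro borel_measurable_power meas)
    show "AE x in lebesgue. (indicator \<Omega> x * f x)\<^sup>2 = (indicator \<Omega> x * g x)\<^sup>2"
      using ae' by eventually_elim (simp only:)
  qed
  then have "square_integrable (\<lambda>x. indicator \<Omega> x * g x)"
    using f' meas by (simp add: square_integrable_def)
  then show g: "g \<in> L2 \<Omega>"
    using \<Omega> by (simp add: L2_iff_square_integrable)
  show "emb \<Omega> g = emb \<Omega> f"
    using emb_eq_iff[OF \<Omega> f g] ae by simp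
qed

lemma L2_integral_squares:
  assumes \<Omega>: "\<Omega> \<in> sets lebesgue" and "\<And>i. i \<in> K \<Longrightarrow> f i \<in> L2 \<Omega>"
  shows "(\<integral>x. (\<Sum>i\<in>K. r i * (f i x)\<^sup>2) \<partial>lebesgue_on \<Omega>) = (\<Sum>i\<in>K. r i * (emb \<Omega> (f i) \<bullet> emb \<Omega> (f i)))"
proof -
  have int: "integrable (lebesgue_on \<Omega>) (\<lambda>x. (f i x)\<^sup>2)" if "i \<in> K" for i
    using assms(2)[OF that] by (simp add: L2_def)
  have "(\<integral>x. (\<Sum>i\<in>K. r i * (f i x)\<^sup>2) \<partial>lebesgue_on \<Omega>) = (\<Sum>i\<in>K. \<integral>x. r i * (f i x)\<^sup>2 \<partial>lebesgue_on \<Omega>)"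
    using int by (intro Bochner_Integration.integral_sum) simp
  also have "\<dots> = (\<Sum>i\<in>K. r i * (emb \<Omega> (f i) \<bullet> emb \<Omega> (f i)))"
    using assms by (intro sum.cong) (simp_all add: inner_emb power2_eq_square)
  finally show ?thesis .
qed

lemma L2_integral_square:
  "\<Omega> \<in> sets lebesgue \<Longrightarrow> f \<in> L2 \<Omega> \<Longrightarrow> (\<integral>x. r * (f x)\<^sup>2 \<partial>lebesgue_on \<Omega>) = r * (emb \<Omega> f \<bullet> emb \<Omega> f)"
  using L2_integral_squares[of \<Omega> "{()}" "\<lambda>_. f" "\<lambda>_. r"] by simp

lemma emb_in_l2_on: "f \<in> L2 \<Omega> \<Longrightarrow> emb \<Omega> f \<in> l2_on \<Omega>"
  by (simp add: l2_on_def)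

lemma subspace_l2_on:
  assumes "\<Omega> \<in> sets lebesgue"
  shows "subspace (l2_on \<Omega>)"
proof -
  have lin: "linear (l2_restrict \<Omega>)"
    by (rule bounded_linear.linear[OF bounded_linear_l2_restrict[OF assms]])
  show ?thesis
    by (auto simp: subspace_def l2_on_iff[OF assms] linear_0[OF lin] linear_add[OF lin] linear_scale[OF lin])
qed

text \<open>The quotient form is the one in which \<open>C_time\<close> and \<open>tderiv\<close>
  express differentiability.\<close>

lemma has_vector_derivative_iff_quotient:
  fixes f :: "real \<Rightarrow> 'b::real_normed_vector"
  shows "(f has_vector_derivative f') (at t within S) \<longleftrightarrow>
    ((\<lambda>s. norm ((1 / (s - t)) *\<^sub>R (f s - f t) - f')) \<longlongrightarrow> 0) (at t within S)"
proof -
  have eq: "norm ((f s - f t) - (s - t) *\<^sub>R f') / norm (s - t) = norm ((1 / (s - t)) *\<^sub>R (f s - f t) - f')"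
    if "s \<noteq> t" for s
  proof -
    have "(1 / (s - t)) *\<^sub>R (f s - f t) - f' = (1 / (s - t)) *\<^sub>R ((f s - f t) - (s - t) *\<^sub>R f')"
      using that by (simp add: scaleR_right_diff_distrib)
    then show ?thesis by (simp add: divide_inverse mult.commute)
  qed
  have "((\<lambda>s. norm ((f s - f t) - (s - t) *\<^sub>R f') / norm (s - t)) \<longlongrightarrow> 0) (at t within S) \<longleftrightarrow>
      ((\<lambda>s. norm ((1 / (s - t)) *\<^sub>R (f s - f t) - f')) \<longlongrightarrow> 0) (at t within S)"
    by (rule tendsto_cong) (unfold eventually_at_filter, intro always_eventually allI impI eq)
  then show ?thesis
    by (simp add: has_vector_derivative_def has_derivative_iff_norm bounded_linear_scaleR_left)
qed

lemma L2_quotient: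
  assumes \<Omega>: "\<Omega> \<in> sets lebesgue" and "u \<in> L2 \<Omega>" "u' \<in> L2 \<Omega>" "v \<in> L2 \<Omega>"
  shows "(\<lambda>x. (u x - u' x) / h - v x) \<in> L2 \<Omega>"
    "emb \<Omega> (\<lambda>x. (u x - u' x) / h - v x) = (1 / h) *\<^sub>R (emb \<Omega> u - emb \<Omega> u') - emb \<Omega> v"
proof -
  have eq: "(\<lambda>x. (u x - u' x) / h - v x) = (\<lambda>x. (1 / h) * (u x - u' x) - v x)" by simp
  note L2 = L2_cmult[OF \<Omega> L2_diff[OF \<Omega> assms(2,3)]]
  show "(\<lambda>x. (u x - u' x) / h - v x) \<in> L2 \<Omega>"
    unfolding eq by (rule L2_diff[OF \<Omega> L2 assms(4)])
  show "emb \<Omega> (\<lambda>x. (u x - u' x) / h - v x) = (1 / h) *\<^sub>R (emb \<Omega> u - emb \<Omega> u') - emb \<Omega> v"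
    unfolding eq emb_diff[OF \<Omega> L2 assms(4)] emb_cmult[OF \<Omega> L2_diff[OF \<Omega> assms(2,3)]]
      emb_diff[OF \<Omega> assms(2,3)] ..
qed

lemma L2_has_vector_derivative_iff:
  assumes \<Omega>: "\<Omega> \<in> sets lebesgue" and u: "\<And>s. s \<in> I \<Longrightarrow> u s \<in> L2 \<Omega>" and v: "v \<in> L2 \<Omega>" and t: "t \<in> I"
  shows "((\<lambda>s. emb \<Omega> (u s)) has_vector_derivative emb \<Omega> v) (at t within I) \<longleftrightarrow>
    ((\<lambda>s. L2_norm \<Omega> (\<lambda>x. (u s x - u t x) / (s - t) - v x)) \<longlongrightarrow> 0) (at t within I)"
  unfolding has_vector_derivative_iff_quotient
proof (rule tendsto_cong)
  have "norm ((1 / (s - t)) *\<^sub>R (emb \<Omega> (u s) - emb \<Omega> (u t)) - emb \<Omega> v) =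
      L2_norm \<Omega> (\<lambda>x. (u s x - u t x) / (s - t) - v x)" if "s \<in> I" for s
    using norm_emb[OF \<Omega> L2_quotient(1)[OF \<Omega> u[OF that] u[OF t] v]]
    by (simp add: L2_quotient(2)[OF \<Omega> u[OF that] u[OF t] v])
  then show "\<forall>\<^sub>F s in at t within I. norm ((1 / (s - t)) *\<^sub>R (emb \<Omega> (u s) - emb \<Omega> (u t)) - emb \<Omega> v) =
      L2_norm \<Omega> (\<lambda>x. (u s x - u t x) / (s - t) - v x)"
    by (simp add: eventually_at_filter)
qed

text \<open>Makes derivatives within the interval unique, also at its endpoints.\<close>

lemma solution_interval_nontrivial:
  assumes "solution_interval I" "t \<in> I"
  shows "at t within I \<noteq> bot"
  using assms(1) unfolding solution_interval_def
proof
  assume "\<exists>t1>0. I = {0..t1}"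
  then show ?thesis using assms(2) by (auto simp: trivial_limit_within)
next
  assume I: "I = {0..}"
  then have "t islimpt {0..t + 1}" using assms(2) by simp
  then have "t islimpt I" by (rule islimpt_subset) (auto simp: I)
  then show ?thesis by (simp add: trivial_limit_within)
qed

text \<open>As for \<open>wderiv\<close>: any derivative of the curve justifies the choice in
  \<open>tderiv\<close>, and uniqueness of derivatives fixes its class.\<close>

lemma tderiv_emb:
  assumes \<Omega>: "\<Omega> \<in> sets lebesgue" and I: "solution_interval I" and u: "\<And>s. s \<in> I \<Longrightarrow> u s \<in> L2 \<Omega>"
    and v: "v \<in> L2 \<Omega>" and t: "t \<in> I"
    and D: "((\<lambda>s. emb \<Omega> (u s)) has_vector_derivative emb \<Omega> v) (at t within I)"
  shows "tderiv \<Omega> I u t \<in> L2 \<Omega>" "emb \<Omega> (tderiv \<Omega> I u t) = emb \<Omega> v"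
proof -
  let ?P = "\<lambda>v. v \<in> L2 \<Omega> \<and> ((\<lambda>s. L2_norm \<Omega> (\<lambda>x. (u s x - u t x) / (s - t) - v x)) \<longlongrightarrow> 0) (at t within I)"
  have "?P v" using L2_has_vector_derivative_iff[OF \<Omega> u v t] D v by simp
  from someI[of ?P, OF this] have P: "?P (tderiv \<Omega> I u t)"
    unfolding tderiv_def .
  then show L2: "tderiv \<Omega> I u t \<in> L2 \<Omega>" by simp
  have "((\<lambda>s. emb \<Omega> (u s)) has_vector_derivative emb \<Omega> (tderiv \<Omega> I u t)) (at t within I)"
    using L2_has_vector_derivative_iff[OF \<Omega> u L2 t] P by simp
  then show "emb \<Omega> (tderiv \<Omega> I u t) = emb \<Omega> v"
    by (rule vector_derivative_unique_within[OF solution_interval_nontrivial[OF I t] _ D])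
qed

text \<open>Choices are not linear: the derivative chosen for the quotient is tied to those chosen
  for its ingredients only through classes.\<close>

lemma emb_deriv_quotient:
  assumes "open \<Omega>" "u \<in> sobolev \<Omega> k" "u' \<in> sobolev \<Omega> k" "v \<in> sobolev \<Omega> k" "\<beta> \<in> multi_indices k"
  shows "wderiv \<Omega> \<beta> (\<lambda>x. (u x - u' x) / h - v x) \<in> L2 \<Omega>"
    "emb_deriv \<Omega> \<beta> (\<lambda>x. (u x - u' x) / h - v x) =
       (1 / h) *\<^sub>R (emb_deriv \<Omega> \<beta> u - emb_deriv \<Omega> \<beta> u') - emb_deriv \<Omega> \<beta> v"
proof -
  have \<Omega>: "\<Omega> \<in> sets lebesgue" using assms(1) by auto
  note s = sobolev_emb_deriv(2,3)[OF assms(1) _ assms(5)]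
  note q = L2_quotient[OF \<Omega> sobolev_L2[OF assms(2)] sobolev_L2[OF assms(3)] sobolev_L2[OF assms(4)]]
  have mem: "(1 / h) *\<^sub>R (emb_deriv \<Omega> \<beta> u - emb_deriv \<Omega> \<beta> u') - emb_deriv \<Omega> \<beta> v \<in> l2_on \<Omega>"
    by (intro subspace_diff subspace_scale subspace_l2_on[OF \<Omega>] s(2) assms(2-4))
  have wd: "weak_deriv \<Omega> \<beta> (emb \<Omega> (\<lambda>x. (u x - u' x) / h - v x))
      ((1 / h) *\<^sub>R (emb_deriv \<Omega> \<beta> u - emb_deriv \<Omega> \<beta> u') - emb_deriv \<Omega> \<beta> v)"
    unfolding q(2) by (intro weak_deriv_diff weak_deriv_scaleR s(1) assms(2-4))
  show "wderiv \<Omega> \<beta> (\<lambda>x. (u x - u' x) / h - v x) \<in> L2 \<Omega>"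
    "emb_deriv \<Omega> \<beta> (\<lambda>x. (u x - u' x) / h - v x) =
       (1 / h) *\<^sub>R (emb_deriv \<Omega> \<beta> u - emb_deriv \<Omega> \<beta> u') - emb_deriv \<Omega> \<beta> v"
    by (rule emb_deriv_eqI[OF assms(1) q(1) mem wd multi_indicesD[OF assms(5)]])+
qed

lemma emb_deriv_has_vector_derivative:
  assumes "open \<Omega>" and u: "\<And>s. s \<in> I \<Longrightarrow> u s \<in> sobolev \<Omega> k" and v: "v \<in> sobolev \<Omega> k" and t: "t \<in> I"
    and \<beta>: "\<beta> \<in> multi_indices k"
    and lim: "((\<lambda>s. sobolev_norm \<Omega> k (\<lambda>x. (u s x - u t x) / (s - t) - v x)) \<longlongrightarrow> 0) (at t within I)"
  shows "((\<lambda>s. emb_deriv \<Omega> \<beta> (u s)) has_vector_derivative emb_deriv \<Omega> \<beta> v) (at t within I)"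
  unfolding has_vector_derivative_iff_quotient
proof (rule Lim_null_comparison[OF _ lim])
  have \<Omega>: "\<Omega> \<in> sets lebesgue" using assms(1) by auto
  have "norm ((1 / (s - t)) *\<^sub>R (emb_deriv \<Omega> \<beta> (u s) - emb_deriv \<Omega> \<beta> (u t)) - emb_deriv \<Omega> \<beta> v)
      \<le> sobolev_norm \<Omega> k (\<lambda>x. (u s x - u t x) / (s - t) - v x)" if "s \<in> I" for s
    using norm_emb_deriv_le[OF \<Omega> \<beta> emb_deriv_quotient(1)[OF assms(1) u[OF that] u[OF t] v \<beta>]]
    by (simp add: emb_deriv_quotient(2)[OF assms(1) u[OF that] u[OF t] v \<beta>])
  then show "\<forall>\<^sub>F s in at t within I.
      norm (norm ((1 / (s - t)) *\<^sub>R (emb_deriv \<Omega> \<beta> (u s) - emb_deriv \<Omega> \<beta> (u t)) - emb_deriv \<Omega> \<beta> v))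
      \<le> sobolev_norm \<Omega> k (\<lambda>x. (u s x - u t x) / (s - t) - v x)"
    by (simp add: eventually_at_filter)
qed

lemma zero_sobolev:
  assumes "\<Omega> \<in> sets lebesgue"
  shows "(\<lambda>x. 0) \<in> sobolev \<Omega> k"
proof -
  have "is_weak_deriv \<Omega> \<beta> (\<lambda>x. 0) (\<lambda>x. 0)" for \<beta> by (simp add: is_weak_deriv_def)
  then show ?thesis
    using L2_zero[OF assms] unfolding sobolev_def by blast
qed

lemma emb_deriv_zero:
  assumes "open \<Omega>" "set \<beta> \<subseteq> Basis"
  shows "emb_deriv \<Omega> \<beta> (\<lambda>x. 0) = 0"
proof -
  have \<Omega>: "\<Omega> \<in> sets lebesgue" using assms(1) by auto
  show ?thesis
    by (rule emb_deriv_eqI[OF assms(1) L2_zero[OF \<Omega>] _ _ assms(2)])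
       (simp_all add: emb_zero weak_deriv_def subspace_0 subspace_l2_on[OF \<Omega>])
qed

lemma emb_deriv_continuous_on:
  assumes "open \<Omega>" and u: "\<And>s. s \<in> I \<Longrightarrow> u s \<in> sobolev \<Omega> k" and \<beta>: "\<beta> \<in> multi_indices k"
    and lim: "\<And>t. t \<in> I \<Longrightarrow> ((\<lambda>s. sobolev_norm \<Omega> k (\<lambda>x. u s x - u t x)) \<longlongrightarrow> 0) (at t within I)"
  shows "continuous_on I (\<lambda>s. emb_deriv \<Omega> \<beta> (u s))"
  unfolding continuous_on_def
proof
  fix t assume t: "t \<in> I"
  have \<Omega>: "\<Omega> \<in> sets lebesgue" using assms(1) by auto
  have "((\<lambda>s. emb_deriv \<Omega> \<beta> (u s) - emb_deriv \<Omega> \<beta> (u t)) \<longlongrightarrow> 0) (at t within I)"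
  proof (rule Lim_null_comparison[OF _ lim[OF t]])
    have "norm (emb_deriv \<Omega> \<beta> (u s) - emb_deriv \<Omega> \<beta> (u t)) \<le> sobolev_norm \<Omega> k (\<lambda>x. u s x - u t x)"
      if "s \<in> I" for s
    proof -
      \<comment> \<open>A plain difference is the quotient with step 1 and
        \<open>v = 0\<close>.\<close>
      note q = emb_deriv_quotient[OF assms(1) u[OF that] u[OF t] zero_sobolev[OF \<Omega>] \<beta>, of 1]
      show ?thesis
        using norm_emb_deriv_le[OF \<Omega> \<beta> q(1)] unfolding q(2)
        by (simp add: emb_deriv_zero[OF assms(1) multi_indicesD[OF \<beta>]])
    qed
    then show "\<forall>\<^sub>F s in at t within I. norm (emb_deriv \<Omega> \<beta> (u s) - emb_deriv \<Omega> \<beta> (u t))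
        \<le> sobolev_norm \<Omega> k (\<lambda>x. u s x - u t x)"
      by (simp add: eventually_at_filter)
  qed
  then show "((\<lambda>s. emb_deriv \<Omega> \<beta> (u s)) \<longlongrightarrow> emb_deriv \<Omega> \<beta> (u t)) (at t within I)"
    by (simp add: LIM_zero_iff)
qed

text \<open>Serves functions known only up to null sets, such as \<open>u0\<close> and
  \<open>tderiv\<close>: the class of the Laplacian depends on the class of the function
  alone.\<close>

lemma emb_laplacian_cong:
  assumes "open \<Omega>" "f \<in> sobolev \<Omega> 2" "g \<in> L2 \<Omega>" "emb \<Omega> g = emb \<Omega> f"
  shows "laplacian \<Omega> g \<in> L2 \<Omega>" "emb \<Omega> (laplacian \<Omega> g) = emb \<Omega> (laplacian \<Omega> f)"
proof -
  have \<Omega>: "\<Omega> \<in> sets lebesgue" using assms(1) by auto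
  have *: "wderiv \<Omega> [i, i] g \<in> L2 \<Omega>" "emb \<Omega> (wderiv \<Omega> [i, i] g) = emb_deriv \<Omega> [i, i] f" if i: "i \<in> Basis" for i
  proof -
    have mi: "[i, i] \<in> multi_indices 2" using i by (simp add: multi_indices_def)
    note f = sobolev_emb_deriv(2,3)[OF assms(1,2) mi]
    show "wderiv \<Omega> [i, i] g \<in> L2 \<Omega>" "emb \<Omega> (wderiv \<Omega> [i, i] g) = emb_deriv \<Omega> [i, i] f"
      using emb_deriv_eqI[OF assms(1,3) f(2) _ multi_indicesD[OF mi]] f(1) assms(4)
      by (simp_all add: emb_deriv_def)
  qed
  show "laplacian \<Omega> g \<in> L2 \<Omega>"
    unfolding laplacian_def[abs_def] using \<Omega> *(1) by (rule L2_sum)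
  have "emb \<Omega> (laplacian \<Omega> g) = (\<Sum>i\<in>Basis. emb \<Omega> (wderiv \<Omega> [i, i] g))"
    unfolding laplacian_def[abs_def] using \<Omega> *(1) by (rule emb_sum)
  then show "emb \<Omega> (laplacian \<Omega> g) = emb \<Omega> (laplacian \<Omega> f)"
    using *(2) by (simp add: emb_laplacian[OF assms(1,2)])
qed

text \<open>\<open>is_time_integral\<close> is \<open>has_integral\<close> read through
  \<open>emb\<close>, because Riemann sums commute with \<open>emb\<close>. Existence follows from
  continuity and completeness, and the integral stays in \<open>l2_on \<Omega>\<close>, so it has a
  representative on \<Omega>.\<close>

lemma time_integral_emb:
  assumes \<Omega>: "\<Omega> \<in> sets lebesgue" and "0 \<le> t" and f: "\<And>s. s \<in> {0..t} \<Longrightarrow> f s \<in> L2 \<Omega>"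
    and cont: "continuous_on {0..t} (\<lambda>s. emb \<Omega> (f s))"
  shows "time_integral \<Omega> f t \<in> L2 \<Omega>"
    "emb \<Omega> (time_integral \<Omega> f t) = integral {0..t} (\<lambda>s. emb \<Omega> (f s))"
proof -
  have sum_emb: "(\<lambda>x. (\<Sum>(s, K)\<in>\<D>. measure lborel K * f s x) - A x) \<in> L2 \<Omega> \<and>
      emb \<Omega> (\<lambda>x. (\<Sum>(s, K)\<in>\<D>. measure lborel K * f s x) - A x) =
        (\<Sum>(s, K)\<in>\<D>. measure lborel K *\<^sub>R emb \<Omega> (f s)) - emb \<Omega> A"
    if \<D>: "\<D> tagged_division_of {0..t}" and A: "A \<in> L2 \<Omega>" for \<D> A
  proof -
    have mem: "(case p of (s, K) \<Rightarrow> (\<lambda>x. measure lborel K * f s x)) \<in> L2 \<Omega>" if "p \<in> \<D>" for p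
    proof -
      obtain s K where p: "p = (s, K)" by force
      then have "s \<in> {0..t}" using tagged_division_ofD(2,3)[OF \<D>] that by blast
      then show ?thesis unfolding p by (simp add: L2_cmult[OF \<Omega>] f)
    qed
    have eq: "(\<lambda>x. \<Sum>(s, K)\<in>\<D>. measure lborel K * f s x) =
        (\<lambda>x. \<Sum>p\<in>\<D>. (case p of (s, K) \<Rightarrow> (\<lambda>x. measure lborel K * f s x)) x)"
      by (intro ext sum.cong) auto
    have S: "(\<lambda>x. \<Sum>(s, K)\<in>\<D>. measure lborel K * f s x) \<in> L2 \<Omega>"
      unfolding eq by (rule L2_sum[OF \<Omega> mem])
    have "emb \<Omega> (\<lambda>x. \<Sum>(s, K)\<in>\<D>. measure lborel K * f s x) =
        (\<Sum>p\<in>\<D>. emb \<Omega> (case p of (s, K) \<Rightarrow> (\<lambda>x. measure lborel K * f s x)))"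
      unfolding eq by (rule emb_sum[OF \<Omega> mem])
    also have "\<dots> = (\<Sum>(s, K)\<in>\<D>. measure lborel K *\<^sub>R emb \<Omega> (f s))"
    proof (intro sum.cong refl)
      fix p assume "p \<in> \<D>"
      obtain s K where p: "p = (s, K)" by force
      then have "s \<in> {0..t}" using tagged_division_ofD(2,3)[OF \<D>] \<open>p \<in> \<D>\<close> by blast
      then show "emb \<Omega> (case p of (s, K) \<Rightarrow> (\<lambda>x. measure lborel K * f s x)) =
          (case p of (s, K) \<Rightarrow> measure lborel K *\<^sub>R emb \<Omega> (f s))"
        unfolding p by (simp add: emb_cmult[OF \<Omega>] f)
    qed
    finally show ?thesis
      using L2_diff[OF \<Omega> S A] emb_diff[OF \<Omega> S A] by simp
  qed
  have iff: "is_time_integral \<Omega> f t A \<longleftrightarrow> ((\<lambda>s. emb \<Omega> (f s)) has_integral emb \<Omega> A) {0..t}"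
    if A: "A \<in> L2 \<Omega>" for A
  proof -
    have "L2_norm \<Omega> (\<lambda>x. (\<Sum>(s, K)\<in>\<D>. measure lborel K * f s x) - A x) =
        norm ((\<Sum>(s, K)\<in>\<D>. measure lborel K *\<^sub>R emb \<Omega> (f s)) - emb \<Omega> A)"
      if "\<D> tagged_division_of {0..t}" for \<D>
      using norm_emb[OF \<Omega> conjunct1[OF sum_emb[OF that A]]]
      unfolding conjunct2[OF sum_emb[OF that A]] by (rule sym)
    then show ?thesis
      unfolding is_time_integral_def has_integral_real by (simp cong: conj_cong imp_cong)
  qed
  have int: "(\<lambda>s. emb \<Omega> (f s)) integrable_on {0..t}"
    by (rule integrable_continuous_interval[OF cont])
  then have "integral {0..t} (\<lambda>s. emb \<Omega> (f s)) \<in> l2_on \<Omega>"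
    by (rule l2_on_integral[OF \<Omega>]) (rule emb_in_l2_on[OF f])
  then obtain A where A: "A \<in> L2 \<Omega>" "emb \<Omega> A = integral {0..t} (\<lambda>s. emb \<Omega> (f s))"
    by (auto simp: l2_on_def)
  then have "A \<in> L2 \<Omega> \<and> is_time_integral \<Omega> f t A"
    using iff[OF A(1)] int by (simp add: integrable_integral)
  from someI[of "\<lambda>A. A \<in> L2 \<Omega> \<and> is_time_integral \<Omega> f t A", OF this]
  have P: "time_integral \<Omega> f t \<in> L2 \<Omega> \<and> is_time_integral \<Omega> f t (time_integral \<Omega> f t)"
    unfolding time_integral_def .
  then show "time_integral \<Omega> f t \<in> L2 \<Omega>" by simp
  show "emb \<Omega> (time_integral \<Omega> f t) = integral {0..t} (\<lambda>s. emb \<Omega> (f s))"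
    using iff[OF conjunct1[OF P]] conjunct2[OF P] by (simp add: integral_unique)
qed

section \<open>Uniqueness and instability\<close>

lemma (in l2_solution) laplacian_zero:
  assumes "t \<in> I" "U t = 0"
  shows "X t = 0"
proof -
  obtain g h where g: "dirichlet_laplacian \<Omega> (U t) g (X t)" and h: "dirichlet_laplacian \<Omega> (X t) h (XX t)"
    using lap_U[OF assms(1)] lap_X[OF assms(1)] by blast
  show ?thesis
    using dirichlet_laplacian_symmetric[OF g h] assms(2) by simp
qed

lemma l2_solution_diff:
  assumes "l2_solution \<Omega> \<rho> a b c d \<eta> I U1 V1 W1 X1 X1' XX1 \<Theta>1 \<Theta>1' K1 KK1 G1"
    and "l2_solution \<Omega> \<rho> a b c d \<eta> I U2 V2 W2 X2 X2' XX2 \<Theta>2 \<Theta>2' K2 KK2 G2"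
  shows "l2_solution \<Omega> \<rho> a b c d \<eta> I (\<lambda>t. U1 t - U2 t) (\<lambda>t. V1 t - V2 t) (\<lambda>t. W1 t - W2 t)
    (\<lambda>t. X1 t - X2 t) (\<lambda>t. X1' t - X2' t) (\<lambda>t. XX1 t - XX2 t) (\<lambda>t. \<Theta>1 t - \<Theta>2 t)
    (\<lambda>t. \<Theta>1' t - \<Theta>2' t) (\<lambda>t. K1 t - K2 t) (\<lambda>t. KK1 t - KK2 t) (\<lambda>i t. G1 i t - G2 i t)"
proof -
  interpret S1: l2_solution \<Omega> \<rho> a b c d \<eta> I U1 V1 W1 X1 X1' XX1 \<Theta>1 \<Theta>1' K1 KK1 G1 by fact
  interpret S2: l2_solution \<Omega> \<rho> a b c d \<eta> I U2 V2 W2 X2 X2' XX2 \<Theta>2 \<Theta>2' K2 KK2 G2 by fact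
  have "\<Omega> \<in> sets lebesgue" using S1.\<Omega> by auto
  note lap_diff = dirichlet_laplacian_diff[OF this]
  have lap_ex: "\<exists>g. dirichlet_laplacian \<Omega> (w - w') g (l - l')"
    if "\<exists>g. dirichlet_laplacian \<Omega> w g l" "\<exists>g. dirichlet_laplacian \<Omega> w' g l'" for w w' l l'
    using that lap_diff by blast
  show ?thesis
  proof
    show "open \<Omega>" "bounded \<Omega>" "\<rho> > 0" "a > 0" "b > 0" "d > 0" "\<eta> \<noteq> 0" "c < 0"
      using S1.\<Omega> S1.params by auto
    show "continuous_on I (\<lambda>t. K1 t - K2 t)" by (intro continuous_on_diff S1.L S2.L)
    show "continuous_on I (\<lambda>t. G1 i t - G2 i t)" if "i \<in> Basis" for i
      using that by (intro continuous_on_diff S1.G S2.G)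
    fix t assume t: "t \<in> I"
    show "((\<lambda>t. U1 t - U2 t) has_vector_derivative V1 t - V2 t) (at t within I)"
      by (intro has_vector_derivative_diff S1.U[OF t] S2.U[OF t])
    show "((\<lambda>t. V1 t - V2 t) has_vector_derivative W1 t - W2 t) (at t within I)"
      by (intro has_vector_derivative_diff S1.V[OF t] S2.V[OF t])
    show "((\<lambda>t. X1 t - X2 t) has_vector_derivative X1' t - X2' t) (at t within I)"
      by (intro has_vector_derivative_diff S1.X[OF t] S2.X[OF t])
    show "((\<lambda>t. \<Theta>1 t - \<Theta>2 t) has_vector_derivative \<Theta>1' t - \<Theta>2' t) (at t within I)"
      by (intro has_vector_derivative_diff S1.\<Theta>[OF t] S2.\<Theta>[OF t])
    show "\<exists>g. dirichlet_laplacian \<Omega> (U1 t - U2 t) g (X1 t - X2 t)"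
      by (rule lap_ex[OF S1.lap_U[OF t] S2.lap_U[OF t]])
    show "\<exists>g. dirichlet_laplacian \<Omega> (V1 t - V2 t) g (X1' t - X2' t)"
      by (rule lap_ex[OF S1.lap_V[OF t] S2.lap_V[OF t]])
    show "\<exists>g. dirichlet_laplacian \<Omega> (X1 t - X2 t) g (XX1 t - XX2 t)"
      by (rule lap_ex[OF S1.lap_X[OF t] S2.lap_X[OF t]])
    show "\<exists>g. dirichlet_laplacian \<Omega> (K1 t - K2 t) g (KK1 t - KK2 t)"
      by (rule lap_ex[OF S1.lap_L[OF t] S2.lap_L[OF t]])
    show "dirichlet_laplacian \<Omega> (\<Theta>1 t - \<Theta>2 t) (\<lambda>i. G1 i t - G2 i t) (K1 t - K2 t)"
      by (rule lap_diff[OF S1.lap_\<Theta>[OF t] S2.lap_\<Theta>[OF t]])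
    assume "t > 0"
    show "\<rho> *\<^sub>R (W1 t - W2 t) = - c *\<^sub>R (XX1 t - XX2 t) + \<eta> *\<^sub>R (K1 t - K2 t)"
      using S1.eq_U[OF t \<open>t > 0\<close>] S2.eq_U[OF t \<open>t > 0\<close>] by (simp add: scaleR_right_diff_distrib)
    show "a *\<^sub>R (\<Theta>1' t - \<Theta>2' t) = b *\<^sub>R (K1 t - K2 t) - d *\<^sub>R (KK1 t - KK2 t) - \<eta> *\<^sub>R (X1' t - X2' t)"
      using S1.eq_\<Theta>[OF t \<open>t > 0\<close>] S2.eq_\<Theta>[OF t \<open>t > 0\<close>] by (simp add: scaleR_right_diff_distrib)
  qed
qed

lemma l2_solution_unique:
  assumes S1: "l2_solution \<Omega> \<rho> a b c d \<eta> I U1 V1 W1 X1 X1' XX1 \<Theta>1 \<Theta>1' K1 KK1 G1"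
    and S2: "l2_solution \<Omega> \<rho> a b c d \<eta> I U2 V2 W2 X2 X2' XX2 \<Theta>2 \<Theta>2' K2 KK2 G2"
    and I: "solution_interval I" and init: "U1 0 = U2 0" "V1 0 = V2 0" "\<Theta>1 0 = \<Theta>2 0" and t: "t \<in> I"
  shows "U1 t = U2 t" "\<Theta>1 t = \<Theta>2 t"
proof -
  interpret D: l2_solution \<Omega> \<rho> a b c d \<eta> I "\<lambda>t. U1 t - U2 t" "\<lambda>t. V1 t - V2 t" "\<lambda>t. W1 t - W2 t"
    "\<lambda>t. X1 t - X2 t" "\<lambda>t. X1' t - X2' t" "\<lambda>t. XX1 t - XX2 t" "\<lambda>t. \<Theta>1 t - \<Theta>2 t"
    "\<lambda>t. \<Theta>1' t - \<Theta>2' t" "\<lambda>t. K1 t - K2 t" "\<lambda>t. KK1 t - KK2 t" "\<lambda>i t. G1 i t - G2 i t"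
    by (rule l2_solution_diff[OF S1 S2])
  \<comment> \<open>T must be positive even for \<open>t = 0\<close>, hence \<open>t + 1\<close> on
    the half-line.\<close>
  have "\<exists>T>0. {0..T} \<subseteq> I \<and> t \<in> {0..T}"
    using I unfolding solution_interval_def
  proof
    assume "\<exists>t1>0. I = {0..t1}"
    then show ?thesis using t by auto
  next
    assume "I = {0..}"
    then show ?thesis using t by (intro exI[of _ "t + 1"]) auto
  qed
  then obtain T where T: "T > 0" "{0..T} \<subseteq> I" "t \<in> {0..T}" by blast
  then have "0 \<in> I" by auto
  have "\<Omega> \<in> sets lebesgue" using D.\<Omega> by auto
  note zero = dirichlet_laplacian_zero[OF this D.lap_\<Theta>[OF t]]
  \<comment> \<open>The difference has zero data, so \<Phi> = 0 solves its auxiliary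
    equation.\<close>
  interpret DP: l2_solution_Phi \<Omega> \<rho> a b c d \<eta> I "\<lambda>t. U1 t - U2 t" "\<lambda>t. V1 t - V2 t" "\<lambda>t. W1 t - W2 t"
    "\<lambda>t. X1 t - X2 t" "\<lambda>t. X1' t - X2' t" "\<lambda>t. XX1 t - XX2 t" "\<lambda>t. \<Theta>1 t - \<Theta>2 t"
    "\<lambda>t. \<Theta>1' t - \<Theta>2' t" "\<lambda>t. K1 t - K2 t" "\<lambda>t. KK1 t - KK2 t" "\<lambda>i t. G1 i t - G2 i t"
    0 "\<lambda>i. 0" 0 0
  proof
    show "dirichlet_laplacian \<Omega> 0 (\<lambda>i. 0) 0" "\<exists>g. dirichlet_laplacian \<Omega> 0 g 0" using zero by blast+
    show "b *\<^sub>R 0 - d *\<^sub>R 0 = a *\<^sub>R (\<Theta>1 0 - \<Theta>2 0) + \<eta> *\<^sub>R (X1 0 - X2 0)"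
      using D.laplacian_zero[OF \<open>0 \<in> I\<close>] init by simp
  qed
  show "U1 t = U2 t" "\<Theta>1 t = \<Theta>2 t"
    using DP.zero_initial_data[OF T(1,2) _ _ _ _ _ T(3)] init by simp_all
qed

text \<open>The derivative promised by \<open>C_time\<close> and the one chosen by
  \<open>tderiv\<close> agree only as classes, at each time; the last conclusion records this so
  that a second derivative can be taken.\<close>

lemma C_time_Suc_L2:
  assumes \<Omega>: "\<Omega> \<in> sets lebesgue" and I: "solution_interval I" and C: "C_time (Suc k) I (L2 \<Omega>) (L2_norm \<Omega>) u"
  shows "\<And>t. t \<in> I \<Longrightarrow> u t \<in> L2 \<Omega>" "\<And>t. t \<in> I \<Longrightarrow> tderiv \<Omega> I u t \<in> L2 \<Omega>"
    "\<And>t. t \<in> I \<Longrightarrow> ((\<lambda>s. emb \<Omega> (u s)) has_vector_derivative emb \<Omega> (tderiv \<Omega> I u t)) (at t within I)"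
    "\<exists>u'. C_time k I (L2 \<Omega>) (L2_norm \<Omega>) u' \<and> (\<forall>t\<in>I. emb \<Omega> (u' t) = emb \<Omega> (tderiv \<Omega> I u t))"
proof -
  obtain u' where u': "C_time k I (L2 \<Omega>) (L2_norm \<Omega>) u'"
    and lim: "\<forall>t\<in>I. ((\<lambda>s. L2_norm \<Omega> (\<lambda>x. (u s x - u t x) / (s - t) - u' t x)) \<longlongrightarrow> 0) (at t within I)"
    using C by auto
  show u: "u t \<in> L2 \<Omega>" if "t \<in> I" for t using C that by simp
  have u'L2: "u' t \<in> L2 \<Omega>" if "t \<in> I" for t using u' that by (cases k) simp_all
  have D: "((\<lambda>s. emb \<Omega> (u s)) has_vector_derivative emb \<Omega> (u' t)) (at t within I)" if "t \<in> I" for t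
    using L2_has_vector_derivative_iff[OF \<Omega> u u'L2[OF that] that] lim that by simp
  note td = tderiv_emb[OF \<Omega> I u u'L2 _ D]
  show "tderiv \<Omega> I u t \<in> L2 \<Omega>" if "t \<in> I" for t by (rule td(1)[OF _ that that that])
  have eq: "emb \<Omega> (tderiv \<Omega> I u t) = emb \<Omega> (u' t)" if "t \<in> I" for t by (rule td(2)[OF _ that that that])
  show "((\<lambda>s. emb \<Omega> (u s)) has_vector_derivative emb \<Omega> (tderiv \<Omega> I u t)) (at t within I)" if "t \<in> I" for t
    unfolding eq[OF that] by (rule D[OF that])
  show "\<exists>u'. C_time k I (L2 \<Omega>) (L2_norm \<Omega>) u' \<and> (\<forall>t\<in>I. emb \<Omega> (u' t) = emb \<Omega> (tderiv \<Omega> I u t))"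
    using u' eq by auto
qed

lemma H4_star_laplacians:
  assumes \<Omega>: "open \<Omega>" and "w \<in> H4_star \<Omega>"
  shows "w \<in> sobolev \<Omega> 2" "laplacian \<Omega> w \<in> sobolev \<Omega> 2"
    "dirichlet_laplacian \<Omega> (emb \<Omega> w) (\<lambda>i. emb_deriv \<Omega> [i] w) (emb \<Omega> (laplacian \<Omega> w))"
    "\<exists>g. dirichlet_laplacian \<Omega> (emb \<Omega> (laplacian \<Omega> w)) g (emb \<Omega> (laplacian \<Omega> (laplacian \<Omega> w)))"
proof -
  have w: "w \<in> sobolev \<Omega> 4" "w \<in> H10 \<Omega>" "laplacian \<Omega> w \<in> H10 \<Omega>"
    using assms(2) by (auto simp: H4_star_def)
  show w2: "w \<in> sobolev \<Omega> 2" by (rule sobolev_mono[OF w(1)]) simp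
  show lw: "laplacian \<Omega> w \<in> sobolev \<Omega> 2"
    by (rule laplacian_sobolev[OF \<Omega>]) (use w in simp)
  show "dirichlet_laplacian \<Omega> (emb \<Omega> w) (\<lambda>i. emb_deriv \<Omega> [i] w) (emb \<Omega> (laplacian \<Omega> w))"
    by (rule dirichlet_laplacian_H10[OF \<Omega> w2 w(2)])
  show "\<exists>g. dirichlet_laplacian \<Omega> (emb \<Omega> (laplacian \<Omega> w)) g (emb \<Omega> (laplacian \<Omega> (laplacian \<Omega> w)))"
    using dirichlet_laplacian_H10[OF \<Omega> lw w(3)] by blast
qed

lemma H4_star_L2:
  assumes \<Omega>: "open \<Omega>" and "w \<in> H4_star \<Omega>"
  shows "w \<in> L2 \<Omega>" "laplacian \<Omega> w \<in> L2 \<Omega>" "laplacian \<Omega> (laplacian \<Omega> w) \<in> L2 \<Omega>"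
  using H4_star_laplacians(1,2)[OF assms] emb_laplacian(1)[OF \<Omega>] by (auto intro: sobolev_L2)

section \<open>Strong solutions as solutions in the Hilbert space\<close>

locale strong_plate_solution =
  fixes \<Omega> :: "'a::euclidean_space set" and \<rho> a b c d \<eta> :: real and u0 v0 \<theta>0 :: "'a \<Rightarrow> real"
    and I :: "real set" and u \<theta> :: "real \<Rightarrow> 'a \<Rightarrow> real"
  assumes \<Omega>: "open \<Omega>" "bounded \<Omega>"
    and params: "\<rho> > 0" "a > 0" "b > 0" "d > 0" "\<eta> \<noteq> 0" "c < 0"
    and I: "solution_interval I"
    and solution: "strong_solution \<Omega> \<rho> a b c d \<eta> u0 v0 \<theta>0 I u \<theta>"
begin

lemma \<Omega>_sets: "\<Omega> \<in> sets lebesgue"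
  using \<Omega> by auto

lemma C_time_solution:
  "C_time (Suc 1) I (L2 \<Omega>) (L2_norm \<Omega>) u"
  "C_time (Suc 0) I (sobolev \<Omega> 2 \<inter> H10 \<Omega>) (sobolev_norm \<Omega> 2) u"
  "C_time 0 I (H4_star \<Omega>) (sobolev_norm \<Omega> 4) u"
  "C_time (Suc 0) I (L2 \<Omega>) (L2_norm \<Omega>) \<theta>"
  "C_time 0 I (H4_star \<Omega>) (sobolev_norm \<Omega> 4) \<theta>"
  using solution by (simp_all add: strong_solution_def numeral_2_eq_2)

lemma H4: "t \<in> I \<Longrightarrow> u t \<in> H4_star \<Omega>" "t \<in> I \<Longrightarrow> \<theta> t \<in> H4_star \<Omega>"
  using C_time_solution(3,5) by simp_all

lemmas u_L2 = C_time_Suc_L2[OF \<Omega>_sets I C_time_solution(1)]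
lemmas \<theta>_L2 = C_time_Suc_L2[OF \<Omega>_sets I C_time_solution(4)]

lemma second_derivative:
  assumes t: "t \<in> I"
  shows "tderiv \<Omega> I (tderiv \<Omega> I u) t \<in> L2 \<Omega>"
    "((\<lambda>s. emb \<Omega> (tderiv \<Omega> I u s)) has_vector_derivative emb \<Omega> (tderiv \<Omega> I (tderiv \<Omega> I u) t)) (at t within I)"
proof -
  obtain u' where u': "C_time (Suc 0) I (L2 \<Omega>) (L2_norm \<Omega>) u'"
      "\<forall>t\<in>I. emb \<Omega> (u' t) = emb \<Omega> (tderiv \<Omega> I u t)"
    using u_L2(4) by auto
  note w = C_time_Suc_L2[OF \<Omega>_sets I u'(1)]
  have D: "((\<lambda>s. emb \<Omega> (tderiv \<Omega> I u s)) has_vector_derivative emb \<Omega> (tderiv \<Omega> I u' t)) (at t within I)"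
    by (rule has_vector_derivative_transform[OF t _ w(3)[OF t]]) (use u'(2) in simp)
  note td = tderiv_emb[OF \<Omega>_sets I u_L2(2) w(2)[OF t] t D]
  show "tderiv \<Omega> I (tderiv \<Omega> I u) t \<in> L2 \<Omega>" by (rule td(1))
  show "((\<lambda>s. emb \<Omega> (tderiv \<Omega> I u s)) has_vector_derivative emb \<Omega> (tderiv \<Omega> I (tderiv \<Omega> I u) t)) (at t within I)"
    using td(2) D by simp
qed

text \<open>u is differentiable in time with values in H^2, and this derivative is the same class as
  the L2 derivative \<open>tderiv\<close>. Hence \<Delta> commutes with the time derivative, and u_t
  inherits the zero trace.\<close>

lemma velocity:
  assumes t: "t \<in> I"
  shows "laplacian \<Omega> (tderiv \<Omega> I u t) \<in> L2 \<Omega>"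
    "((\<lambda>s. emb \<Omega> (laplacian \<Omega> (u s))) has_vector_derivative emb \<Omega> (laplacian \<Omega> (tderiv \<Omega> I u t))) (at t within I)"
    "\<exists>g. dirichlet_laplacian \<Omega> (emb \<Omega> (tderiv \<Omega> I u t)) g (emb \<Omega> (laplacian \<Omega> (tderiv \<Omega> I u t)))"
proof -
  obtain u' where u': "C_time 0 I (sobolev \<Omega> 2 \<inter> H10 \<Omega>) (sobolev_norm \<Omega> 2) u'"
    and lim: "\<forall>t\<in>I. ((\<lambda>s. sobolev_norm \<Omega> 2 (\<lambda>x. (u s x - u t x) / (s - t) - u' t x)) \<longlongrightarrow> 0) (at t within I)"
    using C_time_solution(2) unfolding C_time.simps by blast
  have u't: "u' t \<in> sobolev \<Omega> 2" "u' t \<in> H10 \<Omega>" using u' t by auto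
  have us: "u s \<in> sobolev \<Omega> 2" if "s \<in> I" for s
    by (rule H4_star_laplacians(1)[OF \<Omega>(1) H4(1)[OF that]])
  have D: "((\<lambda>s. emb_deriv \<Omega> \<beta> (u s)) has_vector_derivative emb_deriv \<Omega> \<beta> (u' t)) (at t within I)"
    if "\<beta> \<in> multi_indices 2" for \<beta>
    by (rule emb_deriv_has_vector_derivative[OF \<Omega>(1) us u't(1) t that bspec[OF lim t]])
  have nil: "emb_deriv \<Omega> [] w = emb \<Omega> w" if "w \<in> L2 \<Omega>" for w
    by (rule emb_deriv_eqI[OF \<Omega>(1) that]) (use that in \<open>auto simp: emb_in_l2_on weak_deriv_def\<close>)
  \<comment> \<open>The empty multi-index extracts differentiability in L2 from that in H^2.\<close>
  have "((\<lambda>s. emb_deriv \<Omega> [] (u s)) has_vector_derivative emb_deriv \<Omega> [] (u' t)) (at t within I)"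
    by (rule D) (simp add: multi_indices_def)
  then have "((\<lambda>s. emb \<Omega> (u s)) has_vector_derivative emb \<Omega> (u' t)) (at t within I)"
    unfolding nil[OF sobolev_L2[OF u't(1)]]
    by (rule has_vector_derivative_transform[OF t, rotated]) (simp add: nil u_L2(1))
  from tderiv_emb(2)[where u = u and v = "u' t", OF \<Omega>_sets I _ sobolev_L2[OF u't(1)] t this]
  have eq: "emb \<Omega> (tderiv \<Omega> I u t) = emb \<Omega> (u' t)"
    using u_L2(1) by blast
  note lap = emb_laplacian_cong[OF \<Omega>(1) u't(1) u_L2(2)[OF t] eq]
  show "laplacian \<Omega> (tderiv \<Omega> I u t) \<in> L2 \<Omega>" by (rule lap(1))
  have sum: "((\<lambda>s. \<Sum>i\<in>Basis. emb_deriv \<Omega> [i, i] (u s)) has_vector_derivative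
      (\<Sum>i\<in>Basis. emb_deriv \<Omega> [i, i] (u' t))) (at t within I)"
    by (intro has_vector_derivative_sum D) (simp add: multi_indices_def)
  have "((\<lambda>s. emb \<Omega> (laplacian \<Omega> (u s))) has_vector_derivative
      (\<Sum>i\<in>Basis. emb_deriv \<Omega> [i, i] (u' t))) (at t within I)"
    by (rule has_vector_derivative_transform[OF t _ sum]) (simp add: emb_laplacian(2)[OF \<Omega>(1) us])
  then show "((\<lambda>s. emb \<Omega> (laplacian \<Omega> (u s))) has_vector_derivative emb \<Omega> (laplacian \<Omega> (tderiv \<Omega> I u t))) (at t within I)"
    by (simp only: lap(2) emb_laplacian(2)[OF \<Omega>(1) u't(1)])
  show "\<exists>g. dirichlet_laplacian \<Omega> (emb \<Omega> (tderiv \<Omega> I u t)) g (emb \<Omega> (laplacian \<Omega> (tderiv \<Omega> I u t)))"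
    unfolding lap(2) eq using dirichlet_laplacian_H10[OF \<Omega>(1) u't] by blast
qed

lemma continuous_\<theta>_deriv:
  assumes "\<beta> \<in> multi_indices 4"
  shows "continuous_on I (\<lambda>t. emb_deriv \<Omega> \<beta> (\<theta> t))"
proof (rule emb_deriv_continuous_on[OF \<Omega>(1) _ assms])
  show "\<theta> s \<in> sobolev \<Omega> 4" if "s \<in> I" for s
    using H4(2)[OF that] by (simp add: H4_star_def)
  show "((\<lambda>s. sobolev_norm \<Omega> 4 (\<lambda>x. \<theta> s x - \<theta> t x)) \<longlongrightarrow> 0) (at t within I)" if "t \<in> I" for t
    using C_time_solution(5) that by simp
qed

lemma emb_laplacian_\<theta>: "t \<in> I \<Longrightarrow> emb \<Omega> (laplacian \<Omega> (\<theta> t)) = (\<Sum>i\<in>Basis. emb_deriv \<Omega> [i, i] (\<theta> t))"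
  by (rule emb_laplacian(2)[OF \<Omega>(1) H4_star_laplacians(1)[OF \<Omega>(1) H4(2)]])

sublocale l2_solution \<Omega> \<rho> a b c d \<eta> I "\<lambda>t. emb \<Omega> (u t)" "\<lambda>t. emb \<Omega> (tderiv \<Omega> I u t)"
  "\<lambda>t. emb \<Omega> (tderiv \<Omega> I (tderiv \<Omega> I u) t)" "\<lambda>t. emb \<Omega> (laplacian \<Omega> (u t))"
  "\<lambda>t. emb \<Omega> (laplacian \<Omega> (tderiv \<Omega> I u t))" "\<lambda>t. emb \<Omega> (laplacian \<Omega> (laplacian \<Omega> (u t)))"
  "\<lambda>t. emb \<Omega> (\<theta> t)" "\<lambda>t. emb \<Omega> (tderiv \<Omega> I \<theta> t)" "\<lambda>t. emb \<Omega> (laplacian \<Omega> (\<theta> t))"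
  "\<lambda>t. emb \<Omega> (laplacian \<Omega> (laplacian \<Omega> (\<theta> t)))" "\<lambda>i t. emb_deriv \<Omega> [i] (\<theta> t)"
proof
  show "open \<Omega>" "bounded \<Omega>" "\<rho> > 0" "a > 0" "b > 0" "d > 0" "\<eta> \<noteq> 0" "c < 0"
    using \<Omega> params by auto
  have "continuous_on I (\<lambda>t. \<Sum>i\<in>Basis. emb_deriv \<Omega> [i, i] (\<theta> t))"
    by (intro continuous_on_sum continuous_\<theta>_deriv) (simp add: multi_indices_def)
  then show "continuous_on I (\<lambda>t. emb \<Omega> (laplacian \<Omega> (\<theta> t)))"
    by (simp add: emb_laplacian_\<theta> cong: continuous_on_cong)
  show "continuous_on I (\<lambda>t. emb_deriv \<Omega> [i] (\<theta> t))" if "i \<in> Basis" for i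
    using that by (intro continuous_\<theta>_deriv) (simp add: multi_indices_def)
  fix t assume t: "t \<in> I"
  show "((\<lambda>t. emb \<Omega> (u t)) has_vector_derivative emb \<Omega> (tderiv \<Omega> I u t)) (at t within I)"
    by (rule u_L2(3)[OF t])
  show "((\<lambda>t. emb \<Omega> (tderiv \<Omega> I u t)) has_vector_derivative emb \<Omega> (tderiv \<Omega> I (tderiv \<Omega> I u) t)) (at t within I)"
    by (rule second_derivative(2)[OF t])
  show "((\<lambda>t. emb \<Omega> (laplacian \<Omega> (u t))) has_vector_derivative emb \<Omega> (laplacian \<Omega> (tderiv \<Omega> I u t))) (at t within I)"
    by (rule velocity(2)[OF t])
  show "((\<lambda>t. emb \<Omega> (\<theta> t)) has_vector_derivative emb \<Omega> (tderiv \<Omega> I \<theta> t)) (at t within I)"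
    by (rule \<theta>_L2(3)[OF t])
  note hu = H4_star_laplacians[OF \<Omega>(1) H4(1)[OF t]] and h\<theta> = H4_star_laplacians[OF \<Omega>(1) H4(2)[OF t]]
  show "\<exists>g. dirichlet_laplacian \<Omega> (emb \<Omega> (u t)) g (emb \<Omega> (laplacian \<Omega> (u t)))" using hu(3) by blast
  show "\<exists>g. dirichlet_laplacian \<Omega> (emb \<Omega> (tderiv \<Omega> I u t)) g (emb \<Omega> (laplacian \<Omega> (tderiv \<Omega> I u t)))"
    by (rule velocity(3)[OF t])
  show "\<exists>g. dirichlet_laplacian \<Omega> (emb \<Omega> (laplacian \<Omega> (u t))) g (emb \<Omega> (laplacian \<Omega> (laplacian \<Omega> (u t))))"
    by (rule hu(4))
  show "dirichlet_laplacian \<Omega> (emb \<Omega> (\<theta> t)) (\<lambda>i. emb_deriv \<Omega> [i] (\<theta> t)) (emb \<Omega> (laplacian \<Omega> (\<theta> t)))"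
    by (rule h\<theta>(3))
  show "\<exists>g. dirichlet_laplacian \<Omega> (emb \<Omega> (laplacian \<Omega> (\<theta> t))) g (emb \<Omega> (laplacian \<Omega> (laplacian \<Omega> (\<theta> t))))"
    by (rule h\<theta>(4))
  note uL2 = H4_star_L2[OF \<Omega>(1) H4(1)[OF t]] and \<theta>L2 = H4_star_L2[OF \<Omega>(1) H4(2)[OF t]]
  note cm = L2_cmult[OF \<Omega>_sets] and ecm = emb_cmult[OF \<Omega>_sets]
  assume "t > 0"
  with solution t have eqs:
    "AE x in lebesgue_on \<Omega>. \<rho> * tderiv \<Omega> I (tderiv \<Omega> I u) t x
        = - c * laplacian \<Omega> (laplacian \<Omega> (u t)) x + \<eta> * laplacian \<Omega> (\<theta> t) x"
    "AE x in lebesgue_on \<Omega>. a * tderiv \<Omega> I \<theta> t x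
        = b * laplacian \<Omega> (\<theta> t) x - d * laplacian \<Omega> (laplacian \<Omega> (\<theta> t)) x
          - \<eta> * laplacian \<Omega> (tderiv \<Omega> I u t) x"
    unfolding strong_solution_def by blast+
  have r1: "(\<lambda>x. - c * laplacian \<Omega> (laplacian \<Omega> (u t)) x + \<eta> * laplacian \<Omega> (\<theta> t) x) \<in> L2 \<Omega>"
    by (intro L2_add[OF \<Omega>_sets] cm uL2 \<theta>L2)
  have r2: "(\<lambda>x. b * laplacian \<Omega> (\<theta> t) x - d * laplacian \<Omega> (laplacian \<Omega> (\<theta> t)) x
          - \<eta> * laplacian \<Omega> (tderiv \<Omega> I u t) x) \<in> L2 \<Omega>"
    by (intro L2_diff[OF \<Omega>_sets] cm \<theta>L2 velocity(1)[OF t])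
  have "emb \<Omega> (\<lambda>x. \<rho> * tderiv \<Omega> I (tderiv \<Omega> I u) t x) =
      emb \<Omega> (\<lambda>x. - c * laplacian \<Omega> (laplacian \<Omega> (u t)) x + \<eta> * laplacian \<Omega> (\<theta> t) x)"
    using emb_eq_iff[OF \<Omega>_sets cm[OF second_derivative(1)[OF t]] r1] eqs(1) by simp
  then show "\<rho> *\<^sub>R emb \<Omega> (tderiv \<Omega> I (tderiv \<Omega> I u) t) =
      - c *\<^sub>R emb \<Omega> (laplacian \<Omega> (laplacian \<Omega> (u t))) + \<eta> *\<^sub>R emb \<Omega> (laplacian \<Omega> (\<theta> t))"
    unfolding ecm[OF second_derivative(1)[OF t]] emb_add[OF \<Omega>_sets cm[OF uL2(3)] cm[OF \<theta>L2(2)]]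
      ecm[OF uL2(3)] ecm[OF \<theta>L2(2)] .
  have "emb \<Omega> (\<lambda>x. a * tderiv \<Omega> I \<theta> t x) =
      emb \<Omega> (\<lambda>x. b * laplacian \<Omega> (\<theta> t) x - d * laplacian \<Omega> (laplacian \<Omega> (\<theta> t)) x
          - \<eta> * laplacian \<Omega> (tderiv \<Omega> I u t) x)"
    using emb_eq_iff[OF \<Omega>_sets cm[OF \<theta>_L2(2)[OF t]] r2] eqs(2) by simp
  then show "a *\<^sub>R emb \<Omega> (tderiv \<Omega> I \<theta> t) = b *\<^sub>R emb \<Omega> (laplacian \<Omega> (\<theta> t))
      - d *\<^sub>R emb \<Omega> (laplacian \<Omega> (laplacian \<Omega> (\<theta> t))) - \<eta> *\<^sub>R emb \<Omega> (laplacian \<Omega> (tderiv \<Omega> I u t))"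
    unfolding ecm[OF \<theta>_L2(2)[OF t]]
      emb_diff[OF \<Omega>_sets L2_diff[OF \<Omega>_sets cm[OF \<theta>L2(2)] cm[OF \<theta>L2(3)]] cm[OF velocity(1)[OF t]]]
      emb_diff[OF \<Omega>_sets cm[OF \<theta>L2(2)] cm[OF \<theta>L2(3)]]
      ecm[OF \<theta>L2(2)] ecm[OF \<theta>L2(3)] ecm[OF velocity(1)[OF t]] .
qed

lemma initial_data:
  shows "AE x in lebesgue_on \<Omega>. u 0 x = u0 x" "AE x in lebesgue_on \<Omega>. tderiv \<Omega> I u 0 x = v0 x"
    "AE x in lebesgue_on \<Omega>. \<theta> 0 x = \<theta>0 x"
  using solution by (simp_all add: strong_solution_def)

lemma emb_initial_data:
  assumes "0 \<in> I"
  shows "emb \<Omega> u0 = emb \<Omega> (u 0)" "emb \<Omega> v0 = emb \<Omega> (tderiv \<Omega> I u 0)" "emb \<Omega> \<theta>0 = emb \<Omega> (\<theta> 0)"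
  using L2_AE_cong(2)[OF \<Omega>_sets u_L2(1)[OF assms] initial_data(1)]
    L2_AE_cong(2)[OF \<Omega>_sets u_L2(2)[OF assms] initial_data(2)]
    L2_AE_cong(2)[OF \<Omega>_sets \<theta>_L2(1)[OF assms] initial_data(3)] by simp_all

lemma energy_emb:
  assumes "t \<in> I"
  shows "energy \<Omega> \<rho> a c I u \<theta> t = 1 / 2 * (\<rho> * (emb \<Omega> (tderiv \<Omega> I u t) \<bullet> emb \<Omega> (tderiv \<Omega> I u t))
    + c * (emb \<Omega> (laplacian \<Omega> (u t)) \<bullet> emb \<Omega> (laplacian \<Omega> (u t))) + a * (emb \<Omega> (\<theta> t) \<bullet> emb \<Omega> (\<theta> t)))"
proof -
  let ?f = "\<lambda>i::nat. if i = 0 then tderiv \<Omega> I u t else if i = 1 then laplacian \<Omega> (u t) else \<theta> t"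
  let ?r = "\<lambda>i::nat. if i = 0 then \<rho> else if i = 1 then c else a"
  have "(\<integral>x. (\<Sum>i\<in>{0, 1, 2}. ?r i * (?f i x)\<^sup>2) \<partial>lebesgue_on \<Omega>)
      = (\<Sum>i\<in>{0, 1, 2}. ?r i * (emb \<Omega> (?f i) \<bullet> emb \<Omega> (?f i)))"
    by (rule L2_integral_squares[OF \<Omega>_sets])
       (auto intro: u_L2(2)[OF assms] \<theta>_L2(1)[OF assms] H4_star_L2(2)[OF \<Omega>(1) H4(1)[OF assms]])
  then show ?thesis
    by (simp add: energy_def add.assoc)
qed

lemma laplacian_u0:
  assumes "0 \<in> I"
  shows "laplacian \<Omega> u0 \<in> L2 \<Omega>" "emb \<Omega> (laplacian \<Omega> u0) = emb \<Omega> (laplacian \<Omega> (u 0))"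
  using emb_laplacian_cong[OF \<Omega>(1) H4_star_laplacians(1)[OF \<Omega>(1) H4(1)[OF assms]]]
    L2_AE_cong[OF \<Omega>_sets u_L2(1)[OF assms] initial_data(1)] by simp_all

text \<open>Differentiation under the time integral: continuity of \<theta> in H^4 makes each of its
  derivatives a continuous curve in L2, and weak derivatives commute with integrals. The resulting
  formulas are those that define \<open>Z\<close>.\<close>

lemma Psi_emb:
  assumes s: "0 \<le> s" "{0..s} \<subseteq> I" and \<Phi>: "\<Phi> \<in> H4_star \<Omega>"
  shows "\<And>i. i \<in> Basis \<Longrightarrow> wderiv \<Omega> [i] (Psi \<Omega> \<Phi> \<theta> s) \<in> L2 \<Omega>"
    "\<And>i. i \<in> Basis \<Longrightarrow> emb_deriv \<Omega> [i] (Psi \<Omega> \<Phi> \<theta> s) =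
       emb_deriv \<Omega> [i] \<Phi> + integral {0..s} (\<lambda>t. emb_deriv \<Omega> [i] (\<theta> t))"
    "laplacian \<Omega> (Psi \<Omega> \<Phi> \<theta> s) \<in> L2 \<Omega>"
    "emb \<Omega> (laplacian \<Omega> (Psi \<Omega> \<Phi> \<theta> s)) =
       emb \<Omega> (laplacian \<Omega> \<Phi>) + integral {0..s} (\<lambda>t. emb \<Omega> (laplacian \<Omega> (\<theta> t)))"
proof -
  let ?f = "Psi \<Omega> \<Phi> \<theta> s"
  have cont_\<theta>: "continuous_on {0..s} (\<lambda>t. emb \<Omega> (\<theta> t))"
    unfolding continuous_on_eq_continuous_within
    using has_vector_derivative_within_subset[OF \<theta>_L2(3) s(2)] s(2) has_vector_derivative_continuous by blast
  have \<theta>L2: "\<theta> t \<in> L2 \<Omega>" if "t \<in> {0..s}" for t using that s(2) by (intro \<theta>_L2(1)) auto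
  have \<theta>4: "\<theta> t \<in> sobolev \<Omega> 4" if "t \<in> {0..s}" for t
    using H4(2)[of t] that s(2) by (auto simp: H4_star_def)
  have \<Phi>4: "\<Phi> \<in> sobolev \<Omega> 4" using \<Phi> by (simp add: H4_star_def)
  note ti = time_integral_emb[OF \<Omega>_sets s(1) \<theta>L2 cont_\<theta>]
  have f: "?f \<in> L2 \<Omega>" "emb \<Omega> ?f = emb \<Omega> \<Phi> + integral {0..s} (\<lambda>t. emb \<Omega> (\<theta> t))"
    unfolding Psi_def using L2_add[OF \<Omega>_sets ti(1) sobolev_L2[OF \<Phi>4]]
      emb_add[OF \<Omega>_sets ti(1) sobolev_L2[OF \<Phi>4]] ti(2) by (simp_all add: add.commute)
  have int: "(\<lambda>t. emb_deriv \<Omega> \<beta> (\<theta> t)) integrable_on {0..s}" if "\<beta> \<in> multi_indices 4" for \<beta>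
    by (rule integrable_continuous_interval[OF continuous_on_subset[OF continuous_\<theta>_deriv[OF that] s(2)]])
  have D: "wderiv \<Omega> \<beta> ?f \<in> L2 \<Omega>"
    "emb_deriv \<Omega> \<beta> ?f = emb_deriv \<Omega> \<beta> \<Phi> + integral {0..s} (\<lambda>t. emb_deriv \<Omega> \<beta> (\<theta> t))"
    if \<beta>: "\<beta> \<in> multi_indices 4" for \<beta>
  proof -
    note d = sobolev_emb_deriv(2,3)[OF \<Omega>(1) _ \<beta>]
    have mem: "emb_deriv \<Omega> \<beta> \<Phi> + integral {0..s} (\<lambda>t. emb_deriv \<Omega> \<beta> (\<theta> t)) \<in> l2_on \<Omega>"
      by (intro subspace_add subspace_l2_on[OF \<Omega>_sets] d(2)[OF \<Phi>4] l2_on_integral[OF \<Omega>_sets int[OF \<beta>]] d(2)[OF \<theta>4])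
    have wd: "weak_deriv \<Omega> \<beta> (emb \<Omega> ?f) (emb_deriv \<Omega> \<beta> \<Phi> + integral {0..s} (\<lambda>t. emb_deriv \<Omega> \<beta> (\<theta> t)))"
      unfolding f(2)
      by (intro weak_deriv_add d(1)[OF \<Phi>4] weak_deriv_integral[OF integrable_continuous_interval[OF cont_\<theta>] int[OF \<beta>]]
          d(1)[OF \<theta>4])
    show "wderiv \<Omega> \<beta> ?f \<in> L2 \<Omega>"
      "emb_deriv \<Omega> \<beta> ?f = emb_deriv \<Omega> \<beta> \<Phi> + integral {0..s} (\<lambda>t. emb_deriv \<Omega> \<beta> (\<theta> t))"
      by (rule emb_deriv_eqI[OF \<Omega>(1) f(1) mem wd multi_indicesD[OF \<beta>]])+
  qed
  have mi: "[i] \<in> multi_indices 4" "[i, i] \<in> multi_indices 4" if "i \<in> Basis" for i :: 'a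
    using that by (simp_all add: multi_indices_def)
  show "wderiv \<Omega> [i] ?f \<in> L2 \<Omega>"
    "emb_deriv \<Omega> [i] ?f = emb_deriv \<Omega> [i] \<Phi> + integral {0..s} (\<lambda>t. emb_deriv \<Omega> [i] (\<theta> t))" if "i \<in> Basis" for i
    by (rule D[OF mi(1)[OF that]])+
  show "laplacian \<Omega> ?f \<in> L2 \<Omega>"
    unfolding laplacian_def[abs_def] by (rule L2_sum[OF \<Omega>_sets D(1)[OF mi(2)]])
  have "emb \<Omega> (laplacian \<Omega> ?f) = (\<Sum>i\<in>Basis. emb_deriv \<Omega> [i, i] ?f)"
    unfolding laplacian_def[abs_def] emb_deriv_def by (rule emb_sum[OF \<Omega>_sets D(1)[OF mi(2)]])
  also have "\<dots> = (\<Sum>i\<in>Basis. emb_deriv \<Omega> [i, i] \<Phi> + integral {0..s} (\<lambda>t. emb_deriv \<Omega> [i, i] (\<theta> t)))"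
    by (intro sum.cong refl D(2)[OF mi(2)])
  also have "\<dots> = emb \<Omega> (laplacian \<Omega> \<Phi>) + integral {0..s} (\<lambda>t. \<Sum>i\<in>Basis. emb_deriv \<Omega> [i, i] (\<theta> t))"
    unfolding sum.distrib emb_laplacian(2)[OF \<Omega>(1) H4_star_laplacians(1)[OF \<Omega>(1) \<Phi>]]
    by (subst Henstock_Kurzweil_Integration.integral_sum) (use int mi in auto)
  also have "integral {0..s} (\<lambda>t. \<Sum>i\<in>Basis. emb_deriv \<Omega> [i, i] (\<theta> t)) = integral {0..s} (\<lambda>t. emb \<Omega> (laplacian \<Omega> (\<theta> t)))"
    using s(2) by (intro Henstock_Kurzweil_Integration.integral_cong) (auto simp: emb_laplacian_\<theta>)
  finally show "emb \<Omega> (laplacian \<Omega> ?f) =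
       emb \<Omega> (laplacian \<Omega> \<Phi>) + integral {0..s} (\<lambda>t. emb \<Omega> (laplacian \<Omega> (\<theta> t)))" .
qed

end

lemma strong_solution_exponentially_unstable:
  assumes "strong_plate_solution \<Omega> \<rho> a b c d \<eta> u0 v0 \<theta>0 {0..} u \<theta>"
    and \<Phi>: "solves_Phi \<Omega> a b d \<eta> u0 \<theta>0 \<Phi>"
    and start: "energy \<Omega> \<rho> a c {0..} u \<theta> 0 < 0 \<or> energy \<Omega> \<rho> a c {0..} u \<theta> 0 = 0 \<and>
      (\<exists>D>0. (F_fun \<Omega> \<rho> b d \<Phi> 0 0 u \<theta> has_real_derivative D) (at 0 within {0..}))"
  shows "exponentially_unstable \<Omega> \<rho> b d \<Phi> (- energy \<Omega> \<rho> a c {0..} u \<theta> 0) u \<theta>"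
proof -
  interpret S: strong_plate_solution \<Omega> \<rho> a b c d \<eta> u0 v0 \<theta>0 "{0..}" u \<theta> by fact
  note \<Omega> = S.\<Omega>_sets
  have \<Phi>4: "\<Phi> \<in> H4_star \<Omega>" and \<Phi>_eq: "AE x in lebesgue_on \<Omega>. b * laplacian \<Omega> \<Phi> x - d * laplacian \<Omega> (laplacian \<Omega> \<Phi>) x
        = a * \<theta>0 x + \<eta> * laplacian \<Omega> u0 x"
    using \<Phi> by (auto simp: solves_Phi_def)
  interpret G: l2_global_solution \<Omega> \<rho> a b c d \<eta> "\<lambda>t. emb \<Omega> (u t)" "\<lambda>t. emb \<Omega> (tderiv \<Omega> {0..} u t)"
    "\<lambda>t. emb \<Omega> (tderiv \<Omega> {0..} (tderiv \<Omega> {0..} u) t)" "\<lambda>t. emb \<Omega> (laplacian \<Omega> (u t))"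
    "\<lambda>t. emb \<Omega> (laplacian \<Omega> (tderiv \<Omega> {0..} u t))" "\<lambda>t. emb \<Omega> (laplacian \<Omega> (laplacian \<Omega> (u t)))"
    "\<lambda>t. emb \<Omega> (\<theta> t)" "\<lambda>t. emb \<Omega> (tderiv \<Omega> {0..} \<theta> t)" "\<lambda>t. emb \<Omega> (laplacian \<Omega> (\<theta> t))"
    "\<lambda>t. emb \<Omega> (laplacian \<Omega> (laplacian \<Omega> (\<theta> t)))" "\<lambda>i t. emb_deriv \<Omega> [i] (\<theta> t)"
    "emb \<Omega> \<Phi>" "\<lambda>i. emb_deriv \<Omega> [i] \<Phi>" "emb \<Omega> (laplacian \<Omega> \<Phi>)" "emb \<Omega> (laplacian \<Omega> (laplacian \<Omega> \<Phi>))"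
  proof
    note h = H4_star_laplacians[OF S.\<Omega>(1) \<Phi>4]
    show "dirichlet_laplacian \<Omega> (emb \<Omega> \<Phi>) (\<lambda>i. emb_deriv \<Omega> [i] \<Phi>) (emb \<Omega> (laplacian \<Omega> \<Phi>))" by (rule h(3))
    show "\<exists>g. dirichlet_laplacian \<Omega> (emb \<Omega> (laplacian \<Omega> \<Phi>)) g (emb \<Omega> (laplacian \<Omega> (laplacian \<Omega> \<Phi>)))" by (rule h(4))
    have zero: "(0::real) \<in> {0..}" by simp
    note cm = L2_cmult[OF \<Omega>] and ecm = emb_cmult[OF \<Omega>]
    note \<Phi>L2 = H4_star_L2[OF S.\<Omega>(1) \<Phi>4] and \<theta>L2 = S.\<theta>_L2(1)[OF zero] and lap0 = S.laplacian_u0[OF zero]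
    have "AE x in lebesgue_on \<Omega>. b * laplacian \<Omega> \<Phi> x - d * laplacian \<Omega> (laplacian \<Omega> \<Phi>) x
        = a * \<theta> 0 x + \<eta> * laplacian \<Omega> u0 x"
      using \<Phi>_eq S.initial_data(3) by eventually_elim simp
    then have "emb \<Omega> (\<lambda>x. b * laplacian \<Omega> \<Phi> x - d * laplacian \<Omega> (laplacian \<Omega> \<Phi>) x)
        = emb \<Omega> (\<lambda>x. a * \<theta> 0 x + \<eta> * laplacian \<Omega> u0 x)"
      using emb_eq_iff[OF \<Omega> L2_diff[OF \<Omega> cm[OF \<Phi>L2(2)] cm[OF \<Phi>L2(3)]] L2_add[OF \<Omega> cm[OF \<theta>L2] cm[OF lap0(1)]]]
      by simp
    then show "b *\<^sub>R emb \<Omega> (laplacian \<Omega> \<Phi>) - d *\<^sub>R emb \<Omega> (laplacian \<Omega> (laplacian \<Omega> \<Phi>)) =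
        a *\<^sub>R emb \<Omega> (\<theta> 0) + \<eta> *\<^sub>R emb \<Omega> (laplacian \<Omega> (u 0))"
      unfolding emb_diff[OF \<Omega> cm[OF \<Phi>L2(2)] cm[OF \<Phi>L2(3)]] emb_add[OF \<Omega> cm[OF \<theta>L2] cm[OF lap0(1)]]
        ecm[OF \<Phi>L2(2)] ecm[OF \<Phi>L2(3)] ecm[OF \<theta>L2] ecm[OF lap0(1)] lap0(2) .
  qed
  interpret P: thermoelastic_plate 1 \<rho> a c \<eta> grad_lap_index S.wt "\<lambda>t. emb \<Omega> (u t)" "\<lambda>t. emb \<Omega> (tderiv \<Omega> {0..} u t)"
    "\<lambda>t. emb \<Omega> (tderiv \<Omega> {0..} (tderiv \<Omega> {0..} u) t)" "\<lambda>t. emb \<Omega> (laplacian \<Omega> (u t))"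
    "\<lambda>t. emb \<Omega> (laplacian \<Omega> (tderiv \<Omega> {0..} u t))" "\<lambda>t. emb \<Omega> (\<theta> t)" "\<lambda>t. emb \<Omega> (tderiv \<Omega> {0..} \<theta> t)" S.Y G.Z
    by (rule G.plate) simp
  \<comment> \<open>Passes from integrals of representatives to the abstract functional. It is used
    with \<omega> = 0 for the derivative at 0 and with \<omega> = -E(0) for the growth.\<close>
  have F_eq: "F_fun \<Omega> \<rho> b d \<Phi> \<omega> 0 u \<theta> t = P.Fn \<omega> t" if t: "t \<ge> 0" for \<omega> t
  proof -
    have "(\<integral>x. b * grad_sq \<Omega> (Psi \<Omega> \<Phi> \<theta> s) x + d * (laplacian \<Omega> (Psi \<Omega> \<Phi> \<theta> s) x)\<^sup>2 \<partial>lebesgue_on \<Omega>) = P.BZZ s"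
      if s: "s \<in> {0..t}" for s
    proof -
      have s0: "0 \<le> s" "{0..s} \<subseteq> {0..}" using s by auto
      note psi = S.Psi_emb[OF s0 \<Phi>4]
      let ?f = "grad_lap (laplacian \<Omega> (Psi \<Omega> \<Phi> \<theta> s)) (\<lambda>i. wderiv \<Omega> [i] (Psi \<Omega> \<Phi> \<theta> s))"
      have "(\<integral>x. b * grad_sq \<Omega> (Psi \<Omega> \<Phi> \<theta> s) x + d * (laplacian \<Omega> (Psi \<Omega> \<Phi> \<theta> s) x)\<^sup>2 \<partial>lebesgue_on \<Omega>)
          = (\<integral>x. (\<Sum>j\<in>grad_lap_index. S.wt j * (?f j x)\<^sup>2) \<partial>lebesgue_on \<Omega>)"
        unfolding sum_grad_lap_index grad_sq_def sum_distrib_left grad_lap_simps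
        by (intro arg_cong[of _ _ "integral\<^sup>L (lebesgue_on \<Omega>)"] ext) (rule add.commute)
      also have "(\<integral>x. (\<Sum>j\<in>grad_lap_index. S.wt j * (?f j x)\<^sup>2) \<partial>lebesgue_on \<Omega>)
          = (\<Sum>j\<in>grad_lap_index. S.wt j * (emb \<Omega> (?f j) \<bullet> emb \<Omega> (?f j)))"
      proof (rule L2_integral_squares[OF \<Omega>])
        show "?f j \<in> L2 \<Omega>" if "j \<in> grad_lap_index" for j
        proof (cases j)
          case None
          then show ?thesis using psi(3) by simp
        next
          case (Some i)
          then have "i \<in> Basis" using that by (auto simp: grad_lap_index_def)
          from psi(1)[OF this] show ?thesis by (simp add: Some)
        qed
      qed
      also have "\<dots> = P.BZZ s"
        unfolding P.BZZ_def
      proof (rule sum.cong[OF refl])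
        fix j :: "'a option" assume j: "j \<in> grad_lap_index"
        have "emb \<Omega> (?f j) = G.Z j s"
        proof (cases j)
          case None
          then show ?thesis using psi(4) by (simp add: G.Z_def)
        next
          case (Some i)
          then have "i \<in> Basis" using j by (auto simp: grad_lap_index_def)
          from psi(2)[OF this] show ?thesis
            unfolding G.Z_def Some by (simp add: emb_deriv_def[of _ _ "Psi _ _ _ _"])
        qed
        then show "S.wt j * (emb \<Omega> (?f j) \<bullet> emb \<Omega> (?f j)) = S.wt j * (G.Z j s \<bullet> G.Z j s)" by simp
      qed
      finally show ?thesis .
    qed
    then have "integral {0..t} (\<lambda>s. \<integral>x. b * grad_sq \<Omega> (Psi \<Omega> \<Phi> \<theta> s) x
        + d * (laplacian \<Omega> (Psi \<Omega> \<Phi> \<theta> s) x)\<^sup>2 \<partial>lebesgue_on \<Omega>) = integral {0..t} P.BZZ"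
      by (rule Henstock_Kurzweil_Integration.integral_cong)
    moreover have "(\<integral>x. \<rho> * (u t x)\<^sup>2 \<partial>lebesgue_on \<Omega>) = \<rho> * (emb \<Omega> (u t) \<bullet> emb \<Omega> (u t))"
      by (rule L2_integral_square[OF \<Omega> S.u_L2(1)]) (use t in simp)
    ultimately show ?thesis
      unfolding F_fun_def P.Fn_def by (simp only: add_0_right)
  qed
  define \<omega> where "\<omega> = - energy \<Omega> \<rho> a c {0..} u \<theta> 0"
  have En: "P.En 0 = - \<omega>"
    using S.energy_emb[of 0] by (simp add: \<omega>_def P.En_def)
  have "\<omega> > 0 \<or> \<omega> = 0 \<and> P.Fn' 0 0 > 0"
    using start
  proof
    assume *: "energy \<Omega> \<rho> a c {0..} u \<theta> 0 = 0 \<and>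
      (\<exists>D>0. (F_fun \<Omega> \<rho> b d \<Phi> 0 0 u \<theta> has_real_derivative D) (at 0 within {0..}))"
    then obtain D where D: "D > 0" "(F_fun \<Omega> \<rho> b d \<Phi> 0 0 u \<theta> has_real_derivative D) (at 0 within {0..})" by blast
    \<comment> \<open>The hypothesis provides some one-sided derivative \<open>D\<close>;
      derivatives within [0, 1] are unique, so \<open>D\<close> is the value of \<open>Fn'\<close>
      at 0.\<close>
    have "(F_fun \<Omega> \<rho> b d \<Phi> 0 0 u \<theta> has_vector_derivative D) (at 0 within {0..1})"
      using has_field_derivative_subset[OF D(2), of "{0..1}"] by (simp add: has_real_derivative_iff_has_vector_derivative)
    from has_vector_derivative_transform[OF _ _ this, of "P.Fn 0"]
    have 1: "(P.Fn 0 has_vector_derivative D) (at 0 within {0..1})"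
      by (simp add: F_eq)
    have 2: "(P.Fn 0 has_vector_derivative P.Fn' 0 0) (at 0 within {0..1})"
      using P.Fn_deriv[of 0 0] by (simp add: has_real_derivative_iff_has_vector_derivative)
    have "D = P.Fn' 0 0"
      by (rule vector_derivative_unique_within[OF _ 1 2]) (simp add: trivial_limit_within)
    then show ?thesis using * D(1) by (simp add: \<omega>_def)
  qed (simp add: \<omega>_def)
  then have "\<exists>C1>0. \<exists>\<kappa>>0. \<exists>C2\<ge>0. \<forall>t\<ge>0. P.Fn \<omega> t \<ge> C1 * exp (\<kappa> * t) - C2"
    by (rule G.growth[OF En])
  then obtain C1 \<kappa> C2 where C: "C1 > 0" "\<kappa> > 0" "C2 \<ge> 0" "\<forall>t\<ge>0. P.Fn \<omega> t \<ge> C1 * exp (\<kappa> * t) - C2"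
    by blast
  have "\<forall>t\<ge>0. F_fun \<Omega> \<rho> b d \<Phi> \<omega> 0 u \<theta> t \<ge> C1 * exp (\<kappa> * t) - C2"
  proof (intro allI impI)
    fix t :: real assume t: "0 \<le> t"
    show "F_fun \<Omega> \<rho> b d \<Phi> \<omega> 0 u \<theta> t \<ge> C1 * exp (\<kappa> * t) - C2"
      unfolding F_eq[OF t] using C(4) t by blast
  qed
  then show ?thesis
    unfolding exponentially_unstable_def \<omega>_def[symmetric] using C(1-3)
    by (intro exI[of _ "0::real"] exI[of _ C1] exI[of _ \<kappa>] exI[of _ C2] conjI order_refl)
qed

lemma strong_solution_unique:
  assumes "strong_plate_solution \<Omega> \<rho> a b c d \<eta> u0 v0 \<theta>0 I u \<theta>"
    and "strong_plate_solution \<Omega> \<rho> a b c d \<eta> u0 v0 \<theta>0 I u' \<theta>'" and t: "t \<in> I"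
  shows "AE x in lebesgue_on \<Omega>. u t x = u' t x \<and> \<theta> t x = \<theta>' t x"
proof -
  interpret S1: strong_plate_solution \<Omega> \<rho> a b c d \<eta> u0 v0 \<theta>0 I u \<theta> by fact
  interpret S2: strong_plate_solution \<Omega> \<rho> a b c d \<eta> u0 v0 \<theta>0 I u' \<theta>' by fact
  have zero: "0 \<in> I" using S1.I by (auto simp: solution_interval_def)
  have eq: "emb \<Omega> (u t) = emb \<Omega> (u' t)" "emb \<Omega> (\<theta> t) = emb \<Omega> (\<theta>' t)"
    using l2_solution_unique[OF S1.l2_solution_axioms S2.l2_solution_axioms S1.I _ _ _ t]
      S1.emb_initial_data[OF zero] S2.emb_initial_data[OF zero] by simp_all
  have "AE x in lebesgue_on \<Omega>. u t x = u' t x" "AE x in lebesgue_on \<Omega>. \<theta> t x = \<theta>' t x"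
    using eq emb_eq_iff[OF S1.\<Omega>_sets S1.u_L2(1)[OF t] S2.u_L2(1)[OF t]]
      emb_eq_iff[OF S1.\<Omega>_sets S1.\<theta>_L2(1)[OF t] S2.\<theta>_L2(1)[OF t]] by simp_all
  then show ?thesis by eventually_elim simp
qed

theorem theorem6p1:
  fixes \<Omega> :: "'a::euclidean_space set"
    and \<rho> a b c d \<eta> :: real
    and u0 v0 \<theta>0 :: "'a \<Rightarrow> real"
  assumes "bounded_smooth_domain \<Omega>"
    and "\<rho> > 0" and "a > 0" and "b > 0" and "d > 0" and "\<eta> \<noteq> 0" and "c < 0"
  shows "(\<forall>I u \<theta> u' \<theta>'. solution_interval I
            \<longrightarrow> strong_solution \<Omega> \<rho> a b c d \<eta> u0 v0 \<theta>0 I u \<theta>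
            \<longrightarrow> strong_solution \<Omega> \<rho> a b c d \<eta> u0 v0 \<theta>0 I u' \<theta>'
            \<longrightarrow> (\<forall>t\<in>I. AE x in lebesgue_on \<Omega>. u t x = u' t x \<and> \<theta> t x = \<theta>' t x))
       \<and> (\<forall>u \<theta> \<Phi>. strong_solution \<Omega> \<rho> a b c d \<eta> u0 v0 \<theta>0 {0..} u \<theta>
            \<longrightarrow> solves_Phi \<Omega> a b d \<eta> u0 \<theta>0 \<Phi>
            \<longrightarrow> (energy \<Omega> \<rho> a c {0..} u \<theta> 0 < 0 \<or>
                 energy \<Omega> \<rho> a c {0..} u \<theta> 0 = 0 \<and>
                 (\<exists>D>0. (F_fun \<Omega> \<rho> b d \<Phi> 0 0 u \<theta> has_real_derivative D) (at 0 within {0..})))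
            \<longrightarrow> exponentially_unstable \<Omega> \<rho> b d \<Phi> (- energy \<Omega> \<rho> a c {0..} u \<theta> 0) u \<theta>)"
proof (intro conjI allI impI ballI)
  have plate: "strong_plate_solution \<Omega> \<rho> a b c d \<eta> u0 v0 \<theta>0 I u \<theta>"
    if "solution_interval I" "strong_solution \<Omega> \<rho> a b c d \<eta> u0 v0 \<theta>0 I u \<theta>" for I u \<theta>
    using that assms by unfold_locales (simp_all add: bounded_smooth_domain_def)
  show "AE x in lebesgue_on \<Omega>. u t x = u' t x \<and> \<theta> t x = \<theta>' t x"
    if "solution_interval I" "strong_solution \<Omega> \<rho> a b c d \<eta> u0 v0 \<theta>0 I u \<theta>"
      "strong_solution \<Omega> \<rho> a b c d \<eta> u0 v0 \<theta>0 I u' \<theta>'" "t \<in> I" for I u \<theta> u' \<theta>' t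
    by (rule strong_solution_unique[OF plate[OF that(1,2)] plate[OF that(1,3)] that(4)])
  have I: "solution_interval {0..}" by (simp add: solution_interval_def)
  show "exponentially_unstable \<Omega> \<rho> b d \<Phi> (- energy \<Omega> \<rho> a c {0..} u \<theta> 0) u \<theta>"
    if "strong_solution \<Omega> \<rho> a b c d \<eta> u0 v0 \<theta>0 {0..} u \<theta>" "solves_Phi \<Omega> a b d \<eta> u0 \<theta>0 \<Phi>"
      "energy \<Omega> \<rho> a c {0..} u \<theta> 0 < 0 \<or> energy \<Omega> \<rho> a c {0..} u \<theta> 0 = 0 \<and>
       (\<exists>D>0. (F_fun \<Omega> \<rho> b d \<Phi> 0 0 u \<theta> has_real_derivative D) (at 0 within {0..}))" for u \<theta> \<Phi>
    by (rule strong_solution_exponentially_unstable[OF plate[OF I that(1)] that(2,3)])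
qed

end
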